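(* Let ${\mathcal G}=(B\cup W,E)$ be a finite bipartite graph embedded in the plane (without boundary vertices), each of whose bounded faces is bounded by a simple cycle, with vertex multiplicities $\mathbf n$ satisfying $\sum_{b\in B}n_b=\sum_{w\in W}n_w$, a choice of cilia, a connection $\Phi$, and a Kasteleyn sign function $\epsilon$. Let $\widetilde K$ be the square matrix with rows indexed by pairs $(w,i)$, $w\in W$, $1\le i\le n_w$, columns indexed by pairs $(b,j)$, $b\in B$, $1\le j\le n_b$, and entries $\widetilde K_{(w,i),(b,j)}=\epsilon_{bw}(\phi_{bw})_{ij}$ if $b\sim w$ and $0$ otherwise. Then $$\det\widetilde K=\pm\sum_{m\in\Omega_{\mathbf n}({\mathcal G})}\mathrm{Tr}_\Phi(m),$$ with a sign $\pm$ independent of $\Phi$ and of $m$.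
   Context: A vertex multiplicity is a function $\mathbf n:B\cup W\to\mathbb Z_{>0}$, $v\mapsto n_v$. An $\mathbf n$-multiweb is a function $m:E\to\mathbb Z_{\ge0}$ with $\sum_{u\sim v}m_{uv}=n_v$ for every vertex $v$; $\Omega_{\mathbf n}({\mathcal G})$ is the set of $\mathbf n$-multiwebs. A connection $\Phi=\{\phi_{bw}\}_{bw\in E}$ assigns to each edge $bw$ ($b$ black, $w$ white) a real $n_w\times n_b$ matrix $\phi_{bw}$. A choice of cilia assigns to each vertex $v$ a distinguished wedge between two cyclically consecutive incident edges (the cilium "lies in" the face containing it); it determines a total order ("edge order") of the edges at $v$: at a black vertex, counterclockwise starting just after the cilium; at a white vertex, clockwise starting just after the cilium. A Kasteleyn sign function is a map $\epsilon:E\to\{\pm1\}$ such that for every bounded face $f$, whose boundary has length $2\ell$, $\prod_{e\in\partial f}\epsilon_e=(-1)^{\ell+1+k_f}$, where $k_f$ is the number of vertices $v$ on $\partial f$ with $n_v$ even whose cilium lies in $f$. Trace. Let $\mathcal C_v=\{1,\dots,n_v\}$. A coloring of $m\in\Omega_{\mathbf n}({\mathcal G})$ assigns to each edge $e=bw$ with $m_e>0$ subsets $S_e\subset\mathcal C_b$, $T_e\subset\mathcal C_w$ of size $m_e$ such that at each black $b$ the sets $S_{bw}$ partition $\mathcal C_b$ and at each white $w$ the sets $T_{bw}$ partition $\mathcal C_w$. The sign $c_b$ is the signature of the permutation of $\mathcal C_b$ obtained by listing the sets $S_{bw}$ in the edge order at $b$, each in increasing order; $c_w$ is defined likewise with the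 sets $T_{bw}$ in the edge order at $w$. Then $\mathrm{Tr}_\Phi(m)=\sum_C\prod_v c_v\prod_{e=bw:\,m_e>0}\det[(\phi_{bw})_{T_e,S_e}]$, summing over colorings $C$, where $(\phi)_{T,S}$ is the submatrix with rows $T$ and columns $S$ in increasing order. *)

theory Defs
  imports "HOL-Combinatorics.Permutations" "Jordan_Normal_Form.Determinant"
begin

text \<open>Vertices have type 'v; B (black) and W (white) are finite disjoint sets.
  Edges are pairs (b,w) with b black and w white (simple graph).
  The planar embedding is encoded combinatorially by a rotation system:
  rot v is the counterclockwise successor among the neighbours of v.\<close>

definition nbrs :: "('v \<times> 'v) set \<Rightarrow> 'v \<Rightarrow> 'v set" where
  "nbrs E v = {u. (v, u) \<in> E \<or> (u, v) \<in> E}"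

definition darts :: "('v \<times> 'v) set \<Rightarrow> ('v \<times> 'v) set" where
  "darts E = {(u, v). (u, v) \<in> E \<or> (v, u) \<in> E}"

definition is_rotation :: "('v \<times> 'v) set \<Rightarrow> 'v set \<Rightarrow> ('v \<Rightarrow> 'v \<Rightarrow> 'v) \<Rightarrow> bool" where
  "is_rotation E V rot \<longleftrightarrow>
     (\<forall>v\<in>V. bij_betw (rot v) (nbrs E v) (nbrs E v) \<and>
            (\<forall>u\<in>nbrs E v. \<forall>u'\<in>nbrs E v. \<exists>k. (rot v ^^ k) u = u'))"

definition rot_inv :: "('v \<times> 'v) set \<Rightarrow> ('v \<Rightarrow> 'v \<Rightarrow> 'v) \<Rightarrow> 'v \<Rightarrow> 'v \<Rightarrow> 'v" where
  "rot_inv E rot v = inv_into (nbrs E v) (rot v)"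

text \<open>Face permutation on darts: the face lies to the left of each dart (x,v) of its
  boundary walk; after arriving at v from x one leaves along the clockwise successor of x.\<close>
definition face_step :: "('v \<times> 'v) set \<Rightarrow> ('v \<Rightarrow> 'v \<Rightarrow> 'v) \<Rightarrow> 'v \<times> 'v \<Rightarrow> 'v \<times> 'v" where
  "face_step E rot d = (snd d, rot_inv E rot (snd d) (fst d))"

definition face_of :: "('v \<times> 'v) set \<Rightarrow> ('v \<Rightarrow> 'v \<Rightarrow> 'v) \<Rightarrow> 'v \<times> 'v \<Rightarrow> ('v \<times> 'v) set" where
  "face_of E rot d = {(face_step E rot ^^ k) d | k. True}"

definition faces :: "('v \<times> 'v) set \<Rightarrow> ('v \<Rightarrow> 'v \<Rightarrow> 'v) \<Rightarrow> ('v \<times> 'v) set set" where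
  "faces E rot = face_of E rot ` darts E"

definition face_edges :: "('v \<times> 'v) set \<Rightarrow> ('v \<times> 'v) set \<Rightarrow> ('v \<times> 'v) set" where
  "face_edges E f = {e \<in> E. e \<in> f \<or> prod.swap e \<in> f}"

definition simple_cycle_face :: "('v \<times> 'v) set \<Rightarrow> bool" where
  "simple_cycle_face f \<longleftrightarrow> finite f \<and> card f \<ge> 3 \<and> inj_on snd f"

definition component :: "('v \<times> 'v) set \<Rightarrow> 'v \<Rightarrow> 'v set" where
  "component E v = {u. (v, u) \<in> (darts E)\<^sup>*}"

text \<open>Plane embedded bipartite graph: rotation system with every connected component
  (having at least one edge) of genus 0 (Euler's formula V - E + F = 2),
  together with a choice Fo of the outer (unbounded) face of each such component;
  every bounded face is bounded by a simple cycle.\<close>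
definition plane_bipartite ::
  "'v set \<Rightarrow> 'v set \<Rightarrow> ('v \<times> 'v) set \<Rightarrow> ('v \<Rightarrow> 'v \<Rightarrow> 'v) \<Rightarrow> ('v \<times> 'v) set set \<Rightarrow> bool" where
  "plane_bipartite B W E rot Fo \<longleftrightarrow>
     finite B \<and> finite W \<and> B \<inter> W = {} \<and> E \<subseteq> B \<times> W \<and>
     is_rotation E (B \<union> W) rot \<and>
     (\<forall>v\<in>B \<union> W. nbrs E v \<noteq> {} \<longrightarrow>
        (let C = component E v in
           int (card C) - int (card {e \<in> E. fst e \<in> C})
             + int (card {f \<in> faces E rot. snd ` f \<subseteq> C}) = 2)) \<and>
     Fo \<subseteq> faces E rot \<and>
     (\<forall>v\<in>B \<union> W. nbrs E v \<noteq> {} \<longrightarrow> (\<exists>!f. f \<in> Fo \<and> snd ` f \<subseteq> component E v)) \<and>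
     (\<forall>f\<in>faces E rot - Fo. simple_cycle_face f)"

definition bounded_faces :: "('v \<times> 'v) set \<Rightarrow> ('v \<Rightarrow> 'v \<Rightarrow> 'v) \<Rightarrow> ('v \<times> 'v) set set \<Rightarrow> ('v \<times> 'v) set set" where
  "bounded_faces E rot Fo = faces E rot - Fo"

text \<open>A choice of cilia: cil v is a neighbour u of v, meaning the cilium of v lies in the
  wedge between the edge vu and its counterclockwise successor v (rot v u).\<close>
definition cilia :: "'v set \<Rightarrow> 'v set \<Rightarrow> ('v \<times> 'v) set \<Rightarrow> ('v \<Rightarrow> 'v) \<Rightarrow> bool" where
  "cilia B W E cil \<longleftrightarrow> (\<forall>v\<in>B \<union> W. nbrs E v \<noteq> {} \<longrightarrow> cil v \<in> nbrs E v)"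

text \<open>The cilium of v lies in face f (the face containing the wedge between v(cil v) and
  v(rot v (cil v))).\<close>
definition cilium_in :: "('v \<Rightarrow> 'v \<Rightarrow> 'v) \<Rightarrow> ('v \<Rightarrow> 'v) \<Rightarrow> 'v \<Rightarrow> ('v \<times> 'v) set \<Rightarrow> bool" where
  "cilium_in rot cil v f \<longleftrightarrow> (rot v (cil v), v) \<in> f"

definition k_face :: "('v \<Rightarrow> 'v \<Rightarrow> 'v) \<Rightarrow> ('v \<Rightarrow> 'v) \<Rightarrow> ('v \<Rightarrow> nat) \<Rightarrow> ('v \<times> 'v) set \<Rightarrow> nat" where
  "k_face rot cil n f = card {v \<in> snd ` f. even (n v) \<and> cilium_in rot cil v f}"

definition kasteleyn ::
  "('v \<times> 'v) set \<Rightarrow> ('v \<Rightarrow> 'v \<Rightarrow> 'v) \<Rightarrow> ('v \<times> 'v) set set \<Rightarrow> ('v \<Rightarrow> nat) \<Rightarrow> ('v \<Rightarrow> 'v)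
     \<Rightarrow> ('v \<times> 'v \<Rightarrow> real) \<Rightarrow> bool" where
  "kasteleyn E rot Fo n cil eps \<longleftrightarrow>
     (\<forall>e\<in>E. eps e = 1 \<or> eps e = -1) \<and>
     (\<forall>f\<in>bounded_faces E rot Fo.
        (\<Prod>e\<in>face_edges E f. eps e) = (-1) ^ (card f div 2 + 1 + k_face rot cil n f))"

definition multiwebs :: "'v set \<Rightarrow> 'v set \<Rightarrow> ('v \<times> 'v) set \<Rightarrow> ('v \<Rightarrow> nat) \<Rightarrow> ('v \<times> 'v \<Rightarrow> nat) set" where
  "multiwebs B W E n = {m. (\<forall>e. e \<notin> E \<longrightarrow> m e = 0) \<and>
      (\<forall>b\<in>B. (\<Sum>w\<in>nbrs E b. m (b, w)) = n b) \<and>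
      (\<forall>w\<in>W. (\<Sum>b\<in>nbrs E w. m (b, w)) = n w)}"

text \<open>Edge order at v: at a black vertex counterclockwise starting just after the cilium,
  at a white vertex clockwise starting just after the cilium.\<close>
definition edge_order :: "'v set \<Rightarrow> ('v \<times> 'v) set \<Rightarrow> ('v \<Rightarrow> 'v \<Rightarrow> 'v) \<Rightarrow> ('v \<Rightarrow> 'v) \<Rightarrow> 'v \<Rightarrow> 'v list" where
  "edge_order B E rot cil v =
     (if v \<in> B then map (\<lambda>k. (rot v ^^ Suc k) (cil v)) [0..<card (nbrs E v)]
      else map (\<lambda>k. (rot_inv E rot v ^^ k) (cil v)) [0..<card (nbrs E v)])"

definition colorings :: "'v set \<Rightarrow> 'v set \<Rightarrow> ('v \<times> 'v) set \<Rightarrow> ('v \<Rightarrow> nat) \<Rightarrow> ('v \<times> 'v \<Rightarrow> nat)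
    \<Rightarrow> (('v \<times> 'v \<Rightarrow> nat set) \<times> ('v \<times> 'v \<Rightarrow> nat set)) set" where
  "colorings B W E n m = {(S, T).
      (\<forall>e. e \<notin> E \<longrightarrow> S e = {} \<and> T e = {}) \<and>
      (\<forall>e\<in>E. S e \<subseteq> {1..n (fst e)} \<and> T e \<subseteq> {1..n (snd e)} \<and>
              card (S e) = m e \<and> card (T e) = m e) \<and>
      (\<forall>b\<in>B. (\<Union>w\<in>nbrs E b. S (b, w)) = {1..n b} \<and> disjoint_family_on (\<lambda>w. S (b, w)) (nbrs E b)) \<and>
      (\<forall>w\<in>W. (\<Union>b\<in>nbrs E w. T (b, w)) = {1..n w} \<and> disjoint_family_on (\<lambda>b. T (b, w)) (nbrs E w))}"

definition list_perm :: "nat \<Rightarrow> nat list \<Rightarrow> nat \<Rightarrow> nat" where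
  "list_perm k L = (\<lambda>i. if 1 \<le> i \<and> i \<le> k then L ! (i - 1) else i)"

definition vertex_sign ::
  "'v set \<Rightarrow> ('v \<times> 'v) set \<Rightarrow> ('v \<Rightarrow> 'v \<Rightarrow> 'v) \<Rightarrow> ('v \<Rightarrow> 'v) \<Rightarrow> ('v \<Rightarrow> nat)
    \<Rightarrow> ('v \<times> 'v \<Rightarrow> nat set) \<Rightarrow> ('v \<times> 'v \<Rightarrow> nat set) \<Rightarrow> 'v \<Rightarrow> int" where
  "vertex_sign B E rot cil n S T v =
     (if v \<in> B
      then sign (list_perm (n v) (concat (map (\<lambda>w. sorted_list_of_set (S (v, w))) (edge_order B E rot cil v))))
      else sign (list_perm (n v) (concat (map (\<lambda>b. sorted_list_of_set (T (b, v))) (edge_order B E rot cil v)))))"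

definition subdet :: "(nat \<Rightarrow> nat \<Rightarrow> real) \<Rightarrow> nat set \<Rightarrow> nat set \<Rightarrow> real" where
  "subdet M T S = det (mat (card T) (card S)
      (\<lambda>(i, j). M (sorted_list_of_set T ! i) (sorted_list_of_set S ! j)))"

text \<open>phi e i j is the (i,j) entry (1-based, i \<le> n_w, j \<le> n_b) of the matrix phi_bw, e = (b,w).\<close>
definition trace ::
  "'v set \<Rightarrow> 'v set \<Rightarrow> ('v \<times> 'v) set \<Rightarrow> ('v \<Rightarrow> 'v \<Rightarrow> 'v) \<Rightarrow> ('v \<Rightarrow> 'v) \<Rightarrow> ('v \<Rightarrow> nat)
    \<Rightarrow> ('v \<times> 'v \<Rightarrow> nat \<Rightarrow> nat \<Rightarrow> real) \<Rightarrow> ('v \<times> 'v \<Rightarrow> nat) \<Rightarrow> real" where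
  "trace B W E rot cil n phi m =
     (\<Sum>(S, T)\<in>colorings B W E n m.
        of_int (\<Prod>v\<in>B \<union> W. vertex_sign B E rot cil n S T v) *
        (\<Prod>e\<in>{e \<in> E. m e > 0}. subdet (phi e) (T e) (S e)))"

definition white_idx :: "'v set \<Rightarrow> ('v \<Rightarrow> nat) \<Rightarrow> ('v \<times> nat) set" where
  "white_idx W n = {(w, i). w \<in> W \<and> 1 \<le> i \<and> i \<le> n w}"

definition black_idx :: "'v set \<Rightarrow> ('v \<Rightarrow> nat) \<Rightarrow> ('v \<times> nat) set" where
  "black_idx B n = {(b, j). b \<in> B \<and> 1 \<le> j \<and> j \<le> n b}"

definition Ktilde :: "('v \<times> 'v) set \<Rightarrow> ('v \<times> 'v \<Rightarrow> real) \<Rightarrow> ('v \<times> 'v \<Rightarrow> nat \<Rightarrow> nat \<Rightarrow> real)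
    \<Rightarrow> (nat \<Rightarrow> 'v \<times> nat) \<Rightarrow> (nat \<Rightarrow> 'v \<times> nat) \<Rightarrow> nat \<Rightarrow> real mat" where
  "Ktilde E eps phi r c N = mat N N (\<lambda>(i, j).
     (let (w, a) = r i; (b, bj) = c j in
      if (b, w) \<in> E then eps (b, w) * phi (b, w) a bj else 0))"

end

theory Submission
  imports Defs
begin

text \<open>
  Expand the determinant over permutations and group the terms by the multiweb and the coloring they
  induce. Every sign that occurs is written as a product over ordered pairs, so that two such products
  agree as soon as they agree on each unordered pair. This factors the sign of a permutation
  into the vertex signs, the signs of the permutations inside the single edges, a factor depending only on
  the enumerations of the rows and columns, and \<open>(-1)\<close> to the quadratic form
  \<open>Q(m) = \<Sum> m\<^sub>e m\<^sub>e' I(e, e')\<close>, where \<open>I(e, e')\<close> tells whether the edges \<open>e\<close>, \<open>e'\<close> occur in different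
  relative order at the black and at the white side.

  Hence it suffices that \<open>\<Phi>(m) = (\<Prod> \<epsilon>\<^sub>e ^ m\<^sub>e) (-1) ^ Q(m)\<close> is the same for all multiwebs. It depends only on
  the set \<open>z\<close> of edges of odd multiplicity, whose mod 2 boundary is prescribed by \<open>n\<close>. Two such sets differ
  by a mod 2 cycle, and by Euler's formula and a count of dimensions over \<open>F\<^sub>2\<close> the mod 2 cycles
  are spanned by the bounded faces. Adding a single face to \<open>z\<close> leaves \<open>\<Phi>\<close> unchanged by
  the Kasteleyn condition: the two edges of the face at a vertex are consecutive in the cyclic
  order, so only the position of the cilium matters there. No Jordan curve argument is needed.
\<close>

section \<open>Signs as products over pairs\<close>

definition negif :: "bool \<Rightarrow> real" where
  "negif P = (if P then -1 else 1)"

lemma negif_simps [simp]: "negif True = -1" "negif False = 1" "negif P * negif P = 1"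
  "negif P * (negif P * x) = x"
  by (auto simp: negif_def)

lemma negif_not: "negif (\<not> P) = - negif P"
  by (simp add: negif_def)

lemma prod_pairs_insert:
  fixes f :: "'a \<Rightarrow> 'a \<Rightarrow> 'b::comm_monoid_mult"
  assumes "finite X" "a \<notin> X"
  shows "(\<Prod>x\<in>insert a X. \<Prod>y\<in>insert a X. f x y)
       = f a a * (\<Prod>x\<in>X. f a x * f x a) * (\<Prod>x\<in>X. \<Prod>y\<in>X. f x y)"
  using assms by (simp add: prod.distrib ac_simps)

lemma prod_pairs_cong:
  fixes f g :: "'a \<Rightarrow> 'a \<Rightarrow> 'b::comm_monoid_mult"
  assumes "finite X"
    and "\<And>x y. x \<in> X \<Longrightarrow> y \<in> X \<Longrightarrow> x \<noteq> y \<Longrightarrow> f x y * f y x = g x y * g y x"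
    and "\<And>x. x \<in> X \<Longrightarrow> f x x = g x x"
  shows "(\<Prod>x\<in>X. \<Prod>y\<in>X. f x y) = (\<Prod>x\<in>X. \<Prod>y\<in>X. g x y)"
  using assms
proof (induction X rule: finite_induct)
  case (insert a X)
  have "(\<Prod>x\<in>X. f a x * f x a) = (\<Prod>x\<in>X. g a x * g x a)"
    using insert.hyps(2) by (intro prod.cong refl insert.prems(1)) auto
  moreover have "(\<Prod>x\<in>X. \<Prod>y\<in>X. f x y) = (\<Prod>x\<in>X. \<Prod>y\<in>X. g x y)"
    by (rule insert.IH) (auto intro: insert.prems)
  ultimately show ?case
    using insert.prems(2)[of a] by (simp only: prod_pairs_insert[OF insert.hyps]) simp
qed simp

lemma inversions_transpose:
  fixes key :: "'a \<Rightarrow> nat"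
  assumes "finite X" "inj_on key X" "a \<in> X" "b \<in> X" "a \<noteq> b"
  shows "(\<Prod>x\<in>X. \<Prod>y\<in>X. negif (key x < key y \<and>
           key (transpose a b y) < key (transpose a b x))) = -1"
proof -
  define Y where "Y = X - {a, b}"
  have X: "X = insert a (insert b Y)" and Y: "finite Y" "a \<notin> insert b Y" "b \<notin> Y"
    using assms by (auto simp: Y_def)
  define f where "f x y = negif (key x < key y \<and> key (transpose a b y) < key (transpose a b x))" for x y
  have k: "key a \<noteq> key b" using assms by (auto dest: inj_onD)
  have ff: "f x x = 1" for x by (simp add: f_def)
  have ab: "f a b * f b a = -1" using k \<open>a \<noteq> b\<close> by (auto simp: f_def negif_def)
  have YY: "(\<Prod>x\<in>Y. \<Prod>y\<in>Y. f x y) = 1"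
  proof (intro prod.neutral ballI)
    fix x y assume "x \<in> Y" "y \<in> Y"
    then have "transpose a b x = x" "transpose a b y = y"
      by (auto simp: Y_def transpose_def)
    then show "f x y = 1" by (auto simp: f_def negif_def)
  qed
  have c: "f a c * f c a * (f b c * f c b) = 1" if "c \<in> Y" for c
  proof -
    have "transpose a b c = c" using that by (auto simp: Y_def transpose_def)
    moreover have "key c \<noteq> key a" "key c \<noteq> key b"
      using that assms by (auto simp: Y_def dest: inj_onD)
    ultimately show ?thesis using k by (auto simp: f_def negif_def)
  qed
  have "(\<Prod>x\<in>X. \<Prod>y\<in>X. f x y) = (f a b * f b a) * ((\<Prod>x\<in>Y. f a x * f x a) * (\<Prod>x\<in>Y. f b x * f x b))"
    unfolding X prod_pairs_insert[OF finite.insertI[OF Y(1)] Y(2)] prod_pairs_insert[OF Y(1,3)]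
    using Y by (simp add: ff YY prod.distrib ac_simps)
  also have "\<dots> = -1"
    by (simp add: ab prod.distrib[symmetric] c)
  finally show ?thesis by (simp add: f_def)
qed

lemma sign_eq_inversions:
  fixes key :: "'a \<Rightarrow> nat"
  assumes "p permutes X" "finite X" "inj_on key X"
  shows "real_of_int (sign p) = (\<Prod>x\<in>X. \<Prod>y\<in>X. negif (key x < key y \<and> key (p y) < key (p x)))"
  using assms(1,2)
proof (induction rule: permutes_induct)
  case id
  have "negif (key x < key y \<and> key (id y) < key (id x)) = 1" for x y by (auto simp: negif_def)
  then show ?case by simp
next
  case (swap a b p)
  define t where "t = transpose a b"
  have tX: "t permutes X" using swap by (simp add: t_def permutes_swap_id)
  have "(\<Prod>x\<in>X. \<Prod>y\<in>X. negif (key x < key y \<and> key (t (p y)) < key (t (p x))))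
      = (\<Prod>x\<in>X. \<Prod>y\<in>X. negif (key x < key y \<and> key (p y) < key (p x)) *
           negif (key (p x) < key (p y) \<and> key (t (p y)) < key (t (p x))))"
  proof (rule prod_pairs_cong[OF \<open>finite X\<close>])
    fix x y assume xy: "x \<in> X" "y \<in> X" "x \<noteq> y"
    have "key x \<noteq> key y" using xy assms(3) by (auto dest: inj_onD)
    moreover have "p x \<in> X" "p y \<in> X" "p x \<noteq> p y"
      using xy swap by (auto simp: permutes_in_image dest: permutes_inj injD)
    then have "t (p x) \<in> X" "t (p y) \<in> X" "t (p x) \<noteq> t (p y)"
      using tX by (auto simp: permutes_in_image dest: permutes_inj injD)
    then have "key (p x) \<noteq> key (p y)" "key (t (p x)) \<noteq> key (t (p y))"
      using assms(3) \<open>p x \<in> X\<close> \<open>p y \<in> X\<close> \<open>p x \<noteq> p y\<close> by (auto dest: inj_onD)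
    ultimately show "negif (key x < key y \<and> key (t (p y)) < key (t (p x))) *
          negif (key y < key x \<and> key (t (p x)) < key (t (p y))) =
          negif (key x < key y \<and> key (p y) < key (p x)) *
           negif (key (p x) < key (p y) \<and> key (t (p y)) < key (t (p x))) *
          (negif (key y < key x \<and> key (p x) < key (p y)) *
           negif (key (p y) < key (p x) \<and> key (t (p x)) < key (t (p y))))"
      by (auto simp: negif_def)
  qed simp
  also have "\<dots> = real_of_int (sign p) * (\<Prod>x\<in>X. \<Prod>y\<in>X. negif (key (p x) < key (p y) \<and> key (t (p y)) < key (t (p x))))"
    by (simp add: prod.distrib swap)
  also have "(\<Prod>x\<in>X. \<Prod>y\<in>X. negif (key (p x) < key (p y) \<and> key (t (p y)) < key (t (p x))))
     = (\<Prod>x\<in>X. \<Prod>y\<in>X. negif (key x < key y \<and> key (t y) < key (t x)))"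
    using prod.permute[OF \<open>p permutes X\<close>, of "\<lambda>x. \<Prod>y\<in>X. negif (key x < key y \<and> key (t y) < key (t x))"]
      prod.permute[OF \<open>p permutes X\<close>, of "\<lambda>y. negif (key (p x) < key y \<and> key (t y) < key (t (p x)))" for x]
    by (simp add: o_def)
  also have "\<dots> = -1"
    unfolding t_def using swap assms by (intro inversions_transpose) auto
  finally have "(\<Prod>x\<in>X. \<Prod>y\<in>X. negif (key x < key y \<and> key (t (p y)) < key (t (p x)))) = - real_of_int (sign p)"
    by simp
  moreover have "sign (t \<circ> p) = - sign p"
    using swap assms(2) unfolding t_def
    by (subst sign_compose) (auto simp: sign_swap_id permutation_swap_id intro: permutation_permutes[THEN iffD2])
  ultimately show ?case by (simp add: t_def o_def)
qed

definition cyclic_bij :: "('a \<Rightarrow> 'a) \<Rightarrow> 'a set \<Rightarrow> bool" where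
  "cyclic_bij f A \<longleftrightarrow> bij_betw f A A \<and> (\<forall>x\<in>A. \<forall>y\<in>A. \<exists>k. (f ^^ k) x = y)"

lemma funpow_mem: "bij_betw f A A \<Longrightarrow> a \<in> A \<Longrightarrow> (f ^^ k) a \<in> A"
  by (induction k) (auto dest: bij_betwE)

lemma funpow_inj: "bij_betw f A A \<Longrightarrow> a \<in> A \<Longrightarrow> b \<in> A \<Longrightarrow> (f ^^ k) a = (f ^^ k) b \<Longrightarrow> a = b"
proof (induction k)
  case (Suc k)
  then have "(f ^^ k) a = (f ^^ k) b"
    using funpow_mem[of f A _ k] by (auto simp: bij_betw_def dest: inj_onD)
  with Suc show ?case by blast
qed simp

lemma funpow_cancel:
  assumes "bij_betw f A A" "a \<in> A" "i \<le> j" "(f ^^ i) a = (f ^^ j) a"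
  shows "(f ^^ (j - i)) a = a"
proof -
  have "(f ^^ i) ((f ^^ (j - i)) a) = (f ^^ i) a"
    using assms by (simp add: funpow_add[of i "j - i" f, THEN fun_cong, simplified, symmetric])
  then show ?thesis using funpow_inj[OF assms(1) funpow_mem[OF assms(1,2)] assms(2)] by blast
qed

lemma funpow_return:
  assumes bij: "bij_betw f A A" and "finite A" "a \<in> A"
  obtains t where "t > 0" "(f ^^ t) a = a"
proof -
  have "\<not> inj (\<lambda>k. (f ^^ k) a)"
    using finite_subset[of "range (\<lambda>k. (f ^^ k) a)" A] funpow_mem[OF bij \<open>a \<in> A\<close>]
      \<open>finite A\<close> finite_imageD by blast
  then obtain i j where "i < j" "(f ^^ i) a = (f ^^ j) a"
    by (metis (mono_tags, lifting) injI linorder_neqE_nat)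
  then show ?thesis using funpow_cancel[OF bij \<open>a \<in> A\<close>, of i j] by (intro that[of "j - i"]) auto
qed

lemma cyclic_bij_orbit:
  assumes bij: "bij_betw f A A" and "finite A" "a \<in> A"
  shows "cyclic_bij f {(f ^^ k) a | k. True}"
proof -
  let ?O = "{(f ^^ k) a | k. True}"
  obtain t where t: "t > 0" "(f ^^ t) a = a" using funpow_return[OF assms] .
  have "?O \<subseteq> A" using funpow_mem[OF bij \<open>a \<in> A\<close>] by auto
  then have "inj_on f ?O" using bij by (auto simp: bij_betw_def intro: inj_on_subset)
  moreover have "f ` ?O = ?O"
  proof (intro equalityI subsetI)
    fix y assume "y \<in> f ` ?O"
    then obtain k where "y = (f ^^ Suc k) a" by auto
    then show "y \<in> ?O" by blast
  next
    fix y assume "y \<in> ?O"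
    then obtain k where k: "y = (f ^^ k) a" by auto
    have "y = (f ^^ (k + t)) a" using t(2) k by (simp add: funpow_add)
    also have "k + t = Suc (k + t - 1)" using t(1) by simp
    finally have "y = f ((f ^^ (k + t - 1)) a)" by simp
    then show "y \<in> f ` ?O" by blast
  qed
  moreover have "\<exists>k. (f ^^ k) ((f ^^ i) a) = (f ^^ j) a" for i j
  proof -
    have "(f ^^ (t * i)) a = a" using funpow_mod_eq[OF t(2), of "t * i"] by simp
    then have "(f ^^ (j + t * i)) a = (f ^^ j) a" by (simp add: funpow_add)
    moreover have "j + t * i = (j + (t - 1) * i) + i" using t(1) by (cases t) auto
    ultimately have "(f ^^ (j + (t - 1) * i)) ((f ^^ i) a) = (f ^^ j) a"
      by (metis comp_apply funpow_add)
    then show ?thesis by blast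
  qed
  ultimately show ?thesis unfolding cyclic_bij_def bij_betw_def by blast
qed

lemma cyclic_bij_enum:
  assumes "cyclic_bij f A" "finite A" "a \<in> A"
  shows "bij_betw (\<lambda>k. (f ^^ k) a) {..<card A} A" "(f ^^ card A) a = a"
proof -
  have bij: "bij_betw f A A" and trans: "\<And>y. y \<in> A \<Longrightarrow> \<exists>k. (f ^^ k) a = y"
    using assms by (auto simp: cyclic_bij_def)
  have ex: "\<exists>t. t > 0 \<and> (f ^^ t) a = a" using funpow_return[OF bij assms(2,3)] by blast
  define t where "t = (LEAST t. t > 0 \<and> (f ^^ t) a = a)"
  have t: "t > 0" "(f ^^ t) a = a" using LeastI_ex[OF ex] by (auto simp: t_def)
  have least: "t \<le> s" if "s > 0" "(f ^^ s) a = a" for s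
    using that by (auto simp: t_def intro: Least_le)
  have inj: "inj_on (\<lambda>k. (f ^^ k) a) {..<t}"
  proof (rule linorder_inj_onI)
    fix i j assume "i < j" "i \<in> {..<t}" "j \<in> {..<t}"
    then show "(f ^^ i) a \<noteq> (f ^^ j) a"
      using funpow_cancel[OF bij assms(3), of i j] least[of "j - i"] by fastforce
  qed auto
  have "(\<lambda>k. (f ^^ k) a) ` {..<t} = A"
  proof (intro equalityI subsetI)
    fix y assume "y \<in> A"
    then obtain k where k: "(f ^^ k) a = y" using trans by blast
    have "(f ^^ (k mod t)) a = y" using funpow_mod_eq[OF t(2), of k] k by simp
    then show "y \<in> (\<lambda>k. (f ^^ k) a) ` {..<t}" using t(1) by (intro image_eqI[of _ _ "k mod t"]) auto
  qed (use funpow_mem[OF bij assms(3)] in auto)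
  with inj have b: "bij_betw (\<lambda>k. (f ^^ k) a) {..<t} A" by (simp add: bij_betw_def)
  then have "t = card A" using bij_betw_same_card by fastforce
  with b t show "bij_betw (\<lambda>k. (f ^^ k) a) {..<card A} A" "(f ^^ card A) a = a" by auto
qed

definition cyc_index :: "('a \<Rightarrow> 'a) \<Rightarrow> 'a set \<Rightarrow> 'a \<Rightarrow> 'a \<Rightarrow> nat" where
  "cyc_index f A a = inv_into {..<card A} (\<lambda>k. (f ^^ k) a)"

lemma cyc_index:
  assumes "cyclic_bij f A" "finite A" "a \<in> A"
  shows "bij_betw (cyc_index f A a) A {..<card A}"
    and "k < card A \<Longrightarrow> cyc_index f A a ((f ^^ k) a) = k"
    and "x \<in> A \<Longrightarrow> cyc_index f A a (f x) = (if f x = a then 0 else Suc (cyc_index f A a x))"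
    and "x \<in> A \<Longrightarrow> f x = a \<Longrightarrow> cyc_index f A a x = card A - 1"
proof -
  note enum = cyclic_bij_enum[OF assms]
  define g where "g k = (f ^^ k) a" for k
  have g: "bij_betw g {..<card A} A" and gN: "g (card A) = a" using enum by (auto simp: g_def[abs_def])
  show "bij_betw (cyc_index f A a) A {..<card A}"
    using enum by (simp add: cyc_index_def bij_betw_inv_into)
  have ix: "cyc_index f A a (g k) = k" if "k < card A" for k
    using g that unfolding cyc_index_def g_def[symmetric] by (simp add: bij_betw_def inv_into_f_f)
  then show "k < card A \<Longrightarrow> cyc_index f A a ((f ^^ k) a) = k" by (simp add: g_def)
  have A: "card A > 0" using assms by (auto simp: card_gt_0_iff)
  have *: "g 0 = a" "\<And>k. f (g k) = g (Suc k)" by (auto simp: g_def)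
  have last: "Suc k = card A" if "k < card A" "g (Suc k) = a" for k
    using that ix[of "Suc k"] ix[OF A] * by (cases "Suc k < card A") auto
  { fix x assume "x \<in> A"
    then obtain k where k: "k < card A" "x = g k" using g by (auto simp: bij_betw_def)
    show "cyc_index f A a (f x) = (if f x = a then 0 else Suc (cyc_index f A a x))"
      using ix[OF A] ix[of k] ix[of "Suc k"] k * gN by (cases "Suc k = card A") auto
    assume "f x = a"
    then show "cyc_index f A a x = card A - 1" using last[of k] k * ix[of k] by auto }
qed

lemma inversions_cyclic_bij:
  fixes key :: "'a \<Rightarrow> nat"
  assumes cyc: "cyclic_bij f A" and fin: "finite A" and ne: "A \<noteq> {}" and key: "inj_on key A"
  shows "(\<Prod>x\<in>A. \<Prod>y\<in>A. negif (key x < key y \<and> key (f y) < key (f x))) = (-1) ^ (card A - 1)"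
proof -
  obtain a where a: "a \<in> A" using ne by blast
  define N where "N = card A"
  have N: "N > 0" using fin ne by (auto simp: N_def card_gt_0_iff)
  define ix where "ix = cyc_index f A a"
  note ixs = cyc_index[OF cyc fin a, folded ix_def N_def]
  define g where "g = inv_into A ix"
  have g: "bij_betw g {..<N} A" using ixs(1) by (simp add: g_def bij_betw_inv_into)
  have ixg: "ix (g k) = k" "g k \<in> A" if "k < N" for k
    using that ixs(1) g by (auto simp: g_def bij_betw_inv_into_right dest: bij_betwE)
  define p where "p x = (if x \<in> A then f x else x)" for x
  have "bij_betw p A A"
    using cyc by (subst bij_betw_cong[of _ _ f]) (auto simp: p_def cyclic_bij_def)
  then have p: "p permutes A" by (rule bij_imp_permutes) (simp add: p_def)
  have ixf: "ix (f (g k)) = (if Suc k = N then 0 else Suc k)" if "k < N" for k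
  proof (cases "f (g k) = a")
    case True
    then show ?thesis using ixs(3,4)[of "g k"] ixg[OF that] that by auto
  next
    case False
    then have "ix (f (g k)) = Suc k" using ixs(3)[of "g k"] ixg[OF that] by auto
    moreover have "f (g k) \<in> A" using ixg[OF that] cyc by (auto simp: cyclic_bij_def dest: bij_betwE)
    ultimately show ?thesis using bij_betw_apply[OF ixs(1), of "f (g k)"] by auto
  qed
  have "(\<Prod>x\<in>A. \<Prod>y\<in>A. negif (key x < key y \<and> key (f y) < key (f x))) = real_of_int (sign p)"
    by (simp add: sign_eq_inversions[OF p fin key] p_def cong: prod.cong)
  also have "\<dots> = (\<Prod>x\<in>A. \<Prod>y\<in>A. negif (ix x < ix y \<and> ix (f y) < ix (f x)))"
    using ixs(1) by (subst sign_eq_inversions[OF p fin, of ix]) (auto simp: p_def bij_betw_def cong: prod.cong)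
  also have "\<dots> = (\<Prod>i<N. \<Prod>j<N. negif (i < j \<and> ix (f (g j)) < ix (f (g i))))"
    unfolding prod.reindex_bij_betw[OF g, symmetric] by (intro prod.cong refl) (simp add: ixg)
  also have "\<dots> = (\<Prod>i<N. \<Prod>j<N. if j = N - 1 then negif (i < N - 1) else 1)"
    by (intro prod.cong refl) (auto simp: ixf negif_def)
  also have "\<dots> = (\<Prod>i<N. negif (i < N - 1))"
    using N by (intro prod.cong refl) simp
  also have "\<dots> = (-1) ^ (N - 1)"
  proof -
    have "{..<N} = insert (N - 1) {..<N - 1}" using N by auto
    then show ?thesis by simp
  qed
  finally show ?thesis by (simp add: N_def)
qed

lemma sorted_wrt_concat_blocks:
  fixes pos :: "'u \<Rightarrow> nat" and A :: "'u \<Rightarrow> nat set"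
  assumes "sorted_wrt (\<lambda>u u'. pos u < pos u') us"
    and "\<And>u. u \<in> set us \<Longrightarrow> finite (A u)"
    and "\<And>u i. u \<in> set us \<Longrightarrow> i \<in> A u \<Longrightarrow> e i = u"
  shows "sorted_wrt (\<lambda>i j. pos (e i) < pos (e j) \<or> e i = e j \<and> i < j)
           (concat (map (\<lambda>u. sorted_list_of_set (A u)) us))"
  using assms
proof (induction us)
  case (Cons u us)
  have "sorted_wrt (\<lambda>i j. pos (e i) < pos (e j) \<or> e i = e j \<and> i < j) (sorted_list_of_set (A u))"
    by (rule sorted_wrt_mono_rel[OF _ strict_sorted_list_of_set[of "A u"]])
      (use Cons.prems(2,3)[of u] in simp)
  moreover have "pos (e i) < pos (e j)" if "i \<in> A u" "u' \<in> set us" "j \<in> A u'" for i j u'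
    using that Cons.prems(1) Cons.prems(3)[of u i] Cons.prems(3)[of u' j] by simp
  moreover have "finite (A u)" "\<And>u'. u' \<in> set us \<Longrightarrow> finite (A u')" using Cons.prems(2) by auto
  moreover have "sorted_wrt (\<lambda>i j. pos (e i) < pos (e j) \<or> e i = e j \<and> i < j)
           (concat (map (\<lambda>u. sorted_list_of_set (A u)) us))"
    by (rule Cons.IH) (use Cons.prems in auto)
  ultimately show ?case
    by (auto simp: sorted_wrt_append)
qed simp

lemma sign_list_perm_concat:
  fixes pos :: "'u \<Rightarrow> nat" and A :: "'u \<Rightarrow> nat set"
  assumes "sorted_wrt (\<lambda>u u'. pos u < pos u') us"
    and e: "\<And>u i. u \<in> set us \<Longrightarrow> i \<in> A u \<Longrightarrow> e i = u"
    and un: "(\<Union>u\<in>set us. A u) = {1..n}"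
  shows "real_of_int (sign (list_perm n (concat (map (\<lambda>u. sorted_list_of_set (A u)) us))))
       = (\<Prod>i\<in>{1..n}. \<Prod>j\<in>{1..n}. negif (i < j \<and> pos (e j) < pos (e i)))"
proof -
  define L where "L = concat (map (\<lambda>u. sorted_list_of_set (A u)) us)"
  define R where "R i j \<longleftrightarrow> pos (e i) < pos (e j) \<or> e i = e j \<and> i < j" for i j :: nat
  have fin: "finite (A u)" if "u \<in> set us" for u
    using that un finite_subset[of "A u" "{1..n}"] by blast
  have srt: "sorted_wrt R L"
    unfolding R_def[abs_def] L_def using assms fin by (intro sorted_wrt_concat_blocks) auto
  have set: "set L = {1..n}" using un fin by (auto simp: L_def)
  have "distinct L"
    using srt by (induction L) (auto simp: R_def)
  then have len: "length L = n" using set distinct_card[of L] by simp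
  define q where "q = list_perm n L"
  have q: "q i = L ! (i - 1)" if "i \<in> {1..n}" for i using that by (simp add: q_def list_perm_def)
  have "bij_betw ((!) L \<circ> (\<lambda>i. i - 1)) {1..n} (set L)"
    by (intro bij_betw_trans[OF _ bij_betw_nth[OF \<open>distinct L\<close>]] bij_betw_byWitness[of _ Suc]) (auto simp: len)
  then have "bij_betw q {1..n} {1..n}"
    using set by (subst bij_betw_cong[of _ _ "(!) L \<circ> (\<lambda>i. i - 1)"]) (auto simp: q)
  then have perm: "q permutes {1..n}" by (rule bij_imp_permutes) (auto simp: q_def list_perm_def)
  have "real_of_int (sign q) = (\<Prod>x\<in>{1..n}. \<Prod>y\<in>{1..n}. negif (x < y \<and> q y < q x))"
    using sign_eq_inversions[OF perm, of id] by simp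
  also have "\<dots> = (\<Prod>x\<in>{1..n}. \<Prod>y\<in>{1..n}. negif (q x < q y \<and> pos (e (q y)) < pos (e (q x))))"
  proof (rule prod_pairs_cong)
    fix x y assume xy: "x \<in> {1..n}" "y \<in> {1..n}" "x \<noteq> y"
    have lt: "R (q x) (q y)" if "x < y" "x \<in> {1..n}" "y \<in> {1..n}" for x y
      using that srt by (simp add: q sorted_wrt_iff_nth_less len)
    have "q x \<noteq> q y" using xy perm by (auto dest: permutes_inj injD)
    moreover have "x < y \<longleftrightarrow> R (q x) (q y)" "y < x \<longleftrightarrow> R (q y) (q x)"
      using lt[of x y] lt[of y x] xy by (cases x y rule: linorder_cases; auto simp: R_def)+
    ultimately show "negif (x < y \<and> q y < q x) * negif (y < x \<and> q x < q y) =
      negif (q x < q y \<and> pos (e (q y)) < pos (e (q x))) *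
      negif (q y < q x \<and> pos (e (q x)) < pos (e (q y)))"
      by (auto simp: negif_def R_def)
  qed simp_all
  also have "\<dots> = (\<Prod>i\<in>{1..n}. \<Prod>j\<in>{1..n}. negif (i < j \<and> pos (e j) < pos (e i)))"
    using prod.permute[OF perm, of "\<lambda>x. \<Prod>y\<in>{1..n}. negif (x < y \<and> pos (e y) < pos (e x))"]
      prod.permute[OF perm, of "\<lambda>y. negif (q x < y \<and> pos (e y) < pos (e (q x)))" for x]
    by (simp add: o_def)
  finally show ?thesis by (simp add: q_def L_def)
qed

section \<open>Rotation systems and faces\<close>

locale plane_graph =
  fixes B W :: "'v set" and E :: "('v \<times> 'v) set" and rot :: "'v \<Rightarrow> 'v \<Rightarrow> 'v"
    and Fo :: "('v \<times> 'v) set set"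
  assumes plane: "plane_bipartite B W E rot Fo"
begin

abbreviation rinv :: "'v \<Rightarrow> 'v \<Rightarrow> 'v" where "rinv \<equiv> rot_inv E rot"
abbreviation fstep :: "'v \<times> 'v \<Rightarrow> 'v \<times> 'v" where "fstep \<equiv> face_step E rot"

lemma finite_B: "finite B" and finite_W: "finite W" and disj: "B \<inter> W = {}" and E_sub: "E \<subseteq> B \<times> W"
  using plane by (auto simp: plane_bipartite_def)

lemma E_mem: "(b, w) \<in> E \<Longrightarrow> b \<in> B \<and> w \<in> W \<and> b \<notin> W \<and> w \<notin> B"
  using E_sub disj by auto

lemma finite_E: "finite E"
  using E_sub finite_B finite_W by (meson finite_SigmaI finite_subset)

lemma dart_iff: "(v, u) \<in> darts E \<longleftrightarrow> u \<in> nbrs E v"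
  by (auto simp: darts_def nbrs_def)

lemma nbrs_sym: "u \<in> nbrs E v \<longleftrightarrow> v \<in> nbrs E u"
  by (auto simp: nbrs_def)

lemma dart_sym: "(v, u) \<in> darts E \<longleftrightarrow> (u, v) \<in> darts E"
  by (auto simp: darts_def)

lemma nbrs_vertex: "u \<in> nbrs E v \<Longrightarrow> u \<in> B \<union> W \<and> v \<in> B \<union> W"
  using E_mem by (auto simp: nbrs_def)

lemma nbrs_B: "b \<in> B \<Longrightarrow> nbrs E b = {w. (b, w) \<in> E}"
  using E_mem by (auto simp: nbrs_def)

lemma nbrs_W: "w \<in> W \<Longrightarrow> nbrs E w = {b. (b, w) \<in> E}"
  using E_mem by (auto simp: nbrs_def)

lemma finite_nbrs: "finite (nbrs E v)"
  by (rule finite_subset[of _ "B \<union> W"]) (use nbrs_vertex finite_B finite_W in auto)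

lemma finite_darts: "finite (darts E)"
  by (rule finite_subset[of _ "(B \<union> W) \<times> (B \<union> W)"])
    (use E_mem finite_B finite_W in \<open>auto simp: darts_def\<close>)

lemma rot_cyclic: "v \<in> B \<union> W \<Longrightarrow> cyclic_bij (rot v) (nbrs E v)"
  using plane by (auto simp: plane_bipartite_def is_rotation_def cyclic_bij_def)

lemma rot_mem: "u \<in> nbrs E v \<Longrightarrow> rot v u \<in> nbrs E v"
  using rot_cyclic[of v] nbrs_vertex by (auto simp: cyclic_bij_def dest: bij_betwE)

lemma rinv_bij: "v \<in> B \<union> W \<Longrightarrow> bij_betw (rinv v) (nbrs E v) (nbrs E v)"
  using rot_cyclic[of v] by (auto simp: cyclic_bij_def rot_inv_def bij_betw_inv_into)

lemma rinv_mem: "u \<in> nbrs E v \<Longrightarrow> rinv v u \<in> nbrs E v"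
  using rinv_bij[of v] nbrs_vertex by (auto dest: bij_betwE)

lemma rot_rinv: "u \<in> nbrs E v \<Longrightarrow> rot v (rinv v u) = u"
  using rot_cyclic[of v] nbrs_vertex
  by (auto simp: cyclic_bij_def rot_inv_def bij_betw_def f_inv_into_f)

lemma rinv_rot: "u \<in> nbrs E v \<Longrightarrow> rinv v (rot v u) = u"
  using rot_cyclic[of v] nbrs_vertex
  by (auto simp: cyclic_bij_def rot_inv_def bij_betw_def inv_into_f_f)

lemma rinv_cyclic:
  assumes "v \<in> B \<union> W"
  shows "cyclic_bij (rinv v) (nbrs E v)"
  unfolding cyclic_bij_def
proof (intro conjI ballI rinv_bij assms)
  fix x y assume xy: "x \<in> nbrs E v" "y \<in> nbrs E v"
  then obtain k where k: "(rot v ^^ k) y = x"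
    using rot_cyclic[OF assms] by (auto simp: cyclic_bij_def)
  have "(rinv v ^^ k) ((rot v ^^ k) y) = y"
  proof (induction k)
    case (Suc k)
    have "(rot v ^^ k) y \<in> nbrs E v"
      using rot_cyclic[OF assms] xy by (auto simp: cyclic_bij_def intro: funpow_mem)
    then show ?case using Suc by (simp add: rinv_rot funpow_Suc_right[of k "rinv v"] del: funpow.simps(2) add: funpow.simps(2)[of k "rot v"])
  qed simp
  with k show "\<exists>k. (rinv v ^^ k) x = y" by auto
qed

lemma fstep_simp: "fstep (x, v) = (v, rinv v x)"
  by (simp add: face_step_def)

lemma fstep_pred: "(v, y) \<in> darts E \<Longrightarrow> fstep (rot v y, v) = (v, y)"
  by (simp add: fstep_simp rinv_rot dart_iff)

lemma fstep_dart: "d \<in> darts E \<Longrightarrow> fstep d \<in> darts E"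
  using rinv_mem[of "fst d" "snd d"] dart_sym[of "fst d" "snd d"]
  by (cases d) (simp add: fstep_simp dart_iff)

lemma fstep_bij: "bij_betw fstep (darts E) (darts E)"
proof (rule bij_betw_byWitness[of _ "\<lambda>(v, y). (rot v y, v)"])
  show "\<forall>d\<in>darts E. (case fstep d of (v, y) \<Rightarrow> (rot v y, v)) = d"
  proof
    fix d assume "d \<in> darts E"
    then have "fst d \<in> nbrs E (snd d)" using dart_sym[of "fst d" "snd d"] by (simp add: dart_iff)
    then show "(case fstep d of (v, y) \<Rightarrow> (rot v y, v)) = d"
      by (cases d) (simp add: fstep_simp rot_rinv)
  qed
  show "(\<lambda>(v, y). (rot v y, v)) ` darts E \<subseteq> darts E"
  proof safe
    fix v y assume "(v, y) \<in> darts E"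
    then show "(rot v y, v) \<in> darts E" using dart_sym[of v "rot v y"] by (simp add: dart_iff rot_mem)
  qed
qed (auto simp: fstep_pred fstep_dart)

lemma face_props:
  assumes "f \<in> faces E rot"
  shows face_sub: "f \<subseteq> darts E" and face_ne: "f \<noteq> {}" and face_cyclic: "cyclic_bij fstep f"
    and face_of_mem: "d \<in> f \<Longrightarrow> face_of E rot d = f"
proof -
  obtain d0 where d0: "d0 \<in> darts E" "f = face_of E rot d0" using assms by (auto simp: faces_def)
  have f: "f = {(fstep ^^ k) d0 | k. True}" using d0 by (simp add: face_of_def)
  show "f \<subseteq> darts E" using funpow_mem[OF fstep_bij d0(1)] by (auto simp: f)
  show "f \<noteq> {}" unfolding f by blast
  show c: "cyclic_bij fstep f" unfolding f by (rule cyclic_bij_orbit[OF fstep_bij finite_darts d0(1)])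
  assume d: "d \<in> f"
  have "(fstep ^^ k) d \<in> f" for k
    using c d by (auto simp: cyclic_bij_def intro: funpow_mem)
  moreover have "\<exists>k. y = (fstep ^^ k) d" if "y \<in> f" for y
    using c d that unfolding cyclic_bij_def by metis
  ultimately show "face_of E rot d = f"
    unfolding face_of_def by blast
qed

lemma face_of_self: "d \<in> face_of E rot d"
  unfolding face_of_def by (rule CollectI, rule exI[of _ 0]) simp

lemma face_of_in: "d \<in> darts E \<Longrightarrow> face_of E rot d \<in> faces E rot"
  by (simp add: faces_def)

lemma face_fstep: "f \<in> faces E rot \<Longrightarrow> d \<in> f \<Longrightarrow> fstep d \<in> f"
  using face_cyclic[of f] by (auto simp: cyclic_bij_def dest: bij_betwE)

lemma face_pred:
  assumes "f \<in> faces E rot" "(v, y) \<in> f"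
  shows "(rot v y, v) \<in> f"
proof -
  obtain d where d: "d \<in> f" "(v, y) = fstep d"
    using face_cyclic[OF assms(1)] assms(2) unfolding cyclic_bij_def bij_betw_def by blast
  obtain x where x: "d = (x, v)" "y = rinv v x" using d(2) by (cases d) (simp add: fstep_simp)
  have "x \<in> nbrs E v" using d face_sub[OF assms(1)] x by (auto simp: dart_iff nbrs_sym)
  then show ?thesis using d x by (simp add: rot_rinv)
qed

lemma finite_faces: "finite (faces E rot)"
  using finite_darts by (simp add: faces_def)

end

locale plane_face = plane_graph +
  fixes f
  assumes f: "f \<in> bounded_faces E rot Fo"
begin

text \<open>The darts of the face from black to white, that is, every second edge of its boundary.\<close>
definition D where "D = {d \<in> f. fst d \<in> B}"

definition prev_edge :: "'a \<times> 'a \<Rightarrow> 'a \<times> 'a" where "prev_edge d = (fst d, rot (fst d) (snd d))"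
definition next_edge :: "'a \<times> 'a \<Rightarrow> 'a \<times> 'a" where "next_edge d = (rinv (snd d) (fst d), snd d)"

lemma f_face: "f \<in> faces E rot"
  using f by (simp add: bounded_faces_def)

lemma f_simple: "finite f" "card f \<ge> 3" "inj_on snd f"
  using f plane by (auto simp: bounded_faces_def plane_bipartite_def simple_cycle_face_def)

lemma f_darts: "(u, v) \<in> f \<Longrightarrow> v \<in> nbrs E u \<and> u \<in> nbrs E v"
  using face_sub[OF f_face] nbrs_sym dart_iff by blast

lemma inj_fst: "inj_on fst f"
proof (rule inj_onI)
  fix d d' assume d: "d \<in> f" "d' \<in> f" "fst d = fst d'"
  obtain v y y' where v: "d = (v, y)" "d' = (v, y')" using d(3) by (cases d; cases d') auto
  have "(rot v y, v) = (rot v y', v)"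
    using face_pred[OF f_face, of v y] face_pred[OF f_face, of v y'] d v
    by (intro inj_onD[OF f_simple(3)]) auto
  then have "rinv v (rot v y) = rinv v (rot v y')" by simp
  then show "d = d'" using v d f_darts by (simp add: rinv_rot)
qed

lemma no_swap:
  assumes "(x, v) \<in> f" shows "(v, x) \<notin> f"
proof
  assume r: "(v, x) \<in> f"
  have "(v, rinv v x) \<in> f" "(x, rinv x v) \<in> f"
    using face_fstep[OF f_face assms] face_fstep[OF f_face r] by (auto simp: fstep_simp)
  then have *: "rinv v x = x" "rinv x v = v"
    using assms r inj_onD[OF inj_fst, of "(v, rinv v x)" "(v, x)"] inj_onD[OF inj_fst, of "(x, rinv x v)" "(x, v)"]
    by auto
  have "(fstep ^^ k) (x, v) \<in> {(x, v), (v, x)}" for k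
    by (induction k) (auto simp: fstep_simp *)
  then have "f \<subseteq> {(x, v), (v, x)}"
    using face_of_mem[OF f_face assms] unfolding face_of_def by blast
  then have "card f \<le> card {(x, v), (v, x)}" by (intro card_mono) auto
  also have "\<dots> \<le> 2" by (rule card_insert_le_m1) simp_all
  finally show False using f_simple(2) by simp
qed

lemma D_iff: "d \<in> D \<longleftrightarrow> d \<in> E \<and> d \<in> f"
proof -
  have "d \<in> f \<Longrightarrow> fst d \<in> B \<Longrightarrow> d \<in> E"
    using f_darts[of "fst d" "snd d"] nbrs_B[of "fst d"] by auto
  then show ?thesis using E_mem[of "fst d" "snd d"] by (auto simp: D_def)
qed

lemma D_mem: "(b, w) \<in> D \<Longrightarrow> b \<in> B \<and> w \<in> W \<and> (b, w) \<in> E \<and> w \<in> nbrs E b \<and> b \<in> nbrs E w"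
  using E_mem f_darts by (auto simp: D_iff)

lemma finite_D: "finite D"
  using f_simple by (simp add: D_def)

lemma inj_D: "inj_on fst D" "inj_on snd D"
  using inj_fst f_simple(3) by (auto simp: D_def intro: inj_on_subset)

lemma next_edge_image: "next_edge ` D = {e \<in> E. prod.swap e \<in> f}"
proof (intro equalityI subsetI)
  fix e assume "e \<in> next_edge ` D"
  then obtain b w where d: "(b, w) \<in> D" "e = (rinv w b, w)" by (auto simp: next_edge_def)
  then have "(w, rinv w b) \<in> f" using face_fstep[OF f_face, of "(b, w)"] by (auto simp: D_iff fstep_simp)
  moreover have "(rinv w b, w) \<in> E" using D_mem[OF d(1)] rinv_mem[of b w] nbrs_W[of w] by auto
  ultimately show "e \<in> {e \<in> E. prod.swap e \<in> f}" using d by simp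
next
  fix e assume e: "e \<in> {e \<in> E. prod.swap e \<in> f}"
  obtain b w where bw: "e = (b, w)" by (cases e)
  have wb: "(w, b) \<in> f" "(b, w) \<in> E" using e bw by auto
  have "(rot w b, w) \<in> f" using face_pred[OF f_face wb(1)] .
  moreover have "rot w b \<in> B"
    using rot_mem[of b w] f_darts[OF wb(1)] nbrs_W[of w] E_mem wb(2) by auto
  ultimately have "(rot w b, w) \<in> D" by (simp add: D_def)
  moreover have "next_edge (rot w b, w) = e" using f_darts[OF wb(1)] by (simp add: next_edge_def bw rinv_rot)
  ultimately show "e \<in> next_edge ` D" by force
qed

lemma prev_edge_image: "prev_edge ` D = {e \<in> E. prod.swap e \<in> f}"
proof (intro equalityI subsetI)
  fix e assume "e \<in> prev_edge ` D"
  then obtain b w where d: "(b, w) \<in> D" "e = (b, rot b w)" by (auto simp: prev_edge_def)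
  then have "(rot b w, b) \<in> f" using face_pred[OF f_face, of b w] by (auto simp: D_iff)
  moreover have "(b, rot b w) \<in> E" using D_mem[OF d(1)] rot_mem[of w b] nbrs_B[of b] by auto
  ultimately show "e \<in> {e \<in> E. prod.swap e \<in> f}" using d by simp
next
  fix e assume e: "e \<in> {e \<in> E. prod.swap e \<in> f}"
  obtain b w where bw: "e = (b, w)" by (cases e)
  have wb: "(w, b) \<in> f" "(b, w) \<in> E" using e bw by auto
  have "(b, rinv b w) \<in> f" using face_fstep[OF f_face wb(1)] by (simp add: fstep_simp)
  then have "(b, rinv b w) \<in> D" using E_mem wb(2) by (simp add: D_def)
  moreover have "prev_edge (b, rinv b w) = e" using f_darts[OF wb(1)] by (simp add: prev_edge_def bw rot_rinv)
  ultimately show "e \<in> prev_edge ` D" by force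
qed

lemma inj_prev_edge: "inj_on prev_edge D" and inj_next_edge: "inj_on next_edge D"
  using inj_D by (auto simp: prev_edge_def next_edge_def inj_on_def)

lemma face_edges_eq: "face_edges E f = D \<union> prev_edge ` D" "face_edges E f = D \<union> next_edge ` D"
  unfolding prev_edge_image next_edge_image by (auto simp: face_edges_def D_iff)

lemma D_disj: "D \<inter> prev_edge ` D = {}" "D \<inter> next_edge ` D = {}"
  unfolding prev_edge_image next_edge_image using no_swap by (auto simp: D_iff)

lemma card_f: "card f = 2 * card D"
proof -
  have "f = D \<union> prod.swap ` (next_edge ` D)"
  proof (intro equalityI subsetI)
    fix d assume d: "d \<in> f"
    obtain u v where uv: "d = (u, v)" by (cases d)
    have "(u, v) \<in> E \<or> (v, u) \<in> E" using f_darts[of u v] d uv by (auto simp: nbrs_def)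
    then show "d \<in> D \<union> prod.swap ` (next_edge ` D)"
      unfolding next_edge_image using d uv by (force simp: D_iff image_iff)
  qed (auto simp: D_iff next_edge_image)
  moreover have "D \<inter> prod.swap ` (next_edge ` D) = {}"
  proof -
    have "d \<notin> prod.swap ` {e \<in> E. prod.swap e \<in> f}" if "d \<in> D" for d
      using that E_mem D_mem[of "fst d" "snd d"] by (auto simp: prod.swap_def)
    then show ?thesis unfolding next_edge_image by blast
  qed
  moreover have "card (prod.swap ` (next_edge ` D)) = card D"
    using inj_next_edge by (simp add: card_image)
  ultimately show ?thesis using finite_D by (metis card_Un_disjoint finite_imageI mult_2)
qed

lemma D_ne: "D \<noteq> {}"
  using card_f f_simple(2) by auto

lemma fstep_side: "d \<in> f \<Longrightarrow> fst (fstep d) \<in> B \<longleftrightarrow> fst d \<notin> B"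
  using f_darts[of "fst d" "snd d"] E_mem by (cases d) (auto simp: fstep_simp nbrs_def)

lemma D_cyclic: "cyclic_bij (fstep \<circ> fstep) D"
proof -
  have inj: "inj_on fstep f" using face_cyclic[OF f_face] by (auto simp: cyclic_bij_def bij_betw_def)
  have sub: "(fstep \<circ> fstep) ` D \<subseteq> D"
  proof
    fix e assume "e \<in> (fstep \<circ> fstep) ` D"
    then obtain d where d: "d \<in> f" "fst d \<in> B" "e = fstep (fstep d)" by (auto simp: D_def)
    then show "e \<in> D" using fstep_side[OF d(1)] fstep_side[of "fstep d"] face_fstep[OF f_face] by (simp add: D_def)
  qed
  have "inj_on (fstep \<circ> fstep) D"
    by (rule comp_inj_on; rule inj_on_subset[OF inj]) (use face_fstep[OF f_face] in \<open>auto simp: D_def\<close>)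
  then have "bij_betw (fstep \<circ> fstep) D D"
    using endo_inj_surj[OF finite_D sub] by (simp add: bij_betw_def)
  moreover have "\<exists>k. ((fstep \<circ> fstep) ^^ k) x = y" if xy: "x \<in> D" "y \<in> D" for x y
  proof -
    obtain k where k: "(fstep ^^ k) x = y"
      using face_cyclic[OF f_face] xy by (auto simp: cyclic_bij_def D_def)
    have "(fstep ^^ j) x \<in> f \<and> (fst ((fstep ^^ j) x) \<in> B \<longleftrightarrow> even j)" for j
    proof (induction j)
      case (Suc j)
      then show ?case using face_fstep[OF f_face, of "(fstep ^^ j) x"] fstep_side[of "(fstep ^^ j) x"] by simp
    qed (use xy in \<open>simp add: D_def\<close>)
    then have "even k" using k xy by (auto simp: D_def)
    then obtain j where "k = 2 * j" by blast
    moreover have "(fstep \<circ> fstep) ^^ j = fstep ^^ (2 * j)" by (induction j) (simp_all add: o_assoc)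
    ultimately show ?thesis using k by metis
  qed
  ultimately show ?thesis by (auto simp: cyclic_bij_def)
qed

lemma fst_fstep2: "fst ((fstep \<circ> fstep) d) = fst (next_edge d)"
  by (cases d) (simp add: fstep_simp next_edge_def)

end

section \<open>Mod 2 cycles are spanned by the bounded faces\<close>

lemma odd_card_sym_diff:
  assumes "finite A" "finite A'"
  shows "odd (card (sym_diff A A')) \<longleftrightarrow> odd (card A) \<noteq> odd (card A')"
proof -
  have "card A = card (A - A') + card (A \<inter> A')" "card A' = card (A' - A) + card (A \<inter> A')"
    using assms by (metis card_Diff_subset_Int card_mono finite_Int inf_le1 le_add_diff_inverse2 inf_commute)+
  moreover have "card (sym_diff A A') = card (A - A') + card (A' - A)"
    using assms by (intro card_Un_disjoint) auto
  ultimately show ?thesis by auto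
qed

definition incident :: "('v \<times> 'v) set \<Rightarrow> 'v \<Rightarrow> ('v \<times> 'v) set" where
  "incident z v = {e \<in> z. fst e = v \<or> snd e = v}"

definition bd :: "('v \<times> 'v) set \<Rightarrow> 'v set" where
  "bd z = {v. odd (card (incident z v))}"

lemma bd_sym_diff:
  assumes "finite z" "finite z'"
  shows "bd (sym_diff z z') = sym_diff (bd z) (bd z')"
proof -
  have "odd (card (incident (sym_diff z z') v)) \<longleftrightarrow> odd (card (incident z v)) \<noteq> odd (card (incident z' v))" for v
  proof -
    have "incident (sym_diff z z') v = sym_diff (incident z v) (incident z' v)"
      by (auto simp: incident_def)
    moreover have "finite (incident z v)" "finite (incident z' v)" using assms by (auto simp: incident_def)
    ultimately show ?thesis by (metis odd_card_sym_diff)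
  qed
  then show ?thesis by (auto simp: bd_def)
qed

lemma bd_empty [simp]: "bd {} = {}"
  by (simp add: bd_def incident_def)

lemma bd_edge: "u \<noteq> v \<Longrightarrow> bd {(u, v)} = {u, v}"
proof -
  have "incident {(u, v)} x = (if x = u \<or> x = v then {(u, v)} else {})" for x
    by (auto simp: incident_def)
  then show ?thesis by (auto simp: bd_def)
qed

context plane_face
begin

lemma bd_face_edges: "bd (face_edges E f) = {}"
proof -
  let ?F = "face_edges E f"
  have sub: "?F \<subseteq> E" by (auto simp: face_edges_def)
  have finF: "finite ?F" using sub finite_E finite_subset by blast
  have "even (card (incident ?F v))" for v
  proof -
    let ?D1 = "{d \<in> D. fst d = v}" and ?D2 = "{d \<in> D. snd d = v}"
    have 1: "{e \<in> ?F. fst e = v} = ?D1 \<union> prev_edge ` ?D1"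
    proof -
      have "fst (prev_edge d) = fst d" for d by (simp add: prev_edge_def)
      then show ?thesis unfolding face_edges_eq(1) by auto
    qed
    have 2: "{e \<in> ?F. snd e = v} = ?D2 \<union> next_edge ` ?D2"
    proof -
      have "snd (next_edge d) = snd d" for d by (simp add: next_edge_def)
      then show ?thesis unfolding face_edges_eq(2) by auto
    qed
    have "card {e \<in> ?F. fst e = v} = card ?D1 + card (prev_edge ` ?D1)"
      unfolding 1 using finite_D D_disj by (intro card_Un_disjoint) auto
    also have "card (prev_edge ` ?D1) = card ?D1"
      by (rule card_image, rule inj_on_subset[OF inj_prev_edge]) auto
    finally have e1: "even (card {e \<in> ?F. fst e = v})" by simp
    have "card {e \<in> ?F. snd e = v} = card ?D2 + card (next_edge ` ?D2)"
      unfolding 2 using finite_D D_disj by (intro card_Un_disjoint) auto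
    also have "card (next_edge ` ?D2) = card ?D2"
      by (rule card_image, rule inj_on_subset[OF inj_next_edge]) auto
    finally have e2: "even (card {e \<in> ?F. snd e = v})" by simp
    have "incident ?F v = {e \<in> ?F. fst e = v} \<union> {e \<in> ?F. snd e = v}" by (auto simp: incident_def)
    moreover have "{e \<in> ?F. fst e = v} \<inter> {e \<in> ?F. snd e = v} = {}"
      using sub E_mem by fastforce
    ultimately have "card (incident ?F v) = card {e \<in> ?F. fst e = v} + card {e \<in> ?F. snd e = v}"
      using finF by (simp add: card_Un_disjoint)
    then show ?thesis using e1 e2 by simp
  qed
  then show ?thesis by (simp add: bd_def)
qed

end

context plane_graph
begin

lemma plane_face: "f \<in> bounded_faces E rot Fo \<Longrightarrow> plane_face B W E rot Fo f"
  by (simp add: plane_face_def plane_graph_axioms plane_face_axioms_def)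

definition fsum :: "('v \<times> 'v) set set \<Rightarrow> ('v \<times> 'v) set" where
  "fsum X = {e \<in> E. odd (card {f \<in> X. e \<in> face_edges E f})}"

lemma fsum_insert:
  assumes "finite X" "f \<notin> X"
  shows "fsum (insert f X) = sym_diff (fsum X) (face_edges E f)"
proof -
  have "odd (card {g \<in> insert f X. e \<in> face_edges E g}) \<longleftrightarrow>
      odd (card {g \<in> X. e \<in> face_edges E g}) \<noteq> (e \<in> face_edges E f)" for e
  proof -
    have "{g \<in> insert f X. e \<in> face_edges E g} =
        (if e \<in> face_edges E f then insert f {g \<in> X. e \<in> face_edges E g} else {g \<in> X. e \<in> face_edges E g})"
      by auto
    then show ?thesis using assms by simp
  qed
  then show ?thesis by (auto simp: fsum_def face_edges_def)
qed

lemma mem_face_iff: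
  assumes "g \<in> faces E rot"
  shows "d \<in> g \<longleftrightarrow> face_of E rot d = g"
  using face_of_mem[OF assms, of d] face_of_self[of d] by auto

lemma fsum_iff:
  assumes "X \<subseteq> bounded_faces E rot Fo" "e \<in> E"
  shows "e \<in> fsum X \<longleftrightarrow> (face_of E rot e \<in> X) \<noteq> (face_of E rot (prod.swap e) \<in> X)"
proof -
  let ?f = "face_of E rot e" and ?g = "face_of E rot (prod.swap e)"
  have "e \<in> face_edges E h \<longleftrightarrow> h = ?f \<or> h = ?g" if "h \<in> X" for h
  proof -
    have "h \<in> faces E rot" using that assms(1) by (auto simp: bounded_faces_def)
    then show ?thesis using mem_face_iff[of h e] mem_face_iff[of h "prod.swap e"] assms(2)
      unfolding face_edges_def by blast
  qed
  then have *: "{h \<in> X. e \<in> face_edges E h} = X \<inter> {?f, ?g}" by auto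
  have ne: "?f \<noteq> ?g" if "?f \<in> X" 
  proof
    assume eq: "?f = ?g"
    interpret plane_face B W E rot Fo ?f by (rule plane_face) (use that assms in auto)
    have "(fst e, snd e) \<in> ?f" "(snd e, fst e) \<in> ?f"
      using face_of_self[of e] face_of_self[of "prod.swap e"] eq by (auto simp: prod.swap_def)
    then show False using no_swap by blast
  qed
  have "odd (card (X \<inter> {?f, ?g})) \<longleftrightarrow> (?f \<in> X) \<noteq> (?g \<in> X)"
    using ne by (cases "?f \<in> X"; cases "?g \<in> X") auto
  then show ?thesis using assms by (simp add: fsum_def *)
qed

lemma component_refl: "v \<in> component E v"
  by (simp add: component_def)

lemma component_step: "u \<in> component E v \<Longrightarrow> u' \<in> nbrs E u \<Longrightarrow> u' \<in> component E v"
  unfolding component_def using rtrancl_into_rtrancl[of v u "darts E" u'] by (simp add: dart_iff)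

lemma component_sub:
  assumes "v \<in> B \<union> W"
  shows "component E v \<subseteq> B \<union> W"
proof
  fix u assume "u \<in> component E v"
  then have "(v, u) \<in> (darts E)\<^sup>*" by (simp add: component_def)
  then show "u \<in> B \<union> W"
    by (induction rule: rtrancl_induct) (use assms nbrs_vertex dart_iff in blast)+
qed

lemma finite_component: "v \<in> B \<union> W \<Longrightarrow> finite (component E v)"
  using component_sub finite_B finite_W by (meson finite_UnI finite_subset)

lemma component_edge: "e \<in> E \<Longrightarrow> fst e \<in> component E v \<longleftrightarrow> snd e \<in> component E v"
  using component_step[of "fst e" v "snd e"] component_step[of "snd e" v "fst e"]
  by (auto simp: nbrs_def)

lemma path_bd:
  assumes "u \<in> component E v"
  shows "\<exists>z. z \<subseteq> {e \<in> E. fst e \<in> component E v} \<and> bd z = sym_diff {v} {u}"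
proof -
  have "(v, u) \<in> (darts E)\<^sup>*" using assms by (simp add: component_def)
  then show ?thesis
  proof (induction rule: rtrancl_induct)
    case base
    show ?case by (rule exI[of _ "{}"]) simp
  next
    case (step x y)
    then obtain z where z: "z \<subseteq> {e \<in> E. fst e \<in> component E v}" "bd z = sym_diff {v} {x}" by blast
    have xy: "x \<in> component E v" "y \<in> component E v"
      using step(1) rtrancl_into_rtrancl[OF step(1,2)] by (auto simp: component_def)
    have "\<exists>e\<in>E. e = (x, y) \<or> e = (y, x)" using step(2) by (auto simp: darts_def)
    then obtain e where e: "e \<in> E" "e = (x, y) \<or> e = (y, x)" by blast
    then have "x \<noteq> y" using E_mem by blast
    then have "bd {e} = {x, y}" using e bd_edge[of x y] bd_edge[of y x] by (auto simp: insert_commute)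
    moreover have "finite z" using z(1) finite_E finite_subset by fastforce
    ultimately have "bd (sym_diff z {e}) = sym_diff (sym_diff {v} {x}) {x, y}"
      using z(2) bd_sym_diff[of z "{e}"] by simp
    also have "\<dots> = sym_diff {v} {y}" using \<open>x \<noteq> y\<close> by auto
    finally have "bd (sym_diff z {e}) = sym_diff {v} {y}" .
    moreover have "sym_diff z {e} \<subseteq> {e \<in> E. fst e \<in> component E v}" using z(1) e xy by auto
    ultimately show ?case by blast
  qed
qed

lemma bd_surj:
  assumes "finite Y" "Y \<subseteq> component E v - {v}"
  shows "\<exists>z. z \<subseteq> {e \<in> E. fst e \<in> component E v} \<and> bd z - {v} = Y"
  using assms
proof (induction Y rule: finite_induct)
  case empty
  show ?case by (rule exI[of _ "{}"]) simp
next
  case (insert u Y)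
  obtain z where z: "z \<subseteq> {e \<in> E. fst e \<in> component E v}" "bd z - {v} = Y"
    using insert.IH insert.prems by blast
  obtain p where p: "p \<subseteq> {e \<in> E. fst e \<in> component E v}" "bd p = sym_diff {v} {u}"
    using path_bd[of u v] insert.prems by blast
  have "finite z" "finite p" using z(1) p(1) finite_E finite_subset by fastforce+
  then have "bd (sym_diff z p) = sym_diff (bd z) (sym_diff {v} {u})"
    using p bd_sym_diff[of z p] by simp
  then have "bd (sym_diff z p) - {v} = insert u Y"
    using z(2) insert.prems insert.hyps by auto
  moreover have "sym_diff z p \<subseteq> {e \<in> E. fst e \<in> component E v}" using z(1) p(1) by auto
  ultimately show ?case by blast
qed

lemma euler:
  assumes "v \<in> B \<union> W" "nbrs E v \<noteq> {}"
  shows "int (card (component E v)) - int (card {e \<in> E. fst e \<in> component E v})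
           + int (card {f \<in> faces E rot. snd ` f \<subseteq> component E v}) = 2"
  using assms plane unfolding plane_bipartite_def Let_def by (elim conjE) (drule (1) bspec, erule mp)

lemma outer_face:
  assumes "v \<in> B \<union> W" "nbrs E v \<noteq> {}"
  shows "\<exists>!f. f \<in> Fo \<and> snd ` f \<subseteq> component E v"
proof -
  have "\<forall>v\<in>B \<union> W. nbrs E v \<noteq> {} \<longrightarrow> (\<exists>!f. f \<in> Fo \<and> snd ` f \<subseteq> component E v)"
    using plane unfolding plane_bipartite_def by (elim conjE)
  with assms show ?thesis by blast
qed

lemma Fo_sub: "Fo \<subseteq> faces E rot"
  using plane unfolding plane_bipartite_def by (elim conjE)

lemma inj_on_fsum:
  assumes v: "v \<in> B \<union> W" "nbrs E v \<noteq> {}"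
  shows "inj_on fsum (Pow {f \<in> bounded_faces E rot Fo. snd ` f \<subseteq> component E v})"
proof (rule inj_onI)
  let ?C = "component E v"
  let ?BF = "{f \<in> bounded_faces E rot Fo. snd ` f \<subseteq> ?C}"
  fix X Y assume X: "X \<in> Pow ?BF" and Y: "Y \<in> Pow ?BF" and eq: "fsum X = fsum Y"
  let ?P = "\<lambda>d. (face_of E rot d \<in> X) \<longleftrightarrow> (face_of E rot d \<in> Y)"
  obtain fo where fo: "fo \<in> Fo" "snd ` fo \<subseteq> ?C" "fo \<in> faces E rot"
    using outer_face[OF v] Fo_sub by blast
  have fo_notin: "fo \<notin> X" "fo \<notin> Y" using X Y fo by (auto simp: bounded_faces_def)
  obtain d0 where d0: "d0 \<in> fo" using face_ne[OF fo(3)] by blast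
  have P_swap: "?P (prod.swap d) \<longleftrightarrow> ?P d" if "d \<in> darts E" for d
  proof -
    have *: "?P (prod.swap e) \<longleftrightarrow> ?P e" if "e \<in> E" for e
      using fsum_iff[of X e] fsum_iff[of Y e] X Y eq that by auto
    have "d \<in> E \<or> prod.swap d \<in> E" using that by (auto simp: darts_def)
    then show ?thesis using *[of d] *[of "prod.swap d"] by auto
  qed
  have P_step: "?P (fstep d) \<longleftrightarrow> ?P d" if "d \<in> darts E" for d
  proof -
    have "fstep d \<in> face_of E rot d"
      using face_fstep[OF face_of_in[OF that] face_of_self] .
    then have "face_of E rot (fstep d) = face_of E rot d"
      using mem_face_iff[OF face_of_in[OF that]] by blast
    then show ?thesis by simp
  qed
  have P_rot: "?P (x, u') " if xu: "u \<in> nbrs E x" "u' \<in> nbrs E x" "?P (x, u)" for x u u'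
  proof -
    have x: "x \<in> B \<union> W" using nbrs_vertex xu(1) by blast
    obtain k where k: "(rinv x ^^ k) u = u'"
      using rinv_cyclic[OF x] xu by (auto simp: cyclic_bij_def)
    have "(rinv x ^^ k) u \<in> nbrs E x \<and> ?P (x, (rinv x ^^ k) u)" for k
    proof (induction k)
      case (Suc k)
      let ?u = "(rinv x ^^ k) u"
      have d: "(x, ?u) \<in> darts E" "(?u, x) \<in> darts E" using Suc dart_iff dart_sym by blast+
      have "?P (?u, x)" using P_swap[OF d(1)] Suc by simp
      then have "?P (x, rinv x ?u)" using P_step[OF d(2)] by (simp add: fstep_simp)
      then show ?case using Suc by (simp add: rinv_mem)
    qed (use xu in simp)
    then show ?thesis using k by blast
  qed
  have d0_nb: "snd d0 \<in> nbrs E (fst d0)" using d0 face_sub[OF fo(3)] dart_iff[of "fst d0" "snd d0"] by auto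
  have "?P d0" using mem_face_iff[OF fo(3), of d0] d0 fo_notin by simp
  have d0C: "(v, fst d0) \<in> (darts E)\<^sup>*"
  proof -
    have "snd d0 \<in> ?C" using d0 fo by auto
    then have "fst d0 \<in> ?C" using component_step d0_nb nbrs_sym by blast
    then show ?thesis by (simp add: component_def)
  qed
  have sym: "(x, y) \<in> (darts E)\<^sup>* \<Longrightarrow> (y, x) \<in> (darts E)\<^sup>*" for x y
    using sym_rtrancl[of "darts E"] dart_sym unfolding sym_def by blast
  have allP: "\<forall>u\<in>nbrs E x. ?P (x, u)" if "x \<in> ?C" for x
  proof -
    have "(fst d0, x) \<in> (darts E)\<^sup>*"
      using that sym[OF d0C] by (auto simp: component_def)
    then show ?thesis
    proof (induction rule: rtrancl_induct)
      case base
      show ?case using P_rot[OF d0_nb] \<open>?P d0\<close> by simp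
    next
      case (step y z)
      have yz: "z \<in> nbrs E y" "y \<in> nbrs E z" using step(2) dart_iff dart_sym by blast+
      have "?P (y, z)" using step(3) yz by blast
      then have "?P (z, y)" using P_swap[OF step(2)] by simp
      then show ?case using P_rot[OF yz(2)] by blast
    qed
  qed
  have "g \<in> X \<longleftrightarrow> g \<in> Y" if g: "g \<in> ?BF" for g
  proof -
    have gf: "g \<in> faces E rot" using g by (simp add: bounded_faces_def)
    then obtain d where d: "d \<in> g" using face_ne by blast
    have nb: "snd d \<in> nbrs E (fst d)" using d face_sub[OF gf] dart_iff[of "fst d" "snd d"] by auto
    then have "fst d \<in> ?C" using d g component_step nbrs_sym by blast
    then have "?P d" using allP nb by fastforce
    then show ?thesis using mem_face_iff[OF gf, of d] d by simp
  qed
  note iff = this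
  show "X = Y"
  proof (rule Set.set_eqI)
    fix g
    show "g \<in> X \<longleftrightarrow> g \<in> Y"
    proof (cases "g \<in> ?BF")
      case False
      then show ?thesis using X Y by (meson PowD subsetD)
    qed (rule iff)
  qed
qed

lemma component_cycle_space:
  assumes v: "v \<in> B \<union> W" "nbrs E v \<noteq> {}"
    and z: "z \<subseteq> {e \<in> E. fst e \<in> component E v}" "bd z = {}"
  shows "\<exists>X. X \<subseteq> bounded_faces E rot Fo \<and> z = fsum X"
proof -
  let ?C = "component E v"
  define EC where "EC = {e \<in> E. fst e \<in> ?C}"
  define BF where "BF = {f \<in> bounded_faces E rot Fo. snd ` f \<subseteq> ?C}"
  define Z where "Z = {z. z \<subseteq> EC \<and> bd z = {}}"
  have fin: "finite ?C" "finite EC" "finite BF"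
    using finite_component[OF v(1)] finite_E finite_faces by (simp_all add: EC_def BF_def bounded_faces_def)
  have finZ: "finite Z" using fin(2) finite_subset[of Z "Pow EC"] by (simp add: Z_def)
  obtain fo where fo: "fo \<in> Fo" "snd ` fo \<subseteq> ?C" "\<And>g. g \<in> Fo \<Longrightarrow> snd ` g \<subseteq> ?C \<Longrightarrow> g = fo"
    using outer_face[OF v] by metis
  have "x \<in> faces E rot \<and> snd ` x \<subseteq> ?C \<longleftrightarrow> x = fo \<or> x \<in> BF" for x
  proof (cases "x \<in> Fo")
    case True
    then show ?thesis using fo(1,2) fo(3)[of x] Fo_sub by (auto simp only: BF_def bounded_faces_def)
  next
    case False
    then show ?thesis using fo(1) by (simp only: BF_def bounded_faces_def) blast
  qed
  then have "{f \<in> faces E rot. snd ` f \<subseteq> ?C} = insert fo BF"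
    unfolding insert_def by blast
  moreover have "fo \<notin> BF" using fo(1) by (simp add: BF_def bounded_faces_def)
  ultimately have "int (card ?C) + int (card BF) = int (card EC) + 1" using euler[OF v] fin by (simp add: EC_def)
  moreover have "card ?C > 0" using fin(1) component_refl[of v] by (auto simp: card_gt_0_iff)
  ultimately have cardE: "card EC = card (?C - {v}) + card BF"
    using fin(1) component_refl[of v] by (simp add: card_Diff_singleton)
  have "\<forall>Y\<in>Pow (?C - {v}). \<exists>z. z \<subseteq> EC \<and> bd z - {v} = Y"
    using bd_surj fin(1) finite_subset unfolding EC_def by (metis PowD finite_Diff)
  from bchoice[OF this] obtain s where "\<forall>Y\<in>Pow (?C - {v}). s Y \<subseteq> EC \<and> bd (s Y) - {v} = Y" ..
  then have s: "s Y \<subseteq> EC \<and> bd (s Y) - {v} = Y" if "Y \<subseteq> ?C - {v}" for Y using that by blast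
  have "inj_on (\<lambda>(z, Y). sym_diff z (s Y)) (Z \<times> Pow (?C - {v}))"
  proof (rule inj_onI, clarify)
    fix z1 Y1 z2 Y2 assume a: "z1 \<in> Z" "z2 \<in> Z" "Y1 \<subseteq> ?C - {v}" "Y2 \<subseteq> ?C - {v}"
      and eq: "sym_diff z1 (s Y1) = sym_diff z2 (s Y2)"
    have *: "bd (sym_diff z (s Y)) = bd (s Y)" if "z \<in> Z" "Y \<subseteq> ?C - {v}" for z Y
      using that bd_sym_diff[of z "s Y"] s[of Y] fin(2) finite_subset[of _ EC] by (auto simp: Z_def)
    have "bd (s Y1) = bd (s Y2)" using * a eq by metis
    then have "Y1 = Y2" using s a by metis
    then show "z1 = z2 \<and> Y1 = Y2" using eq by blast
  qed
  moreover have "(\<lambda>(z, Y). sym_diff z (s Y)) ` (Z \<times> Pow (?C - {v})) \<subseteq> Pow EC"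
  proof clarify
    fix z Y x assume "z \<in> Z" "Y \<subseteq> ?C - {v}" "x \<in> sym_diff z (s Y)"
    then show "x \<in> EC" using s[of Y] unfolding Z_def by blast
  qed
  ultimately have "card (Z \<times> Pow (?C - {v})) \<le> card (Pow EC)"
    using fin(2) by (intro card_inj_on_le) auto
  then have "card Z * 2 ^ card (?C - {v}) \<le> 2 ^ card BF * 2 ^ card (?C - {v})"
    using fin by (simp add: card_cartesian_product card_Pow cardE power_add mult.commute)
  then have le: "card Z \<le> 2 ^ card BF" by simp
  have sub: "fsum X \<in> Z" if "X \<subseteq> BF" for X
    using finite_subset[OF that fin(3)] that
  proof (induction X rule: finite_induct)
    case empty
    show ?case by (simp add: Z_def fsum_def)
  next
    case (insert g X)
    interpret plane_face B W E rot Fo g by (rule plane_face) (use insert.prems in \<open>simp add: BF_def\<close>)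
    have "face_edges E g \<subseteq> EC"
    proof
      fix e assume e: "e \<in> face_edges E g"
      then have "fst e \<in> ?C \<or> snd e \<in> ?C" "e \<in> E"
        using insert.prems by (auto simp: face_edges_def BF_def)
      then show "e \<in> EC" using component_edge[of e v] by (auto simp: EC_def)
    qed
    moreover have "fsum X \<in> Z" using insert by auto
    moreover have "finite (fsum X)" "finite (face_edges E g)" using finite_E by (auto simp: fsum_def face_edges_def)
    ultimately show ?case
      unfolding fsum_insert[OF insert.hyps] Z_def using bd_sym_diff[of "fsum X" "face_edges E g"] bd_face_edges by auto
  qed
  have "fsum ` Pow BF = Z"
  proof (rule card_seteq[OF finZ])
    show "fsum ` Pow BF \<subseteq> Z" using sub by auto
    have "card (fsum ` Pow BF) = 2 ^ card BF"
      using card_image[OF inj_on_fsum[OF v]] fin by (simp add: BF_def card_Pow)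
    then show "card Z \<le> card (fsum ` Pow BF)" using le by simp
  qed
  moreover have "z \<in> Z" using z by (simp add: Z_def EC_def)
  ultimately show ?thesis by (auto simp: BF_def)
qed

lemma cycle_induct [consumes 2, case_names empty face]:
  assumes "z \<subseteq> E" "bd z = {}"
    and base: "P {}"
    and step: "\<And>z f. z \<subseteq> E \<Longrightarrow> bd z = {} \<Longrightarrow> P z \<Longrightarrow> f \<in> bounded_faces E rot Fo \<Longrightarrow> P (sym_diff z (face_edges E f))"
  shows "P z"
  using finite_subset[OF assms(1) finite_E] assms(1,2)
proof (induction z rule: finite_psubset_induct)
  case (psubset z)
  show ?case
  proof (cases "z = {}")
    case False
    then obtain e where e: "e \<in> z" by blast
    define v where "v = fst e"
    let ?EC = "{e \<in> E. fst e \<in> component E v}"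
    have v: "v \<in> B \<union> W" "nbrs E v \<noteq> {}"
      using e psubset.prems(1) E_mem[of "fst e" "snd e"] by (auto simp: v_def nbrs_def intro!: exI[of _ "snd e"])
    have inc: "incident (z \<inter> ?EC) u = (if u \<in> component E v then incident z u else {})" for u
    proof -
      have "e \<in> z \<Longrightarrow> fst e \<in> component E v \<longleftrightarrow> snd e \<in> component E v" for e
        using psubset.prems(1) component_edge by blast
      then show ?thesis using psubset.prems(1) by (auto simp: incident_def)
    qed
    have inc': "incident (z - ?EC) u = (if u \<in> component E v then {} else incident z u)" for u
    proof -
      have "e \<in> z \<Longrightarrow> fst e \<in> component E v \<longleftrightarrow> snd e \<in> component E v" for e
        using psubset.prems(1) component_edge by blast
      then show ?thesis using psubset.prems(1) by (auto simp: incident_def)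
    qed
    have bd: "bd (z \<inter> ?EC) = {}" "bd (z - ?EC) = {}"
      using psubset.prems(2) by (auto simp: bd_def inc inc')
    obtain X where X: "X \<subseteq> bounded_faces E rot Fo" "z \<inter> ?EC = fsum X"
      using component_cycle_space[OF v _ bd(1)] by blast
    have "z - ?EC \<subset> z" using e psubset.prems(1) component_refl[of v] by (auto simp: v_def)
    then have P0: "P (z - ?EC)" using psubset bd(2) by blast
    have finX: "finite X" using X(1) finite_faces finite_subset by (auto simp: bounded_faces_def)
    have "P (sym_diff (z - ?EC) (fsum X)) \<and> bd (sym_diff (z - ?EC) (fsum X)) = {}"
      using finX X(1)
    proof (induction X rule: finite_induct)
      case empty
      show ?case using P0 bd by (simp add: fsum_def)
    next
      case (insert g X)
      interpret plane_face B W E rot Fo g by (rule plane_face) (use insert.prems in simp)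
      let ?z = "sym_diff (z - ?EC) (fsum X)"
      have eq: "sym_diff (z - ?EC) (fsum (insert g X)) = sym_diff ?z (face_edges E g)"
        unfolding fsum_insert[OF insert.hyps] by blast
      have zE: "?z \<subseteq> E" using psubset.prems(1) by (auto simp: fsum_def)
      have "finite ?z" "finite (face_edges E g)"
        using finite_subset[OF zE finite_E] finite_E by (auto simp: face_edges_def)
      then have "bd (sym_diff ?z (face_edges E g)) = {}"
        using bd_sym_diff[of ?z "face_edges E g"] bd_face_edges insert by auto
      moreover have "P (sym_diff ?z (face_edges E g))"
        using insert by (intro step zE) auto
      ultimately show ?case unfolding eq by blast
    qed
    moreover have "sym_diff (z - ?EC) (fsum X) = z" unfolding X(2)[symmetric] by blast
    ultimately show ?thesis by simp
  qed (use base in simp)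
qed

end

section \<open>The sign of an edge set\<close>

lemma cyc_index_order:
  assumes "cyclic_bij f A" "finite A" "a \<in> A" "x \<in> A" "u \<in> A"
  defines "ix \<equiv> cyc_index f A a"
  shows "negif (ix u < ix x) * negif (ix u < ix (f x)) = negif (u = x) * negif (f x = a)"
    and "ix x < ix (f x) \<longleftrightarrow> f x \<noteq> a"
proof -
  note ixs = cyc_index[OF assms(1-3), folded ix_def]
  have inj: "ix u = ix x \<longleftrightarrow> u = x" using ixs(1) assms(4,5) by (auto simp: bij_betw_def dest: inj_onD)
  have lt: "ix u < card A" "ix x < card A" using ixs(1) assms(4,5) by (auto dest!: bij_betwE)
  show "ix x < ix (f x) \<longleftrightarrow> f x \<noteq> a" using ixs(3)[OF assms(4)] by auto
  show "negif (ix u < ix x) * negif (ix u < ix (f x)) = negif (u = x) * negif (f x = a)"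
  proof (cases "f x = a")
    case True
    then have "ix x = card A - 1" "ix (f x) = 0" using ixs(3,4)[OF assms(4)] by auto
    then show ?thesis using True inj lt by (auto simp: negif_def)
  next
    case False
    then have "ix (f x) = Suc (ix x)" using ixs(3)[OF assms(4)] by simp
    then show ?thesis using False inj by (auto simp: negif_def)
  qed
qed

lemma prod_negif: "finite z \<Longrightarrow> (\<Prod>e\<in>z. negif (Q e)) = (-1) ^ card {e \<in> z. Q e}"
proof (induction z rule: finite_induct)
  case (insert x z)
  then have "{e \<in> insert x z. Q e} = (if Q x then insert x {e \<in> z. Q e} else {e \<in> z. Q e})" by auto
  with insert show ?case by (simp add: negif_def)
qed simp

lemma negif_odd: "negif (odd k) = (-1) ^ k"
  by (simp add: negif_def)

lemma prod_pairs_Un: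
  fixes J :: "'a \<Rightarrow> 'a \<Rightarrow> 'b::comm_monoid_mult"
  assumes "finite A" "finite A'" "A \<inter> A' = {}"
  shows "(\<Prod>x\<in>A \<union> A'. \<Prod>y\<in>A \<union> A'. J x y) =
     (\<Prod>x\<in>A. \<Prod>y\<in>A. J x y) * (\<Prod>x\<in>A'. \<Prod>y\<in>A'. J x y) * (\<Prod>x\<in>A. \<Prod>y\<in>A'. J x y * J y x)"
proof -
  have "(\<Prod>x\<in>A'. \<Prod>y\<in>A. J x y) = (\<Prod>x\<in>A. \<Prod>y\<in>A'. J y x)"
    by (rule prod.swap)
  then show ?thesis using assms by (simp add: prod.union_disjoint prod.distrib ac_simps)
qed

lemma prod_pairs_sym_diff:
  fixes J :: "'a \<Rightarrow> 'a \<Rightarrow> real"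
  assumes "finite z" "finite F" and sq: "\<And>x y. J x y * J x y = 1"
  shows "(\<Prod>x\<in>sym_diff z F. \<Prod>y\<in>sym_diff z F. J x y) =
     (\<Prod>x\<in>z. \<Prod>y\<in>z. J x y) * (\<Prod>x\<in>F. \<Prod>y\<in>F. J x y) * (\<Prod>x\<in>z. \<Prod>y\<in>F. J x y * J y x)"
proof -
  define P where "P A = (\<Prod>x\<in>A. \<Prod>y\<in>A. J x y)" for A
  define X where "X A A' = (\<Prod>x\<in>A. \<Prod>y\<in>A'. J x y * J y x)" for A A'
  define A I D where "A = z - F" and "I = z \<inter> F" and "D = F - z"
  have fin: "finite A" "finite I" "finite D" using assms by (auto simp: A_def I_def D_def)
  have z: "z = A \<union> I" "A \<inter> I = {}" and F: "F = I \<union> D" "I \<inter> D = {}"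
    and s: "sym_diff z F = A \<union> D" "A \<inter> D = {}" by (auto simp: A_def I_def D_def)
  have U: "P (U \<union> V) = P U * P V * X U V" if "finite U" "finite V" "U \<inter> V = {}" for U V
    unfolding P_def X_def using that by (rule prod_pairs_Un)
  have one: "(\<Prod>x\<in>U. \<Prod>y\<in>V. J x y) * (\<Prod>x\<in>U. \<Prod>y\<in>V. J x y) = 1" for U V
    by (simp add: prod.distrib[symmetric] sq)
  have PP: "P U * P U = 1" for U unfolding P_def by (rule one)
  have "(\<Prod>x\<in>I. \<Prod>y\<in>I. J y x) = P I" unfolding P_def by (rule prod.swap)
  then have XII: "X I I = 1" using PP[of I] by (simp add: X_def prod.distrib P_def)
  have XX: "X U V * X U V = 1" for U V
  proof -
    have "X U V * X U V = (\<Prod>x\<in>U. \<Prod>y\<in>V. (J x y * J x y) * (J y x * J y x))"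
      by (simp add: X_def prod.distrib ac_simps)
    then show ?thesis by (simp add: sq)
  qed
  have Xz: "X z F = X A I * X A D * (X I I * X I D)"
    unfolding z(1) F(1) X_def using fin z(2) F(2) by (simp add: prod.union_disjoint prod.distrib)
  have "P z * P F * X z F = (P A * P D * X A D) * (P I * P I) * (X A I * X A I) * (X I D * X I D)"
    unfolding Xz XII using U[OF fin(1,2) z(2)] U[OF fin(2,3) F(2)] z(1) F(1) by (simp add: ac_simps)
  also have "\<dots> = P (sym_diff z F)" using U[OF fin(1,3) s(2)] s(1) by (simp add: PP XX)
  finally show ?thesis by (simp add: P_def X_def)
qed

locale kasteleyn_graph = plane_graph +
  fixes n :: "'a \<Rightarrow> nat" and cil :: "'a \<Rightarrow> 'a" and eps :: "'a \<times> 'a \<Rightarrow> real" and key :: "'a \<Rightarrow> nat"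
  assumes cilia: "cilia B W E cil" and kast: "kasteleyn E rot Fo n cil eps"
    and key: "inj_on key (B \<union> W)"
begin

definition ostep :: "'a \<Rightarrow> 'a \<Rightarrow> 'a" where
  "ostep v = (if v \<in> B then rot v else rinv v)"

definition ostart :: "'a \<Rightarrow> 'a" where
  "ostart v = (if v \<in> B then rot v (cil v) else cil v)"

definition pos :: "'a \<Rightarrow> 'a \<Rightarrow> nat" where
  "pos v = cyc_index (ostep v) (nbrs E v) (ostart v)"

lemma cil_mem: "u \<in> nbrs E v \<Longrightarrow> cil v \<in> nbrs E v"
  using cilia nbrs_vertex by (auto simp: cilia_def)

lemma ostep_cyclic: "v \<in> B \<union> W \<Longrightarrow> cyclic_bij (ostep v) (nbrs E v)"
  using rot_cyclic rinv_cyclic by (auto simp: ostep_def)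

lemma ostart_mem: "u \<in> nbrs E v \<Longrightarrow> ostart v \<in> nbrs E v"
  using cil_mem rot_mem by (auto simp: ostart_def)

lemma pos_bij:
  assumes "u \<in> nbrs E v"
  shows "bij_betw (pos v) (nbrs E v) {..<card (nbrs E v)}"
  unfolding pos_def using assms nbrs_vertex
  by (intro cyc_index(1) ostep_cyclic finite_nbrs ostart_mem[OF assms]) blast

lemma pos_eq_iff: "u \<in> nbrs E v \<Longrightarrow> u' \<in> nbrs E v \<Longrightarrow> pos v u = pos v u' \<longleftrightarrow> u = u'"
  using pos_bij[of u v] by (auto simp: bij_betw_def dest: inj_onD)

lemma pos_black:
  assumes "b \<in> B" "u \<in> nbrs E b" "y \<in> nbrs E b"
  shows "negif (pos b u < pos b y) * negif (pos b u < pos b (rot b y)) = negif (u = y) * negif (y = cil b)"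
    and "pos b y < pos b (rot b y) \<longleftrightarrow> y \<noteq> cil b"
proof -
  have eq: "rot b y = ostart b \<longleftrightarrow> y = cil b"
    unfolding ostart_def
    using assms(1) rinv_rot[OF assms(3)] rinv_rot[OF cil_mem[OF assms(3)]] by metis
  have b: "b \<in> B \<union> W" and o: "ostep b y = rot b y" using assms by (auto simp: ostep_def)
  note * = cyc_index_order[OF ostep_cyclic[OF b] finite_nbrs ostart_mem[OF assms(2)] assms(3,2), folded pos_def]
  show "negif (pos b u < pos b y) * negif (pos b u < pos b (rot b y)) = negif (u = y) * negif (y = cil b)"
    using *(1) unfolding eq o .
  show "pos b y < pos b (rot b y) \<longleftrightarrow> y \<noteq> cil b" using *(2) unfolding eq o .
qed

lemma pos_white:
  assumes "w \<in> W" "u \<in> nbrs E w" "x \<in> nbrs E w"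
  shows "negif (pos w u < pos w x) * negif (pos w u < pos w (rinv w x)) = negif (u = x) * negif (rinv w x = cil w)"
    and "pos w x < pos w (rinv w x) \<longleftrightarrow> rinv w x \<noteq> cil w"
proof -
  have "w \<notin> B" using assms(1) disj by auto
  then have eq: "ostart w = cil w" and o: "ostep w x = rinv w x" by (auto simp: ostep_def ostart_def)
  have w: "w \<in> B \<union> W" using assms by auto
  note * = cyc_index_order[OF ostep_cyclic[OF w] finite_nbrs ostart_mem[OF assms(2)] assms(3,2), folded pos_def]
  show "negif (pos w u < pos w x) * negif (pos w u < pos w (rinv w x)) = negif (u = x) * negif (rinv w x = cil w)"
    using *(1) unfolding eq o .
  show "pos w x < pos w (rinv w x) \<longleftrightarrow> rinv w x \<noteq> cil w" using *(2) unfolding eq o .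
qed

definition lessB :: "'a \<times> 'a \<Rightarrow> 'a \<times> 'a \<Rightarrow> bool" where
  "lessB e e' \<longleftrightarrow> key (fst e) < key (fst e') \<or> fst e = fst e' \<and> pos (fst e) (snd e) < pos (fst e) (snd e')"

definition lessW :: "'a \<times> 'a \<Rightarrow> 'a \<times> 'a \<Rightarrow> bool" where
  "lessW e e' \<longleftrightarrow> key (snd e) < key (snd e') \<or> snd e = snd e' \<and> pos (snd e) (fst e) < pos (snd e) (fst e')"

lemma key_eq_iff: "u \<in> B \<union> W \<Longrightarrow> v \<in> B \<union> W \<Longrightarrow> key u = key v \<longleftrightarrow> u = v"
  using key by (auto dest: inj_onD)

lemma edge_nbrs: "e \<in> E \<Longrightarrow> fst e \<in> B" "e \<in> E \<Longrightarrow> snd e \<in> W"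
  "e \<in> E \<Longrightarrow> snd e \<in> nbrs E (fst e)" "e \<in> E \<Longrightarrow> fst e \<in> nbrs E (snd e)"
  using E_mem[of "fst e" "snd e"] by (auto simp: nbrs_def)

lemma lessB_total: "e \<in> E \<Longrightarrow> e' \<in> E \<Longrightarrow> e \<noteq> e' \<Longrightarrow> lessB e' e \<longleftrightarrow> \<not> lessB e e'"
proof -
  assume e: "e \<in> E" "e' \<in> E" "e \<noteq> e'"
  have "key (fst e) = key (fst e') \<longleftrightarrow> fst e = fst e'" using e edge_nbrs by (intro key_eq_iff) auto
  moreover have "pos (fst e) (snd e) \<noteq> pos (fst e) (snd e')" if eq: "fst e = fst e'"
  proof -
    have "snd e \<noteq> snd e'" using e(3) eq by (metis prod_eqI)
    moreover have "snd e \<in> nbrs E (fst e)" "snd e' \<in> nbrs E (fst e)" unfolding eq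
      using e edge_nbrs eq by metis+
    ultimately show ?thesis by (simp add: pos_eq_iff)
  qed
  ultimately show ?thesis unfolding lessB_def by (metis not_less_iff_gr_or_eq)
qed

lemma lessW_total: "e \<in> E \<Longrightarrow> e' \<in> E \<Longrightarrow> e \<noteq> e' \<Longrightarrow> lessW e' e \<longleftrightarrow> \<not> lessW e e'"
proof -
  assume e: "e \<in> E" "e' \<in> E" "e \<noteq> e'"
  have "key (snd e) = key (snd e') \<longleftrightarrow> snd e = snd e'" using e edge_nbrs by (intro key_eq_iff) auto
  moreover have "pos (snd e) (fst e) \<noteq> pos (snd e) (fst e')" if eq: "snd e = snd e'"
  proof -
    have "fst e \<noteq> fst e'" using e(3) eq by (metis prod_eqI)
    moreover have "fst e \<in> nbrs E (snd e)" "fst e' \<in> nbrs E (snd e)" unfolding eq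
      using e edge_nbrs eq by metis+
    ultimately show ?thesis by (simp add: pos_eq_iff)
  qed
  ultimately show ?thesis unfolding lessW_def by (metis not_less_iff_gr_or_eq)
qed

text \<open>The quadratic form of the introduction: \<open>J e e' * J e' e\<close> is \<open>(-1) ^ I(e, e')\<close>.\<close>
definition J :: "'a \<times> 'a \<Rightarrow> 'a \<times> 'a \<Rightarrow> real" where
  "J e e' = negif (lessB e e' \<and> lessW e' e)"

lemma J_polar: "e \<in> E \<Longrightarrow> e' \<in> E \<Longrightarrow> J e e' * J e' e = negif (lessB e e') * negif (lessW e e')"
proof (cases "e = e'")
  case True
  then show ?thesis by (simp add: J_def lessB_def lessW_def)
next
  case False
  assume "e \<in> E" "e' \<in> E"
  then have "lessB e' e \<longleftrightarrow> \<not> lessB e e'" "lessW e' e \<longleftrightarrow> \<not> lessW e e'"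
    using False lessB_total lessW_total by blast+
  then show ?thesis by (cases "lessB e e'"; cases "lessW e e'") (simp_all add: J_def)
qed

definition Phi :: "('a \<times> 'a) set \<Rightarrow> real" where
  "Phi z = (\<Prod>e\<in>z. eps e) * (\<Prod>e\<in>z. \<Prod>e'\<in>z. J e e')"

lemma eps_sq: "e \<in> E \<Longrightarrow> eps e * eps e = 1"
  using kast by (auto simp: kasteleyn_def)

end

section \<open>Invariance under adding a face\<close>

locale kasteleyn_face = kasteleyn_graph + plane_face
begin

definition cilB :: "'a \<times> 'a \<Rightarrow> bool" where "cilB d \<longleftrightarrow> snd d = cil (fst d)"
definition cilW :: "'a \<times> 'a \<Rightarrow> bool" where "cilW d \<longleftrightarrow> rinv (snd d) (fst d) = cil (snd d)"

abbreviation F where "F \<equiv> face_edges E f"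

lemma D_E: "d \<in> D \<Longrightarrow> d \<in> E" by (simp add: D_iff)

lemma next_edge_E: "d \<in> D \<Longrightarrow> next_edge d \<in> E"
  using next_edge_image by blast

lemma F_sub: "F \<subseteq> E" and finite_F: "finite F"
  using finite_E by (auto simp: face_edges_def)

lemma prod_F_prev_edge: "(\<Prod>e\<in>F. h e) = (\<Prod>d\<in>D. h d * h (prev_edge d))" for h :: "'a \<times> 'a \<Rightarrow> real"
  unfolding face_edges_eq(1) using finite_D D_disj(1) inj_prev_edge
  by (simp add: prod.union_disjoint prod.reindex prod.distrib)

lemma prod_F_next_edge: "(\<Prod>e\<in>F. h e) = (\<Prod>d\<in>D. h d * h (next_edge d))" for h :: "'a \<times> 'a \<Rightarrow> real"
  unfolding face_edges_eq(2) using finite_D D_disj(2) inj_next_edge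
  by (simp add: prod.union_disjoint prod.reindex prod.distrib)

lemma prod_lessB:
  assumes e: "e \<in> E"
  shows "(\<Prod>e'\<in>F. negif (lessB e e')) = (\<Prod>d\<in>D. negif (e = d) * negif (fst e = fst d \<and> cilB d))"
  unfolding prod_F_prev_edge
proof (rule prod.cong[OF refl])
  fix d assume d: "d \<in> D"
  obtain b y where dby: "d = (b, y)" by (cases d)
  obtain a u where au: "e = (a, u)" by (cases e)
  show "negif (lessB e d) * negif (lessB e (prev_edge d)) = negif (e = d) * negif (fst e = fst d \<and> cilB d)"
  proof (cases "a = b")
    case True
    have "negif (pos b u < pos b y) * negif (pos b u < pos b (rot b y)) = negif (u = y) * negif (y = cil b)"
      using edge_nbrs[OF e] edge_nbrs[OF D_E[OF d]] True by (intro pos_black) (auto simp: dby au)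
    then show ?thesis by (simp add: lessB_def dby au prev_edge_def True cilB_def)
  next
    case False
    then show ?thesis by (simp add: lessB_def dby au prev_edge_def)
  qed
qed

lemma prod_lessW:
  assumes e: "e \<in> E"
  shows "(\<Prod>e'\<in>F. negif (lessW e e')) = (\<Prod>d\<in>D. negif (e = d) * negif (snd e = snd d \<and> cilW d))"
  unfolding prod_F_next_edge
proof (rule prod.cong[OF refl])
  fix d assume d: "d \<in> D"
  obtain x w where xw: "d = (x, w)" by (cases d)
  obtain u a where ua: "e = (u, a)" by (cases e)
  show "negif (lessW e d) * negif (lessW e (next_edge d)) = negif (e = d) * negif (snd e = snd d \<and> cilW d)"
  proof (cases "a = w")
    case True
    have "negif (pos w u < pos w x) * negif (pos w u < pos w (rinv w x)) = negif (u = x) * negif (rinv w x = cil w)"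
      using edge_nbrs[OF e] edge_nbrs[OF D_E[OF d]] True by (intro pos_white) (auto simp: xw ua)
    then show ?thesis by (simp add: lessW_def xw ua next_edge_def True cilW_def)
  next
    case False
    then show ?thesis by (simp add: lessW_def xw ua next_edge_def)
  qed
qed

lemma cross_term:
  assumes z: "z \<subseteq> E" and bdz: "bd z = {v \<in> B \<union> W. odd (n v)}"
  shows "(\<Prod>e\<in>z. \<Prod>e'\<in>F. J e e' * J e' e) =
    (\<Prod>d\<in>D. negif (cilB d \<and> odd (n (fst d))) * negif (cilW d \<and> odd (n (snd d))))"
proof -
  have finz: "finite z" using z finite_E finite_subset by blast
  have "(\<Prod>e\<in>z. \<Prod>e'\<in>F. J e e' * J e' e) =
      (\<Prod>e\<in>z. (\<Prod>e'\<in>F. negif (lessB e e')) * (\<Prod>e'\<in>F. negif (lessW e e')))"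
    unfolding prod.distrib[symmetric] using z F_sub by (intro prod.cong refl J_polar) auto
  also have "\<dots> = (\<Prod>e\<in>z. \<Prod>d\<in>D. negif (fst e = fst d \<and> cilB d) * negif (snd e = snd d \<and> cilW d))"
  proof (rule prod.cong[OF refl])
    fix e assume "e \<in> z"
    then have e: "e \<in> E" using z by blast
    show "(\<Prod>e'\<in>F. negif (lessB e e')) * (\<Prod>e'\<in>F. negif (lessW e e')) =
        (\<Prod>d\<in>D. negif (fst e = fst d \<and> cilB d) * negif (snd e = snd d \<and> cilW d))"
      unfolding prod_lessB[OF e] prod_lessW[OF e] prod.distrib[symmetric]
      by (intro prod.cong refl) (auto simp: negif_def)
  qed
  also have "\<dots> = (\<Prod>d\<in>D. \<Prod>e\<in>z. negif (fst e = fst d \<and> cilB d) * negif (snd e = snd d \<and> cilW d))"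
    by (rule prod.swap)
  also have "\<dots> = (\<Prod>d\<in>D. negif (cilB d \<and> odd (n (fst d))) * negif (cilW d \<and> odd (n (snd d))))"
  proof (rule prod.cong[OF refl])
    fix d assume d: "d \<in> D"
    then have dE: "d \<in> E" by (rule D_E)
    have v: "fst d \<in> B" "snd d \<in> W" "fst d \<notin> W" "snd d \<notin> B" using edge_nbrs[OF dE] disj by auto
    have i: "incident z (fst d) = {e \<in> z. fst e = fst d}" "incident z (snd d) = {e \<in> z. snd e = snd d}"
      using z v edge_nbrs by (auto simp: incident_def)
    have "odd (card {e \<in> z. fst e = fst d}) \<longleftrightarrow> odd (n (fst d))"
      "odd (card {e \<in> z. snd e = snd d}) \<longleftrightarrow> odd (n (snd d))"
      using bdz v unfolding i[symmetric] bd_def by blast+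
    then have c: "(-1::real) ^ card {e \<in> z. fst e = fst d} = negif (odd (n (fst d)))"
      "(-1::real) ^ card {e \<in> z. snd e = snd d} = negif (odd (n (snd d)))"
      by (simp_all only: negif_odd[symmetric])
    have "(\<Prod>e\<in>z. negif (fst e = fst d \<and> cilB d)) = negif (cilB d \<and> odd (n (fst d)))"
      by (cases "cilB d") (simp_all add: prod_negif[OF finz] c)
    moreover have "(\<Prod>e\<in>z. negif (snd e = snd d \<and> cilW d)) = negif (cilW d \<and> odd (n (snd d)))"
      by (cases "cilW d") (simp_all add: prod_negif[OF finz] c)
    ultimately show "(\<Prod>e\<in>z. negif (fst e = fst d \<and> cilB d) * negif (snd e = snd d \<and> cilW d)) =
        negif (cilB d \<and> odd (n (fst d))) * negif (cilW d \<and> odd (n (snd d)))"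
      by (simp add: prod.distrib)
  qed
  finally show ?thesis .
qed

lemma inj_key: "inj_on (\<lambda>d. key (fst d)) D" "inj_on (\<lambda>d. key (snd d)) D"
  using inj_D edge_nbrs D_E key_eq_iff by (auto simp: inj_on_def)

lemma face_term: "(\<Prod>e\<in>F. \<Prod>e'\<in>F. J e e') = (-1) ^ (card D - 1) * (\<Prod>d\<in>D. negif (cilB d) * negif (cilW d))"
proof -
  let ?kb = "\<lambda>d. key (fst d)" and ?kw = "\<lambda>d. key (snd d)"
  have kb: "?kb d \<noteq> ?kb g" "?kw d \<noteq> ?kw g" if "d \<in> D" "g \<in> D" "d \<noteq> g" for d g
    using inj_key that by (auto dest: inj_onD)
  have split: "(\<Prod>e\<in>F. \<Prod>e'\<in>F. J e e') = (\<Prod>e\<in>D. \<Prod>e'\<in>D. J e e') *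
     (\<Prod>e\<in>next_edge ` D. \<Prod>e'\<in>next_edge ` D. J e e') * (\<Prod>e\<in>D. \<Prod>e'\<in>next_edge ` D. J e e' * J e' e)"
    unfolding face_edges_eq(2) using finite_D D_disj by (intro prod_pairs_Un) auto
  let ?s = "fstep \<circ> fstep"
  have sD: "?s d \<in> D" "?s d = ?s g \<longleftrightarrow> d = g" if "d \<in> D" "g \<in> D" for d g
    using D_cyclic that bij_betw_apply[of ?s D D d] inj_on_eq_iff[of ?s D d g]
    unfolding cyclic_bij_def bij_betw_def by blast+
  have "(\<Prod>e\<in>D. \<Prod>e'\<in>D. J e e') * (\<Prod>e\<in>next_edge ` D. \<Prod>e'\<in>next_edge ` D. J e e')
      = (\<Prod>d\<in>D. \<Prod>g\<in>D. J d g * J (next_edge d) (next_edge g))"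
    using inj_next_edge by (simp add: prod.reindex prod.distrib)
  also have "\<dots> = (\<Prod>d\<in>D. \<Prod>g\<in>D. negif (?kb d < ?kb g \<and> ?kb (?s g) < ?kb (?s d)))"
  proof (rule prod_pairs_cong[OF finite_D])
    fix d g assume dg: "d \<in> D" "g \<in> D" "d \<noteq> g"
    have s: "?kb (?s d) \<noteq> ?kb (?s g)" using kb(1)[of "?s d" "?s g"] sD[OF dg(1,2)] sD(1)[OF dg(2,1)] dg by blast
    have next_edge: "fst (next_edge x) = fst (?s x)" "snd (next_edge x) = snd x" for x by (simp_all only: fst_fstep2, simp add: next_edge_def)
    have ne: "fst d \<noteq> fst g" "snd d \<noteq> snd g" "fst (?s d) \<noteq> fst (?s g)" using kb[OF dg] s by auto
    have j: "J x y = negif (?kb x < ?kb y \<and> ?kw y < ?kw x)" if "fst x \<noteq> fst y" "snd x \<noteq> snd y" for x y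
      using that by (auto simp: J_def lessB_def lessW_def)
    have j': "J (next_edge x) (next_edge y) = negif (?kb (?s x) < ?kb (?s y) \<and> ?kw y < ?kw x)"
      if "fst (?s x) \<noteq> fst (?s y)" "snd x \<noteq> snd y" for x y
      using that j[of "next_edge x" "next_edge y"] by (simp only: next_edge) simp
    show "J d g * J (next_edge d) (next_edge g) * (J g d * J (next_edge g) (next_edge d)) =
       negif (?kb d < ?kb g \<and> ?kb (?s g) < ?kb (?s d)) * negif (?kb g < ?kb d \<and> ?kb (?s d) < ?kb (?s g))"
      using kb[OF dg] s unfolding j[OF ne(1,2)] j'[OF ne(3,2)] j[OF ne(1,2)[symmetric]] j'[OF ne(3,2)[symmetric]]
      by (auto simp: negif_def)
  qed (simp add: J_def lessB_def lessW_def)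
  also have "\<dots> = (-1) ^ (card D - 1)"
    by (rule inversions_cyclic_bij[OF D_cyclic finite_D D_ne inj_key(1)])
  finally have same: "(\<Prod>e\<in>D. \<Prod>e'\<in>D. J e e') * (\<Prod>e\<in>next_edge ` D. \<Prod>e'\<in>next_edge ` D. J e e') = (-1) ^ (card D - 1)" .
  have fab: "prev_edge ` D = next_edge ` D" using prev_edge_image next_edge_image by simp
  have "(\<Prod>e\<in>D. \<Prod>e'\<in>next_edge ` D. J e e' * J e' e) =
      (\<Prod>e\<in>D. (\<Prod>e'\<in>next_edge ` D. negif (lessB e e')) * (\<Prod>e'\<in>next_edge ` D. negif (lessW e e')))"
    unfolding prod.distrib[symmetric] using D_E next_edge_E by (intro prod.cong refl J_polar) auto
  also have "\<dots> = (\<Prod>d\<in>D. \<Prod>g\<in>D. negif (lessB d (prev_edge g))) * (\<Prod>d\<in>D. \<Prod>g\<in>D. negif (lessW d (next_edge g)))"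
  proof -
    have "(\<Prod>e'\<in>next_edge ` D. negif (lessB e e')) = (\<Prod>g\<in>D. negif (lessB e (prev_edge g)))" for e
      unfolding fab[symmetric] using inj_prev_edge by (simp add: prod.reindex)
    moreover have "(\<Prod>e'\<in>next_edge ` D. negif (lessW e e')) = (\<Prod>g\<in>D. negif (lessW e (next_edge g)))" for e
      using inj_next_edge by (simp add: prod.reindex)
    ultimately show ?thesis by (simp only: prod.distrib)
  qed
  also have "(\<Prod>d\<in>D. \<Prod>g\<in>D. negif (lessB d (prev_edge g))) =
      (\<Prod>d\<in>D. \<Prod>g\<in>D. negif (?kb d < ?kb g) * (if g = d then negif (\<not> cilB d) else 1))"
  proof (intro prod.cong refl)
    fix d g assume dg: "d \<in> D" "g \<in> D"
    show "negif (lessB d (prev_edge g)) = negif (?kb d < ?kb g) * (if g = d then negif (\<not> cilB d) else 1)"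
    proof (cases "g = d")
      case True
      have "pos (fst d) (snd d) < pos (fst d) (rot (fst d) (snd d)) \<longleftrightarrow> snd d \<noteq> cil (fst d)"
        using edge_nbrs[OF D_E[OF dg(1)]] by (intro pos_black) auto
      then show ?thesis by (simp add: True lessB_def prev_edge_def cilB_def)
    next
      case False
      then have "fst d \<noteq> fst g" using inj_D(1) dg by (auto dest: inj_onD)
      then show ?thesis using False by (simp add: lessB_def prev_edge_def)
    qed
  qed
  also have "(\<Prod>d\<in>D. \<Prod>g\<in>D. negif (lessW d (next_edge g))) =
      (\<Prod>d\<in>D. \<Prod>g\<in>D. negif (?kw d < ?kw g) * (if g = d then negif (\<not> cilW d) else 1))"
  proof (intro prod.cong refl)
    fix d g assume dg: "d \<in> D" "g \<in> D"
    show "negif (lessW d (next_edge g)) = negif (?kw d < ?kw g) * (if g = d then negif (\<not> cilW d) else 1)"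
    proof (cases "g = d")
      case True
      have "pos (snd d) (fst d) < pos (snd d) (rinv (snd d) (fst d)) \<longleftrightarrow> rinv (snd d) (fst d) \<noteq> cil (snd d)"
        using edge_nbrs[OF D_E[OF dg(1)]] by (intro pos_white) auto
      then show ?thesis by (simp add: True lessW_def next_edge_def cilW_def)
    next
      case False
      then have "snd d \<noteq> snd g" using inj_D(2) dg by (auto dest: inj_onD)
      then show ?thesis using False by (simp add: lessW_def next_edge_def)
    qed
  qed
  also have "(\<Prod>d\<in>D. \<Prod>g\<in>D. negif (?kb d < ?kb g) * (if g = d then negif (\<not> cilB d) else 1)) *
      (\<Prod>d\<in>D. \<Prod>g\<in>D. negif (?kw d < ?kw g) * (if g = d then negif (\<not> cilW d) else 1)) =
      (\<Prod>d\<in>D. \<Prod>g\<in>D. negif (?kb d < ?kb g)) * (\<Prod>d\<in>D. \<Prod>g\<in>D. negif (?kw d < ?kw g)) *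
      (\<Prod>d\<in>D. negif (cilB d) * negif (cilW d))"
    using finite_D by (simp add: prod.distrib prod.delta negif_not prod_uminus flip: power_add mult_2)
  also have "(\<Prod>d\<in>D. \<Prod>g\<in>D. negif (?kb d < ?kb g)) = (\<Prod>d\<in>D. \<Prod>g\<in>D. negif (?kw d < ?kw g))"
  proof (rule prod_pairs_cong[OF finite_D])
    fix d g assume dg: "d \<in> D" "g \<in> D" "d \<noteq> g"
    show "negif (?kb d < ?kb g) * negif (?kb g < ?kb d) = negif (?kw d < ?kw g) * negif (?kw g < ?kw d)"
      using kb[OF dg] by (auto simp: negif_def)
  qed simp
  also have "(\<Prod>d\<in>D. \<Prod>g\<in>D. negif (?kw d < ?kw g)) * (\<Prod>d\<in>D. \<Prod>g\<in>D. negif (?kw d < ?kw g)) = 1"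
    by (simp flip: prod.distrib)
  finally show ?thesis unfolding split same by simp
qed

lemma k_face_sign: "(-1::real) ^ k_face rot cil n f =
   (\<Prod>d\<in>D. negif (cilB d \<and> even (n (fst d))) * negif (cilW d \<and> even (n (snd d))))"
proof -
  have inB: "cilium_in rot cil (fst d) f \<longleftrightarrow> cilB d" if d: "d \<in> D" for d
  proof -
    obtain b y where dby: "d = (b, y)" by (cases d)
    have m: "y \<in> nbrs E b" "(b, y) \<in> f" using d D_mem by (auto simp: dby D_iff)
    have p: "(rot b y, b) \<in> f" using face_pred[OF f_face m(2)] .
    have "(rot b (cil b), b) \<in> f \<longleftrightarrow> rot b (cil b) = rot b y"
      using p inj_onD[OF f_simple(3), of "(rot b (cil b), b)" "(rot b y, b)"] by auto
    also have "\<dots> \<longleftrightarrow> cil b = y" using rinv_rot[OF m(1)] rinv_rot[OF cil_mem[OF m(1)]] by metis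
    finally show ?thesis by (auto simp: dby cilium_in_def cilB_def)
  qed
  have inW: "cilium_in rot cil (snd d) f \<longleftrightarrow> cilW d" if d: "d \<in> D" for d
  proof -
    obtain x w where xw: "d = (x, w)" by (cases d)
    have m: "x \<in> nbrs E w" "(x, w) \<in> f" using d D_mem by (auto simp: xw D_iff)
    have "(rot w (cil w), w) \<in> f \<longleftrightarrow> rot w (cil w) = x"
      using m(2) inj_onD[OF f_simple(3), of "(rot w (cil w), w)" "(x, w)"] by auto
    also have "\<dots> \<longleftrightarrow> rinv w x = cil w" using rinv_rot[OF cil_mem[OF m(1)]] rot_rinv[OF m(1)] by metis
    finally show ?thesis by (auto simp: xw cilium_in_def cilW_def)
  qed
  have vs: "snd ` f = fst ` D \<union> snd ` D"
  proof (intro equalityI subsetI)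
    fix v assume "v \<in> snd ` f"
    then obtain u where u: "(u, v) \<in> f" by auto
    show "v \<in> fst ` D \<union> snd ` D"
    proof (cases "u \<in> B")
      case True
      then have "(u, v) \<in> D" using u by (simp add: D_def)
      then show ?thesis by force
    next
      case False
      have "fstep (u, v) \<in> D" using face_fstep[OF f_face u] fstep_side[OF u] False by (simp add: D_def)
      then show ?thesis by (force simp: fstep_simp)
    qed
  next
    fix v assume "v \<in> fst ` D \<union> snd ` D"
    then obtain d where d: "d \<in> D" "v = fst d \<or> v = snd d" by auto
    have df: "(fst d, snd d) \<in> f" using d by (simp add: D_def)
    then show "v \<in> snd ` f" using d(2) face_pred[OF f_face df] by force
  qed
  let ?S = "{d \<in> D. cilB d \<and> even (n (fst d))}" and ?T = "{d \<in> D. cilW d \<and> even (n (snd d))}"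
  have "{v \<in> snd ` f. even (n v) \<and> cilium_in rot cil v f} = fst ` ?S \<union> snd ` ?T"
    unfolding vs using inB inW by auto
  moreover have "fst ` ?S \<inter> snd ` ?T = {}" using D_mem disj by fastforce
  moreover have "card (fst ` ?S) = card ?S" "card (snd ` ?T) = card ?T"
    by (intro card_image inj_on_subset[OF inj_D(1)] inj_on_subset[OF inj_D(2)]; blast)+
  ultimately have "k_face rot cil n f = card ?S + card ?T"
    unfolding k_face_def using finite_D by (simp add: card_Un_disjoint)
  then show ?thesis by (simp add: prod.distrib prod_negif[OF finite_D] power_add)
qed

lemma Phi_face:
  assumes z: "z \<subseteq> E" and bdz: "bd z = {v \<in> B \<union> W. odd (n v)}"
  shows "Phi (sym_diff z F) = Phi z"
proof -
  have finz: "finite z" using z finite_E finite_subset by blast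
  have sq: "J x y * J x y = 1" for x y by (simp add: J_def)
  have eps: "(\<Prod>e\<in>sym_diff z F. eps e) = (\<Prod>e\<in>z. eps e) * (\<Prod>e\<in>F. eps e)"
  proof -
    have "(\<Prod>e\<in>z \<inter> F. eps e) * (\<Prod>e\<in>z \<inter> F. eps e) = 1"
      unfolding prod.distrib[symmetric] using z eps_sq by (intro prod.neutral) auto
    moreover have "(\<Prod>e\<in>z. eps e) = (\<Prod>e\<in>z - F. eps e) * (\<Prod>e\<in>z \<inter> F. eps e)"
      using finz by (subst prod.union_disjoint[symmetric]) (auto intro: prod.cong)
    moreover have "(\<Prod>e\<in>F. eps e) = (\<Prod>e\<in>F - z. eps e) * (\<Prod>e\<in>z \<inter> F. eps e)"
      using finite_F by (subst prod.union_disjoint[symmetric]) (auto intro: prod.cong)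
    moreover have "(\<Prod>e\<in>sym_diff z F. eps e) = (\<Prod>e\<in>z - F. eps e) * (\<Prod>e\<in>F - z. eps e)"
      using finz finite_F by (intro prod.union_disjoint) auto
    ultimately show ?thesis by (simp add: ac_simps)
  qed
  have kF: "(\<Prod>e\<in>F. eps e) = (-1) ^ (card D + 1) * (-1) ^ k_face rot cil n f"
    using kast f card_f by (simp add: kasteleyn_def power_add)
  have rearr: "(a * k) * ((a' * p) * x) = (a * a') * (k * (p * x))" for a a' k p x :: real
    by (simp only: ac_simps)
  have "(\<Prod>e\<in>F. eps e) * ((\<Prod>e\<in>F. \<Prod>e'\<in>F. J e e') * (\<Prod>e\<in>z. \<Prod>e'\<in>F. J e e' * J e' e)) =
     ((-1) ^ (card D + 1) * (-1) ^ (card D - 1)) *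
     (\<Prod>d\<in>D. (negif (cilB d \<and> even (n (fst d))) * negif (cilW d \<and> even (n (snd d)))) *
        ((negif (cilB d) * negif (cilW d)) *
         (negif (cilB d \<and> odd (n (fst d))) * negif (cilW d \<and> odd (n (snd d))))))"
    unfolding kF face_term cross_term[OF z bdz] k_face_sign rearr prod.distrib[symmetric] ..
  also have "(\<Prod>d\<in>D. (negif (cilB d \<and> even (n (fst d))) * negif (cilW d \<and> even (n (snd d)))) *
        ((negif (cilB d) * negif (cilW d)) *
         (negif (cilB d \<and> odd (n (fst d))) * negif (cilW d \<and> odd (n (snd d)))))) = 1"
    by (rule prod.neutral) (auto simp: negif_def)
  also have "(-1::real) ^ (card D + 1) * (-1) ^ (card D - 1) = 1"
  proof -
    obtain k where "card D = Suc k" using finite_D D_ne by (metis card_0_eq not0_implies_Suc)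
    then show ?thesis by (simp flip: power_add mult_2)
  qed
  finally have *: "(\<Prod>e\<in>F. eps e) * ((\<Prod>e\<in>F. \<Prod>e'\<in>F. J e e') * (\<Prod>e\<in>z. \<Prod>e'\<in>F. J e e' * J e' e)) = 1"
    by simp
  have "Phi (sym_diff z F) = Phi z *
     ((\<Prod>e\<in>F. eps e) * ((\<Prod>e\<in>F. \<Prod>e'\<in>F. J e e') * (\<Prod>e\<in>z. \<Prod>e'\<in>F. J e e' * J e' e)))"
    unfolding Phi_def eps prod_pairs_sym_diff[OF finz finite_F sq] by (simp only: ac_simps)
  then show ?thesis unfolding * by simp
qed

end

context kasteleyn_graph
begin

lemma Phi_const:
  assumes "z0 \<subseteq> E" "bd z0 = {v \<in> B \<union> W. odd (n v)}" "z1 \<subseteq> E" "bd z1 = {v \<in> B \<union> W. odd (n v)}"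
  shows "Phi z1 = Phi z0"
proof -
  have fin: "finite z" if "z \<subseteq> E" for z using that finite_E finite_subset by blast
  have "bd (sym_diff z0 z1) = {}"
    using bd_sym_diff[OF fin[OF assms(1)] fin[OF assms(3)]] assms by simp
  moreover have "sym_diff z0 z1 \<subseteq> E" using assms by blast
  moreover have "Phi (sym_diff z0 z) = Phi z0" if "z \<subseteq> E" "bd z = {}" for z
    using that
  proof (induction rule: cycle_induct)
    case (face z f)
    interpret kasteleyn_face B W E rot Fo n cil eps key f
      by (intro kasteleyn_face.intro kasteleyn_graph_axioms plane_face face)
    have "bd (sym_diff z0 z) = {v \<in> B \<union> W. odd (n v)}"
      using bd_sym_diff[OF fin[OF assms(1)] fin[OF face(1)]] assms(2) face(2) by simp
    moreover have "sym_diff z0 z \<subseteq> E" using assms(1) face(1) by blast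
    ultimately have "Phi (sym_diff (sym_diff z0 z) F) = Phi (sym_diff z0 z)" by (intro Phi_face)
    moreover have "sym_diff z0 (sym_diff z F) = sym_diff (sym_diff z0 z) F" by blast
    ultimately show ?case using face.IH by simp
  qed simp
  ultimately have "Phi (sym_diff z0 (sym_diff z0 z1)) = Phi z0" by blast
  moreover have "sym_diff z0 (sym_diff z0 z1) = z1" by blast
  ultimately show ?thesis by simp
qed

end

section \<open>Factorization of the sign of a permutation\<close>

definition enum_of :: "nat set \<Rightarrow> nat \<Rightarrow> nat" where
  "enum_of A i = sorted_list_of_set A ! i"

lemma enum_of_bij: "finite A \<Longrightarrow> bij_betw (enum_of A) {..<card A} A"
  unfolding enum_of_def[abs_def] using bij_betw_nth[of "sorted_list_of_set A" "{..<card A}" A] by simp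

lemma enum_of_less_iff:
  assumes "i < card A" "j < card A"
  shows "enum_of A i < enum_of A j \<longleftrightarrow> i < j"
proof -
  have "enum_of A i < enum_of A j" if "i < j" "j < card A" for i j
    using sorted_wrt_nth_less[OF strict_sorted_list_of_set[of A] that(1)] that by (simp add: enum_of_def)
  then show ?thesis using assms by (metis less_asym linorder_neqE_nat)
qed

definition index_in :: "nat set \<Rightarrow> nat \<Rightarrow> nat" where
  "index_in A = inv_into {..<card A} (enum_of A)"

lemma index_in:
  assumes "finite A" "a \<in> A"
  shows "index_in A a < card A" "enum_of A (index_in A a) = a"
  using enum_of_bij[OF assms(1)] assms(2) bij_betw_apply[OF bij_betw_inv_into[OF enum_of_bij[OF assms(1)]], of a]
  by (auto simp: index_in_def bij_betw_inv_into_right)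

lemma index_in_enum: "finite A \<Longrightarrow> i < card A \<Longrightarrow> index_in A (enum_of A i) = i"
  using enum_of_bij[of A] by (simp add: index_in_def bij_betw_inv_into_left)

lemma enum_of_mem: "finite A \<Longrightarrow> i < card A \<Longrightarrow> enum_of A i \<in> A"
  using enum_of_bij[of A] by (auto dest: bij_betwE)

lemma negif_xor:
  assumes "u' \<longleftrightarrow> \<not> u" "v' \<longleftrightarrow> \<not> v"
  shows "negif (u \<and> v') * negif (u' \<and> v) = negif (u \<noteq> v)"
  using assms by (cases u; cases v) simp_all

lemma prod_fibers:
  fixes n :: "'v \<Rightarrow> nat"
  assumes "finite W" "bij_betw r {..<N} (SIGMA w:W. {1..n w})"
  shows "(\<Prod>k<N. \<Prod>l<N. negif (fst (r k) = fst (r l) \<and> h (r k) (r l)))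
       = (\<Prod>w\<in>W. \<Prod>a\<in>{1..n w}. \<Prod>a'\<in>{1..n w}. negif (h (w, a) (w, a')))"
proof -
  let ?I = "SIGMA w:W. {1..n w}"
  have "(\<Prod>k<N. \<Prod>l<N. negif (fst (r k) = fst (r l) \<and> h (r k) (r l)))
      = (\<Prod>x\<in>?I. \<Prod>y\<in>?I. negif (fst x = fst y \<and> h x y))"
    using prod.reindex_bij_betw[OF assms(2), of "\<lambda>x. \<Prod>y\<in>?I. negif (fst x = fst y \<and> h x y)"]
      prod.reindex_bij_betw[OF assms(2), of "\<lambda>y. negif (fst (r k) = fst y \<and> h (r k) y)" for k]
    by simp
  also have "\<dots> = (\<Prod>w\<in>W. \<Prod>a\<in>{1..n w}. \<Prod>w'\<in>W. \<Prod>a'\<in>{1..n w'}. negif (w = w' \<and> h (w, a) (w', a')))"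
  proof -
    have "(\<Prod>x\<in>?I. g x) = (\<Prod>w\<in>W. \<Prod>a\<in>{1..n w}. g (w, a))" for g :: "'v \<times> nat \<Rightarrow> real"
      using prod.Sigma[of W "\<lambda>w. {1..n w}" "\<lambda>w a. g (w, a)"] assms(1) by simp
    then show ?thesis by simp
  qed
  also have "\<dots> = (\<Prod>w\<in>W. \<Prod>a\<in>{1..n w}. \<Prod>w'\<in>W. if w' = w then \<Prod>a'\<in>{1..n w}. negif (h (w, a) (w, a')) else 1)"
    by (intro prod.cong refl) auto
  also have "\<dots> = (\<Prod>w\<in>W. \<Prod>a\<in>{1..n w}. \<Prod>a'\<in>{1..n w}. negif (h (w, a) (w, a')))"
    using assms(1) by (intro prod.cong refl) simp
  finally show ?thesis .
qed

context kasteleyn_graph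
begin

lemma edge_order_eq:
  "edge_order B E rot cil v = map (\<lambda>k. (ostep v ^^ k) (ostart v)) [0..<card (nbrs E v)]"
  by (simp add: edge_order_def ostep_def ostart_def funpow_swap1)

lemma edge_order_props:
  assumes "v \<in> B \<union> W"
  shows "set (edge_order B E rot cil v) = nbrs E v"
    and "sorted_wrt (\<lambda>u u'. pos v u < pos v u') (edge_order B E rot cil v)"
proof -
  have "set (edge_order B E rot cil v) = nbrs E v \<and>
      sorted_wrt (\<lambda>u u'. pos v u < pos v u') (edge_order B E rot cil v)"
  proof (cases "nbrs E v = {}")
    case False
    then have st: "ostart v \<in> nbrs E v" using ostart_mem by blast
    note bij = cyclic_bij_enum(1)[OF ostep_cyclic[OF assms] finite_nbrs st]
    note ix = cyc_index(2)[OF ostep_cyclic[OF assms] finite_nbrs st, folded pos_def]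
    have "set (edge_order B E rot cil v) = nbrs E v"
      using bij by (simp add: edge_order_eq bij_betw_def atLeast0LessThan)
    moreover have "sorted_wrt (\<lambda>u u'. pos v u < pos v u') (edge_order B E rot cil v)"
      unfolding edge_order_eq sorted_wrt_iff_nth_less by (simp add: ix)
    ultimately show ?thesis by blast
  qed (simp add: edge_order_eq)
  then show "set (edge_order B E rot cil v) = nbrs E v"
    "sorted_wrt (\<lambda>u u'. pos v u < pos v u') (edge_order B E rot cil v)" by auto
qed

end

locale indexed_graph = kasteleyn_graph +
  fixes r c :: "nat \<Rightarrow> 'a \<times> nat" and N :: nat
  assumes r: "bij_betw r {..<N} (white_idx W n)" and c: "bij_betw c {..<N} (black_idx B n)"
begin

lemma white_idx_Sigma: "white_idx W n = (SIGMA w:W. {1..n w})"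
  and black_idx_Sigma: "black_idx B n = (SIGMA b:B. {1..n b})"
  by (auto simp: white_idx_def black_idx_def)

lemma r_mem: "k < N \<Longrightarrow> fst (r k) \<in> W \<and> snd (r k) \<in> {1..n (fst (r k))}"
  using bij_betw_apply[OF r, of k] by (auto simp: white_idx_def)

lemma c_mem: "k < N \<Longrightarrow> fst (c k) \<in> B \<and> snd (c k) \<in> {1..n (fst (c k))}"
  using bij_betw_apply[OF c, of k] by (auto simp: black_idx_def)

definition lex :: "'a \<times> nat \<Rightarrow> 'a \<times> nat \<Rightarrow> bool" where
  "lex x y \<longleftrightarrow> key (fst x) < key (fst y) \<or> fst x = fst y \<and> snd x < snd y"

lemma lex_total:
  assumes "fst x \<in> B \<union> W" "fst y \<in> B \<union> W" "x \<noteq> y"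
  shows "lex y x \<longleftrightarrow> \<not> lex x y"
  using key_eq_iff[OF assms(1,2)] assms(3) unfolding lex_def prod_eq_iff
  by (metis not_less_iff_gr_or_eq)

definition sign_r :: real where
  "sign_r = (\<Prod>k<N. \<Prod>l<N. negif (k < l \<and> lex (r l) (r k)))"

definition sign_c :: real where
  "sign_c = (\<Prod>k<N. \<Prod>l<N. negif (k < l \<and> lex (c l) (c k)))"

definition strand :: "(nat \<Rightarrow> nat) \<Rightarrow> nat \<Rightarrow> 'a \<times> 'a" where
  "strand p k = (fst (c (p k)), fst (r k))"

lemma c_inj: "k < N \<Longrightarrow> l < N \<Longrightarrow> c k = c l \<longleftrightarrow> k = l"
  using c by (auto simp: bij_betw_def dest: inj_onD)

lemma r_inj: "k < N \<Longrightarrow> l < N \<Longrightarrow> r k = r l \<longleftrightarrow> k = l"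
  using r by (auto simp: bij_betw_def dest: inj_onD)

lemma sign_factorization:
  assumes p: "p permutes {..<N}" and E: "\<And>k. k < N \<Longrightarrow> strand p k \<in> E"
  defines "a \<equiv> \<lambda>k. snd (r k)" and "j \<equiv> \<lambda>k. snd (c (p k))"
    and "w \<equiv> \<lambda>k. fst (r k)" and "b \<equiv> \<lambda>k. fst (c (p k))"
  shows "real_of_int (sign p) = sign_r * sign_c *
     ((\<Prod>k<N. \<Prod>l<N. negif (w k = w l \<and> a k < a l \<and> pos (w k) (b l) < pos (w k) (b k))) *
      (\<Prod>k<N. \<Prod>l<N. negif (b k = b l \<and> j k < j l \<and> pos (b k) (w l) < pos (b k) (w k)))) *
     ((\<Prod>k<N. \<Prod>l<N. J (strand p k) (strand p l)) *
      (\<Prod>k<N. \<Prod>l<N. negif (strand p k = strand p l \<and> a k < a l \<and> j l < j k)))"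
proof -
  have sc: "sign_c = (\<Prod>k<N. \<Prod>l<N. negif (p k < p l \<and> lex (c (p l)) (c (p k))))"
    unfolding sign_c_def
    using prod.permute[OF p, of "\<lambda>k. \<Prod>l<N. negif (k < l \<and> lex (c l) (c k))"]
      prod.permute[OF p, of "\<lambda>l. negif (p k < l \<and> lex (c l) (c (p k)))" for k]
    by (simp add: o_def)
  have "real_of_int (sign p) = (\<Prod>k<N. \<Prod>l<N. negif (k < l \<and> p l < p k))"
    using sign_eq_inversions[OF p, of id] by simp
  also have "\<dots> = (\<Prod>k<N. \<Prod>l<N. negif (k < l \<and> lex (r l) (r k)) * negif (p k < p l \<and> lex (c (p l)) (c (p k))) *
     (negif (w k = w l \<and> a k < a l \<and> pos (w k) (b l) < pos (w k) (b k)) *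
      negif (b k = b l \<and> j k < j l \<and> pos (b k) (w l) < pos (b k) (w k))) *
     (J (strand p k) (strand p l) * negif (strand p k = strand p l \<and> a k < a l \<and> j l < j k)))"
  proof (rule prod_pairs_cong)
    fix k l assume "k \<in> {..<N}" "l \<in> {..<N}" and kl: "k \<noteq> l"
    then have k: "k < N" and l: "l < N" by auto
    have pk: "p k < N" and pl: "p l < N" using p k l by (metis lessThan_iff permutes_in_image)+
    have pkl: "p k \<noteq> p l" using p kl by (auto dest: permutes_inj injD)
    have e: "strand p k \<in> E" "strand p l \<in> E" using E k l by auto
    have ek: "strand p k = (b k, w k)" "strand p l = (b l, w l)" by (simp_all add: strand_def b_def w_def)
    define x1 where "x1 \<longleftrightarrow> lex (r k) (r l)"
    define y1 where "y1 \<longleftrightarrow> lex (c (p k)) (c (p l))"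
    define x2 where "x2 \<longleftrightarrow> (if strand p k = strand p l then a k < a l else lessW (strand p k) (strand p l))"
    define y2 where "y2 \<longleftrightarrow> (if strand p k = strand p l then j k < j l else lessB (strand p k) (strand p l))"
    have rkl: "r k \<noteq> r l" and ckl: "c (p k) \<noteq> c (p l)" using r_inj k l kl c_inj pk pl pkl by auto
    have x1': "lex (r l) (r k) \<longleftrightarrow> \<not> x1" unfolding x1_def
      using r_mem[OF k] r_mem[OF l] rkl by (intro lex_total) auto
    have y1': "lex (c (p l)) (c (p k)) \<longleftrightarrow> \<not> y1" unfolding y1_def
      using c_mem[OF pk] c_mem[OF pl] ckl by (intro lex_total) auto
    have a_ne: "a k \<noteq> a l" if "w k = w l" using that rkl by (auto simp: a_def w_def prod_eq_iff)
    have j_ne: "j k \<noteq> j l" if "b k = b l" using that ckl by (auto simp: j_def b_def prod_eq_iff)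
    have p1: "negif (k < l \<and> p l < p k) * negif (l < k \<and> p k < p l) = negif ((k < l) \<noteq> (p k < p l))"
      by (rule negif_xor) (use kl pkl in auto)
    have p2: "negif (k < l \<and> lex (r l) (r k)) * negif (l < k \<and> lex (r k) (r l)) = negif ((k < l) \<noteq> x1)"
      unfolding x1_def by (rule negif_xor) (use kl x1' x1_def in auto)
    have p3: "negif (p k < p l \<and> lex (c (p l)) (c (p k))) * negif (p l < p k \<and> lex (c (p k)) (c (p l))) = negif ((p k < p l) \<noteq> y1)"
      unfolding y1_def by (rule negif_xor) (use pkl y1' y1_def in auto)
    have p4: "negif (w k = w l \<and> a k < a l \<and> pos (w k) (b l) < pos (w k) (b k)) *
        negif (w l = w k \<and> a l < a k \<and> pos (w l) (b k) < pos (w l) (b l)) = negif (x1 \<noteq> x2)"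
    proof (cases "w k = w l")
      case True
      have x1: "x1 \<longleftrightarrow> a k < a l" using True by (simp add: x1_def lex_def w_def a_def)
      show ?thesis
      proof (cases "b k = b l")
        case False
        have nb: "b k \<in> nbrs E (w l)" "b l \<in> nbrs E (w l)" using edge_nbrs(4) e ek True by fastforce+
        have x2: "x2 \<longleftrightarrow> pos (w l) (b k) < pos (w l) (b l)" using False True by (simp add: x2_def ek lessW_def)
        have "pos (w l) (b k) \<noteq> pos (w l) (b l)" using pos_eq_iff[OF nb] False by simp
        then have "pos (w l) (b l) < pos (w l) (b k) \<longleftrightarrow> \<not> x2" unfolding x2 by auto
        moreover have "a l < a k \<longleftrightarrow> \<not> a k < a l" using a_ne[OF True] by auto
        ultimately show ?thesis unfolding x1 x2 using True by (simp add: negif_xor)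
      next
        case b: True
        then show ?thesis unfolding x1 x2_def ek using True by simp
      qed
    next
      case False
      then have "x1 \<longleftrightarrow> key (w k) < key (w l)" by (simp add: x1_def lex_def w_def)
      then show ?thesis using False by (simp add: x2_def lessW_def ek)
    qed
    have p5: "negif (b k = b l \<and> j k < j l \<and> pos (b k) (w l) < pos (b k) (w k)) *
        negif (b l = b k \<and> j l < j k \<and> pos (b l) (w k) < pos (b l) (w l)) = negif (y1 \<noteq> y2)"
    proof (cases "b k = b l")
      case True
      have y1: "y1 \<longleftrightarrow> j k < j l" using True by (simp add: y1_def lex_def b_def j_def)
      show ?thesis
      proof (cases "w k = w l")
        case False
        have nb: "w k \<in> nbrs E (b l)" "w l \<in> nbrs E (b l)" using edge_nbrs(3) e ek True by fastforce+
        have y2: "y2 \<longleftrightarrow> pos (b l) (w k) < pos (b l) (w l)" using False True by (simp add: y2_def ek lessB_def)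
        have "pos (b l) (w k) \<noteq> pos (b l) (w l)" using pos_eq_iff[OF nb] False by simp
        then have "pos (b l) (w l) < pos (b l) (w k) \<longleftrightarrow> \<not> y2" unfolding y2 by auto
        moreover have "j l < j k \<longleftrightarrow> \<not> j k < j l" using j_ne[OF True] by auto
        ultimately show ?thesis unfolding y1 y2 using True by (simp add: negif_xor)
      next
        case w: True
        then show ?thesis unfolding y1 y2_def ek using True by simp
      qed
    next
      case False
      then have "y1 \<longleftrightarrow> key (b k) < key (b l)" by (simp add: y1_def lex_def b_def)
      then show ?thesis using False by (simp add: y2_def lessB_def ek)
    qed
    have p6: "J (strand p k) (strand p l) * J (strand p l) (strand p k) *
        (negif (strand p k = strand p l \<and> a k < a l \<and> j l < j k) *
         negif (strand p l = strand p k \<and> a l < a k \<and> j k < j l)) = negif (x2 \<noteq> y2)"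
    proof (cases "strand p k = strand p l")
      case True
      have "w k = w l" "b k = b l" using True ek by auto
      then have "a l < a k \<longleftrightarrow> \<not> a k < a l" "j l < j k \<longleftrightarrow> \<not> j k < j l" using a_ne j_ne by auto
      then have "negif (a k < a l \<and> j l < j k) * negif (a l < a k \<and> j k < j l) = negif ((a k < a l) \<noteq> (j k < j l))"
        by (rule negif_xor)
      moreover have "J (strand p k) (strand p l) = 1" "J (strand p l) (strand p k) = 1"
        by (simp_all add: True J_def lessB_def)
      ultimately show ?thesis by (simp add: x2_def y2_def True)
    next
      case False
      then have ne: "(strand p l = strand p k) = False" by auto
      have "negif (lessB (strand p k) (strand p l)) * negif (lessW (strand p k) (strand p l)) = negif (x2 \<noteq> y2)"
        unfolding x2_def y2_def using False
        by (cases "lessB (strand p k) (strand p l)"; cases "lessW (strand p k) (strand p l)") simp_all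
      then show ?thesis unfolding J_polar[OF e] using False ne by simp
    qed
    have rearr: "A1 * A2 * (A3 * A4) * (A5 * A6) * (B1 * B2 * (B3 * B4) * (B5 * B6)) =
       (A1 * B1) * (A2 * B2) * ((A3 * B3) * (A4 * B4)) * (A5 * B5 * (A6 * B6))"
      for A1 A2 A3 A4 A5 A6 B1 B2 B3 B4 B5 B6 :: real by (simp only: ac_simps)
    show "negif (k < l \<and> p l < p k) * negif (l < k \<and> p k < p l) =
      negif (k < l \<and> lex (r l) (r k)) * negif (p k < p l \<and> lex (c (p l)) (c (p k))) *
     (negif (w k = w l \<and> a k < a l \<and> pos (w k) (b l) < pos (w k) (b k)) *
      negif (b k = b l \<and> j k < j l \<and> pos (b k) (w l) < pos (b k) (w k))) *
     (J (strand p k) (strand p l) * negif (strand p k = strand p l \<and> a k < a l \<and> j l < j k)) *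
     (negif (l < k \<and> lex (r k) (r l)) * negif (p l < p k \<and> lex (c (p k)) (c (p l))) *
     (negif (w l = w k \<and> a l < a k \<and> pos (w l) (b k) < pos (w l) (b l)) *
      negif (b l = b k \<and> j l < j k \<and> pos (b l) (w k) < pos (b l) (w l))) *
     (J (strand p l) (strand p k) * negif (strand p l = strand p k \<and> a l < a k \<and> j k < j l)))"
      unfolding rearr p1 p2 p3 p4 p5 p6
      by (cases "k < l"; cases "p k < p l"; cases x1; cases y1; cases x2; cases y2) simp_all
  qed (simp_all add: J_def lessB_def)
  also have "\<dots> = sign_r * sign_c *
     ((\<Prod>k<N. \<Prod>l<N. negif (w k = w l \<and> a k < a l \<and> pos (w k) (b l) < pos (w k) (b k))) *
      (\<Prod>k<N. \<Prod>l<N. negif (b k = b l \<and> j k < j l \<and> pos (b k) (w l) < pos (b k) (w k)))) *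
     ((\<Prod>k<N. \<Prod>l<N. J (strand p k) (strand p l)) *
      (\<Prod>k<N. \<Prod>l<N. negif (strand p k = strand p l \<and> a k < a l \<and> j l < j k)))"
    unfolding sc sign_r_def prod.distrib ..
  finally show ?thesis .
qed

end

section \<open>Permutations inducing a given coloring\<close>

lemma power_sq_one: "x * x = 1 \<Longrightarrow> x ^ k = (if odd k then x else 1)" for x :: real
  by (induction k) auto

context plane_graph
begin

lemma bd_odd_multiweb:
  assumes m: "m \<in> multiwebs B W E n"
  shows "bd {e \<in> E. odd (m e)} = {v \<in> B \<union> W. odd (n v)}"
proof -
  have B: "odd (card (incident {e \<in> E. odd (m e)} b)) \<longleftrightarrow> odd (n b)" if b: "b \<in> B" for b
  proof -
    have "incident {e \<in> E. odd (m e)} b = Pair b ` {w \<in> nbrs E b. odd (m (b, w))}"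
      using b E_mem by (auto simp: incident_def nbrs_B)
    then have "card (incident {e \<in> E. odd (m e)} b) = card {w \<in> nbrs E b. odd (m (b, w))}"
      by (simp add: card_image inj_on_def)
    moreover have "n b = (\<Sum>w\<in>nbrs E b. m (b, w))" using m b by (simp add: multiwebs_def)
    ultimately show ?thesis using even_sum_iff[OF finite_nbrs, of "\<lambda>w. m (b, w)" b] by simp
  qed
  have W: "odd (card (incident {e \<in> E. odd (m e)} w)) \<longleftrightarrow> odd (n w)" if w: "w \<in> W" for w
  proof -
    have "incident {e \<in> E. odd (m e)} w = (\<lambda>b. (b, w)) ` {b \<in> nbrs E w. odd (m (b, w))}"
      using w E_mem by (auto simp: incident_def nbrs_W)
    then have "card (incident {e \<in> E. odd (m e)} w) = card {b \<in> nbrs E w. odd (m (b, w))}"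
      by (simp add: card_image inj_on_def)
    moreover have "n w = (\<Sum>b\<in>nbrs E w. m (b, w))" using m w by (simp add: multiwebs_def)
    ultimately show ?thesis using even_sum_iff[OF finite_nbrs, of "\<lambda>b. m (b, w)" w] by simp
  qed
  have out: "incident {e \<in> E. odd (m e)} v = {}" if "v \<notin> B \<union> W" for v
    using that E_mem by (auto simp: incident_def)
  show ?thesis
  proof (rule Set.set_eqI)
    fix v
    show "v \<in> bd {e \<in> E. odd (m e)} \<longleftrightarrow> v \<in> {v \<in> B \<union> W. odd (n v)}"
      using B[of v] W[of v] out[of v] by (cases "v \<in> B"; cases "v \<in> W") (simp_all add: bd_def)
  qed
qed

end

lemma subdet_eq:
  assumes "finite T" "finite S" "card T = k" "card S = k"
  shows "subdet M T S = (\<Sum>q | q permutes {..<k}. of_int (sign q) * (\<Prod>i<k. M (enum_of T i) (enum_of S (q i))))"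
proof -
  let ?A = "mat k k (\<lambda>(i, j). M (enum_of T i) (enum_of S j))"
  have "subdet M T S = det ?A"
    unfolding subdet_def enum_of_def using assms by simp
  also have "\<dots> = (\<Sum>q | q permutes {0..<k}. signof q * (\<Prod>i = 0..<k. ?A $$ (i, q i)))"
    by (rule det_def') simp
  also have "\<dots> = (\<Sum>q | q permutes {..<k}. of_int (sign q) * (\<Prod>i<k. M (enum_of T i) (enum_of S (q i))))"
    unfolding atLeast0LessThan
  proof (rule sum.cong[OF refl])
    fix q assume "q \<in> {q. q permutes {..<k}}"
    then have "q i < k" if "i < k" for i using that by (metis lessThan_iff mem_Collect_eq permutes_in_image)
    then show "signof q * (\<Prod>i<k. ?A $$ (i, q i)) = of_int (sign q) * (\<Prod>i<k. M (enum_of T i) (enum_of S (q i)))"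
      by simp
  qed
  finally show ?thesis .
qed

locale colored_web = indexed_graph +
  fixes m :: "'a \<times> 'a \<Rightarrow> nat" and S T :: "'a \<times> 'a \<Rightarrow> nat set"
  assumes mw: "m \<in> multiwebs B W E n" and col: "(S, T) \<in> colorings B W E n m"
begin

lemma S_props: "e \<in> E \<Longrightarrow> S e \<subseteq> {1..n (fst e)}" "e \<in> E \<Longrightarrow> card (S e) = m e" "e \<in> E \<Longrightarrow> finite (S e)"
  and T_props: "e \<in> E \<Longrightarrow> T e \<subseteq> {1..n (snd e)}" "e \<in> E \<Longrightarrow> card (T e) = m e" "e \<in> E \<Longrightarrow> finite (T e)"
proof -
  have *: "\<forall>e\<in>E. S e \<subseteq> {1..n (fst e)} \<and> T e \<subseteq> {1..n (snd e)} \<and> card (S e) = m e \<and> card (T e) = m e"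
    using col unfolding colorings_def by blast
  show "S e \<subseteq> {1..n (fst e)}" "card (S e) = m e" "T e \<subseteq> {1..n (snd e)}" "card (T e) = m e" if "e \<in> E"
    using bspec[OF * that] by simp_all
  show "finite (S e)" if "e \<in> E"
    using bspec[OF * that] by (intro finite_subset[OF _ finite_atLeastAtMost[of 1 "n (fst e)"]]) simp
  show "finite (T e)" if "e \<in> E"
    using bspec[OF * that] by (intro finite_subset[OF _ finite_atLeastAtMost[of 1 "n (snd e)"]]) simp
qed

lemma ST_outside: "e \<notin> E \<Longrightarrow> S e = {}" "e \<notin> E \<Longrightarrow> T e = {}" "e \<notin> E \<Longrightarrow> m e = 0"
  using col[unfolded colorings_def mem_Collect_eq prod.case, THEN conjunct1]
    mw[unfolded multiwebs_def mem_Collect_eq, THEN conjunct1] by blast+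

lemma S_part: "b \<in> B \<Longrightarrow> (\<Union>w\<in>nbrs E b. S (b, w)) = {1..n b}" "b \<in> B \<Longrightarrow> disjoint_family_on (\<lambda>w. S (b, w)) (nbrs E b)"
  and T_part: "w \<in> W \<Longrightarrow> (\<Union>b\<in>nbrs E w. T (b, w)) = {1..n w}" "w \<in> W \<Longrightarrow> disjoint_family_on (\<lambda>b. T (b, w)) (nbrs E w)"
proof -
  note col' = col[unfolded colorings_def mem_Collect_eq prod.case, THEN conjunct2, THEN conjunct2]
  show "(\<Union>w\<in>nbrs E b. S (b, w)) = {1..n b}" "disjoint_family_on (\<lambda>w. S (b, w)) (nbrs E b)" if "b \<in> B"
    using bspec[OF col'[THEN conjunct1] that] by simp_all
  show "(\<Union>b\<in>nbrs E w. T (b, w)) = {1..n w}" "disjoint_family_on (\<lambda>b. T (b, w)) (nbrs E w)" if "w \<in> W"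
    using bspec[OF col'[THEN conjunct2] that] by simp_all
qed

definition black_of :: "'a \<Rightarrow> nat \<Rightarrow> 'a" where
  "black_of w a = (THE b. b \<in> nbrs E w \<and> a \<in> T (b, w))"

definition white_of :: "'a \<Rightarrow> nat \<Rightarrow> 'a" where
  "white_of b j = (THE w. w \<in> nbrs E b \<and> j \<in> S (b, w))"

lemma black_of_eq:
  assumes "w \<in> W" "b \<in> nbrs E w" "a \<in> T (b, w)"
  shows "black_of w a = b"
  unfolding black_of_def
proof (rule the_equality)
  fix b' assume "b' \<in> nbrs E w \<and> a \<in> T (b', w)"
  then show "b' = b" using disjoint_family_onD[OF T_part(2)[OF assms(1)], of b' b] assms(2,3) by blast
qed (use assms in blast)

lemma white_of_eq:
  assumes "b \<in> B" "w \<in> nbrs E b" "j \<in> S (b, w)"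
  shows "white_of b j = w"
  unfolding white_of_def
proof (rule the_equality)
  fix w' assume "w' \<in> nbrs E b \<and> j \<in> S (b, w')"
  then show "w' = w" using disjoint_family_onD[OF S_part(2)[OF assms(1)], of w' w] assms(2,3) by blast
qed (use assms in blast)

lemma black_of_mem:
  assumes "w \<in> W" "a \<in> {1..n w}"
  shows "black_of w a \<in> nbrs E w" "a \<in> T (black_of w a, w)"
proof -
  obtain b where "b \<in> nbrs E w" "a \<in> T (b, w)" using T_part(1)[OF assms(1)] assms(2) by blast
  then show "black_of w a \<in> nbrs E w" "a \<in> T (black_of w a, w)" using black_of_eq[OF assms(1)] by auto
qed

definition row_edge :: "nat \<Rightarrow> 'a \<times> 'a" where
  "row_edge k = (black_of (fst (r k)) (snd (r k)), fst (r k))"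

lemma row_edge_E: "k < N \<Longrightarrow> row_edge k \<in> E" and row_edge_T: "k < N \<Longrightarrow> snd (r k) \<in> T (row_edge k)"
proof -
  assume k: "k < N"
  have w: "fst (r k) \<in> W" "snd (r k) \<in> {1..n (fst (r k))}" using r_mem[OF k] by auto
  show "row_edge k \<in> E" using black_of_mem(1)[OF w] nbrs_W[OF w(1)] by (simp add: row_edge_def)
  show "snd (r k) \<in> T (row_edge k)" using black_of_mem(2)[OF w] by (simp add: row_edge_def)
qed

definition row_at :: "'a \<times> 'a \<Rightarrow> nat \<Rightarrow> nat" where
  "row_at e i = inv_into {..<N} r (snd e, enum_of (T e) i)"

lemma row_at:
  assumes e: "e \<in> E" and i: "i < m e"
  shows "row_at e i < N" "r (row_at e i) = (snd e, enum_of (T e) i)" "row_edge (row_at e i) = e"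
proof -
  have mem: "enum_of (T e) i \<in> T e" using i T_props[OF e] by (intro enum_of_mem) auto
  have "(snd e, enum_of (T e) i) \<in> white_idx W n"
    using mem T_props(1)[OF e] edge_nbrs(2)[OF e] by (auto simp: white_idx_def)
  then show "row_at e i < N" "r (row_at e i) = (snd e, enum_of (T e) i)"
    using r bij_betw_apply[OF bij_betw_inv_into[OF r], of "(snd e, enum_of (T e) i)"]
    by (auto simp: row_at_def bij_betw_inv_into_right)
  moreover have "black_of (snd e) (enum_of (T e) i) = fst e"
    using edge_nbrs[OF e] mem by (intro black_of_eq) auto
  ultimately show "row_edge (row_at e i) = e" by (simp add: row_edge_def)
qed

lemma row_at_index:
  assumes "k < N"
  shows "index_in (T (row_edge k)) (snd (r k)) < m (row_edge k)" "row_at (row_edge k) (index_in (T (row_edge k)) (snd (r k))) = k"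
proof -
  note e = row_edge_E[OF assms]
  show i: "index_in (T (row_edge k)) (snd (r k)) < m (row_edge k)"
    using index_in(1)[OF T_props(3)[OF e] row_edge_T[OF assms]] T_props(2)[OF e] by simp
  have "r (row_at (row_edge k) (index_in (T (row_edge k)) (snd (r k)))) = (snd (row_edge k), snd (r k))"
    using row_at(2)[OF e i] index_in(2)[OF T_props(3)[OF e] row_edge_T[OF assms]] by simp
  also have "\<dots> = r k" by (simp add: row_edge_def)
  finally show "row_at (row_edge k) (index_in (T (row_edge k)) (snd (r k))) = k"
    using r_inj[OF row_at(1)[OF e i] assms] by blast
qed

lemma row_at_inj:
  assumes "e \<in> E" "i < m e" "i' < m e" "row_at e i = row_at e i'"
  shows "i = i'"
proof -
  have "enum_of (T e) i = enum_of (T e) i'"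
    using row_at(2)[OF assms(1,2)] row_at(2)[OF assms(1,3)] assms(4) by simp
  then show ?thesis using enum_of_bij[OF T_props(3)[OF assms(1)]] assms(2,3) T_props(2)[OF assms(1)]
    by (auto simp: bij_betw_def dest: inj_onD)
qed

lemma row_at_bij:
  assumes e: "e \<in> E"
  shows "bij_betw (row_at e) {..<m e} {k \<in> {..<N}. row_edge k = e}"
proof (rule bij_betw_imageI)
  show "inj_on (row_at e) {..<m e}" using row_at_inj[OF e] by (auto simp: inj_on_def)
  show "row_at e ` {..<m e} = {k \<in> {..<N}. row_edge k = e}"
  proof (intro equalityI subsetI)
    fix k assume "k \<in> row_at e ` {..<m e}"
    then show "k \<in> {k \<in> {..<N}. row_edge k = e}" using row_at[OF e] by auto
  next
    fix k assume "k \<in> {k \<in> {..<N}. row_edge k = e}"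
    then have k: "k < N" "row_edge k = e" by auto
    show "k \<in> row_at e ` {..<m e}"
      using row_at_index[OF k(1)] unfolding k(2) by (intro image_eqI[of _ _ "index_in (T e) (snd (r k))"]) simp_all
  qed
qed

lemma prod_by_edge: "(\<Prod>k<N. g k) = (\<Prod>e\<in>E. \<Prod>i<m e. g (row_at e i))" for g :: "nat \<Rightarrow> real"
proof -
  have "(\<Prod>k<N. g k) = (\<Prod>e\<in>E. \<Prod>k\<in>{k \<in> {..<N}. row_edge k = e}. g k)"
    using row_edge_E by (intro prod.group[symmetric] finite_E) auto
  also have "\<dots> = (\<Prod>e\<in>E. \<Prod>i<m e. g (row_at e i))"
    by (intro prod.cong refl prod.reindex_bij_betw[symmetric] row_at_bij)
  finally show ?thesis .
qed

lemma prod_pairs_by_edge: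
  "(\<Prod>k<N. \<Prod>l<N. negif (row_edge k = row_edge l \<and> h k l)) =
   (\<Prod>e\<in>E. \<Prod>i<m e. \<Prod>i'<m e. negif (h (row_at e i) (row_at e i')))"
proof -
  have "(\<Prod>k<N. \<Prod>l<N. negif (row_edge k = row_edge l \<and> h k l)) =
      (\<Prod>e\<in>E. \<Prod>i<m e. \<Prod>e'\<in>E. \<Prod>i'<m e'. negif (row_edge (row_at e i) = row_edge (row_at e' i') \<and> h (row_at e i) (row_at e' i')))"
    by (simp only: prod_by_edge)
  also have "\<dots> = (\<Prod>e\<in>E. \<Prod>i<m e. \<Prod>e'\<in>E. if e' = e then \<Prod>i'<m e. negif (h (row_at e i) (row_at e i')) else 1)"
    by (intro prod.cong refl) (auto simp: row_at(3))
  also have "\<dots> = (\<Prod>e\<in>E. \<Prod>i<m e. \<Prod>i'<m e. negif (h (row_at e i) (row_at e i')))"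
    using finite_E by (intro prod.cong refl) simp
  finally show ?thesis .
qed

lemma prod_edge_sq_one:
  fixes g :: "'a \<times> 'a \<Rightarrow> real"
  assumes "\<And>e. e \<in> E \<Longrightarrow> g e * g e = 1"
  shows "(\<Prod>k<N. g (row_edge k)) = (\<Prod>e\<in>{e \<in> E. odd (m e)}. g e)"
proof -
  have "(\<Prod>k<N. g (row_edge k)) = (\<Prod>e\<in>E. \<Prod>i<m e. g (row_edge (row_at e i)))" by (rule prod_by_edge)
  also have "\<dots> = (\<Prod>e\<in>E. if odd (m e) then g e else 1)"
    by (intro prod.cong refl) (simp add: row_at(3) power_sq_one assms)
  also have "\<dots> = (\<Prod>e\<in>{e \<in> E. odd (m e)}. g e)"
    by (rule prod.inter_filter[symmetric, OF finite_E])
  finally show ?thesis .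
qed

lemma Phi_strands:
  "(\<Prod>k<N. eps (row_edge k)) * (\<Prod>k<N. \<Prod>l<N. J (row_edge k) (row_edge l)) = Phi {e \<in> E. odd (m e)}"
proof -
  let ?z = "{e \<in> E. odd (m e)}"
  have sq: "J e e' * J e e' = 1" for e e' by (simp add: J_def)
  have "(\<Prod>k<N. \<Prod>l<N. J (row_edge k) (row_edge l)) = (\<Prod>k<N. \<Prod>e'\<in>?z. J (row_edge k) e')"
    by (intro prod.cong refl prod_edge_sq_one sq)
  also have "\<dots> = (\<Prod>e\<in>?z. \<Prod>e'\<in>?z. J e e')"
    by (rule prod_edge_sq_one) (simp add: prod.distrib[symmetric] sq)
  finally show ?thesis using prod_edge_sq_one[of eps] eps_sq by (simp add: Phi_def)
qed

definition compatible :: "(nat \<Rightarrow> nat) \<Rightarrow> bool" where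
  "compatible p \<longleftrightarrow> p permutes {..<N} \<and> (\<forall>k<N. fst (c (p k)) = fst (row_edge k) \<and> snd (c (p k)) \<in> S (row_edge k))"

lemma strand_compatible: "compatible p \<Longrightarrow> k < N \<Longrightarrow> strand p k = row_edge k"
  by (simp add: compatible_def strand_def row_edge_def)

definition assemble :: "('a \<times> 'a \<Rightarrow> nat \<Rightarrow> nat) \<Rightarrow> nat \<Rightarrow> nat" where
  "assemble q k = (if k < N then
     inv_into {..<N} c (fst (row_edge k), enum_of (S (row_edge k)) (q (row_edge k) (index_in (T (row_edge k)) (snd (r k))))) else k)"

abbreviation perm_families :: "('a \<times> 'a \<Rightarrow> nat \<Rightarrow> nat) set" where
  "perm_families \<equiv> (\<Pi>\<^sub>E e\<in>E. {q. q permutes {..<m e}})"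

lemma assemble:
  assumes q: "q \<in> perm_families" and k: "k < N"
  defines "i \<equiv> index_in (T (row_edge k)) (snd (r k))"
  shows "q (row_edge k) i < m (row_edge k)" "assemble q k < N" "c (assemble q k) = (fst (row_edge k), enum_of (S (row_edge k)) (q (row_edge k) i))"
proof -
  note e = row_edge_E[OF k]
  have "q (row_edge k) permutes {..<m (row_edge k)}" using q e by blast
  then show qi: "q (row_edge k) i < m (row_edge k)"
    using row_at_index(1)[OF k] permutes_in_image[of "q (row_edge k)" "{..<m (row_edge k)}" i] by (simp add: i_def)
  have mem: "enum_of (S (row_edge k)) (q (row_edge k) i) \<in> S (row_edge k)" using qi S_props[OF e] by (intro enum_of_mem) auto
  have "(fst (row_edge k), enum_of (S (row_edge k)) (q (row_edge k) i)) \<in> black_idx B n"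
    using mem S_props(1)[OF e] edge_nbrs(1)[OF e] by (auto simp: black_idx_def)
  then show "assemble q k < N" "c (assemble q k) = (fst (row_edge k), enum_of (S (row_edge k)) (q (row_edge k) i))"
    using c bij_betw_apply[OF bij_betw_inv_into[OF c], of "(fst (row_edge k), enum_of (S (row_edge k)) (q (row_edge k) i))"] k
    by (auto simp: assemble_def i_def bij_betw_inv_into_right)
qed

lemma assemble_row_at:
  assumes q: "q \<in> perm_families" and e: "e \<in> E" and i: "i < m e"
  shows "c (assemble q (row_at e i)) = (fst e, enum_of (S e) (q e i))"
proof -
  have "index_in (T e) (snd (r (row_at e i))) = i"
    using row_at(2)[OF e i] T_props[OF e] i by (simp add: index_in_enum)
  then show ?thesis using assemble(3)[OF q row_at(1)[OF e i]] row_at(3)[OF e i] by simp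
qed

lemma assemble_compatible:
  assumes q: "q \<in> perm_families"
  shows "compatible (assemble q)"
proof -
  have S: "snd (c (assemble q k)) \<in> S (row_edge k)" if "k < N" for k
    using assemble[OF q that] S_props[OF row_edge_E[OF that]] by (simp add: enum_of_mem)
  have inj: "inj_on (assemble q) {..<N}"
  proof (rule inj_onI)
    fix k l assume "k \<in> {..<N}" "l \<in> {..<N}" and eq: "assemble q k = assemble q l"
    then have k: "k < N" and l: "l < N" by auto
    have b: "fst (row_edge k) = fst (row_edge l)" using assemble(3)[OF q k] assemble(3)[OF q l] eq by simp
    have "white_of (fst (row_edge k)) (snd (c (assemble q k))) = snd (row_edge k)"
      using edge_nbrs[OF row_edge_E[OF k]] S[OF k] by (intro white_of_eq) auto
    moreover have "white_of (fst (row_edge l)) (snd (c (assemble q l))) = snd (row_edge l)"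
      using edge_nbrs[OF row_edge_E[OF l]] S[OF l] by (intro white_of_eq) auto
    ultimately have e: "row_edge k = row_edge l" using b eq by (metis prod_eqI)
    define i i' where "i = index_in (T (row_edge k)) (snd (r k))" and "i' = index_in (T (row_edge l)) (snd (r l))"
    have lt: "q (row_edge l) i < card (S (row_edge l))" "q (row_edge l) i' < card (S (row_edge l))"
      using assemble(1)[OF q k] assemble(1)[OF q l] e S_props(2)[OF row_edge_E[OF l]] by (auto simp: i_def i'_def)
    have "enum_of (S (row_edge l)) (q (row_edge l) i) = enum_of (S (row_edge l)) (q (row_edge l) i')"
      using assemble(3)[OF q k] assemble(3)[OF q l] eq e by (simp add: i_def i'_def)
    then have "q (row_edge l) i = q (row_edge l) i'"
      using enum_of_bij[OF S_props(3)[OF row_edge_E[OF l]]] lt by (auto simp: bij_betw_def dest: inj_onD)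
    moreover have qp: "q (row_edge l) permutes {..<m (row_edge l)}" using q row_edge_E[OF l] by blast
    ultimately have "i = i'" using injD[OF permutes_inj[OF qp], of i i'] by blast
    have "row_at (row_edge k) i = k" "row_at (row_edge l) i' = l"
      unfolding i_def i'_def by (rule row_at_index(2)[OF k], rule row_at_index(2)[OF l])
    then show "k = l" unfolding e \<open>i = i'\<close> by (rule trans[OF sym])
  qed
  have "assemble q ` {..<N} \<subseteq> {..<N}" using assemble(2)[OF q] by auto
  then have "bij_betw (assemble q) {..<N} {..<N}"
    using endo_inj_surj[OF _ _ inj] inj by (simp add: bij_betw_def)
  then have "assemble q permutes {..<N}" by (rule bij_imp_permutes) (simp add: assemble_def)
  then show ?thesis using S assemble(3)[OF q] by (simp add: compatible_def)
qed

lemma assemble_bij: "bij_betw assemble perm_families {p. compatible p}"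
proof (rule bij_betw_imageI)
  show "inj_on assemble perm_families"
  proof (rule inj_onI)
    fix q q' assume q: "q \<in> perm_families" and q': "q' \<in> perm_families" and eq: "assemble q = assemble q'"
    show "q = q'"
    proof (rule PiE_ext[OF q q'])
      fix e assume e: "e \<in> E"
      have p: "q e permutes {..<m e}" "q' e permutes {..<m e}" using q q' e by blast+
      show "q e = q' e"
      proof
        fix i show "q e i = q' e i"
        proof (cases "i < m e")
          case True
          have lt: "q e i < card (S e)" "q' e i < card (S e)"
            using True permutes_in_image[OF p(1), of i] permutes_in_image[OF p(2), of i] S_props(2)[OF e] by auto
          have "enum_of (S e) (q e i) = enum_of (S e) (q' e i)"
            using assemble_row_at[OF q e True] assemble_row_at[OF q' e True] eq by simp
          then show ?thesis using enum_of_bij[OF S_props(3)[OF e]] lt by (auto simp: bij_betw_def dest: inj_onD)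
        next
          case False
          then show ?thesis using permutes_not_in[OF p(1)] permutes_not_in[OF p(2)] by simp
        qed
      qed
    qed
  qed
  show "assemble ` perm_families = {p. compatible p}"
  proof (intro equalityI subsetI)
    fix p assume "p \<in> {p. compatible p}"
    then have p: "p permutes {..<N}" and pk: "\<And>k. k < N \<Longrightarrow> fst (c (p k)) = fst (row_edge k)"
      "\<And>k. k < N \<Longrightarrow> snd (c (p k)) \<in> S (row_edge k)" by (auto simp: compatible_def)
    have pN: "p k < N" if "k < N" for k using permutes_in_image[OF p, of k] that by simp
    define q where "q = (\<lambda>e\<in>E. \<lambda>i. if i < m e then index_in (S e) (snd (c (p (row_at e i)))) else i)"
    have perm: "q e permutes {..<m e}" if e: "e \<in> E" for e
    proof -
      have qe: "q e i = index_in (S e) (snd (c (p (row_at e i))))" if "i < m e" for i using e that by (simp add: q_def)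
      have mem: "snd (c (p (row_at e i))) \<in> S e" if "i < m e" for i
        using pk(2)[OF row_at(1)[OF e that]] row_at(3)[OF e that] by simp
      have "q e ` {..<m e} \<subseteq> {..<m e}"
        using index_in(1)[OF S_props(3)[OF e] mem] S_props(2)[OF e] qe by auto
      moreover have inj: "inj_on (q e) {..<m e}"
      proof (rule inj_onI)
        fix i i' assume "i \<in> {..<m e}" "i' \<in> {..<m e}" and eq: "q e i = q e i'"
        then have i: "i < m e" and i': "i' < m e" by auto
        have "snd (c (p (row_at e i))) = snd (c (p (row_at e i')))"
          using index_in(2)[OF S_props(3)[OF e] mem[OF i]] index_in(2)[OF S_props(3)[OF e] mem[OF i']] eq qe i i' by metis
        moreover have "fst (c (p (row_at e i))) = fst (c (p (row_at e i')))"
          using pk(1)[OF row_at(1)[OF e i]] pk(1)[OF row_at(1)[OF e i']] row_at(3)[OF e i] row_at(3)[OF e i'] by simp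
        ultimately have "p (row_at e i) = p (row_at e i')"
          using c_inj[OF pN[OF row_at(1)[OF e i]] pN[OF row_at(1)[OF e i']]] by (simp add: prod_eq_iff)
        then have "row_at e i = row_at e i'" using injD[OF permutes_inj[OF p], of "row_at e i" "row_at e i'"] by blast
        then show "i = i'" by (rule row_at_inj[OF e i i'])
      qed
      ultimately have "bij_betw (q e) {..<m e} {..<m e}"
        using endo_inj_surj[of "{..<m e}" "q e"] by (simp add: bij_betw_def)
      then show ?thesis by (rule bij_imp_permutes) (use e in \<open>simp add: q_def\<close>)
    qed
    have q: "q \<in> perm_families" using perm by (auto simp: q_def)
    have "assemble q = p"
    proof
      fix k show "assemble q k = p k"
      proof (cases "k < N")
        case True
        note e = row_edge_E[OF True]
        define i where "i = index_in (T (row_edge k)) (snd (r k))"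
        have i: "i < m (row_edge k)" "row_at (row_edge k) i = k" using row_at_index[OF True] by (simp_all add: i_def)
        have "q (row_edge k) i = index_in (S (row_edge k)) (snd (c (p k)))" using e i by (simp add: q_def)
        then have "c (assemble q k) = c (p k)"
          using assemble(3)[OF q True] pk(1)[OF True] index_in(2)[OF S_props(3)[OF e] pk(2)[OF True]]
          by (simp add: i_def[symmetric] prod_eq_iff)
        then show ?thesis using c_inj[OF assemble(2)[OF q True] pN[OF True]] by blast
      next
        case False
        then show ?thesis using permutes_not_in[OF p, of k] by (simp add: assemble_def)
      qed
    qed
    then show "p \<in> assemble ` perm_families" using q by blast
  qed (use assemble_compatible in auto)
qed

lemma vertex_sign_W:
  assumes w: "w \<in> W"
  shows "real_of_int (vertex_sign B E rot cil n S T w) =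
    (\<Prod>a\<in>{1..n w}. \<Prod>a'\<in>{1..n w}. negif (a < a' \<and> pos w (black_of w a') < pos w (black_of w a)))"
proof -
  have v: "w \<in> B \<union> W" "w \<notin> B" using w disj by auto
  show ?thesis unfolding vertex_sign_def if_not_P[OF v(2)]
    by (rule sign_list_perm_concat[OF edge_order_props(2)[OF v(1)]])
      (simp_all add: edge_order_props(1)[OF v(1)] black_of_eq[OF w] T_part(1)[OF w])
qed

lemma vertex_sign_B:
  assumes b: "b \<in> B"
  shows "real_of_int (vertex_sign B E rot cil n S T b) =
    (\<Prod>j\<in>{1..n b}. \<Prod>j'\<in>{1..n b}. negif (j < j' \<and> pos b (white_of b j') < pos b (white_of b j)))"
proof -
  have v: "b \<in> B \<union> W" using b by auto
  show ?thesis unfolding vertex_sign_def if_P[OF b]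
    by (rule sign_list_perm_concat[OF edge_order_props(2)[OF v]])
      (simp_all add: edge_order_props(1)[OF v] white_of_eq[OF b] S_part(1)[OF b])
qed

lemma sign_compatible:
  assumes "compatible p"
  shows "real_of_int (sign p) = sign_r * sign_c *
     real_of_int (\<Prod>v\<in>B \<union> W. vertex_sign B E rot cil n S T v) *
     ((\<Prod>k<N. \<Prod>l<N. J (row_edge k) (row_edge l)) *
      (\<Prod>k<N. \<Prod>l<N. negif (row_edge k = row_edge l \<and> snd (r k) < snd (r l) \<and> snd (c (p l)) < snd (c (p k)))))"
proof -
  have p: "p permutes {..<N}" using assms by (simp add: compatible_def)
  have st: "strand p k = row_edge k" if "k < N" for k using strand_compatible[OF assms that] .
  have bk: "fst (c (p k)) = black_of (fst (r k)) (snd (r k))" if "k < N" for k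
    using st[OF that] by (simp add: strand_def row_edge_def)
  have wk: "fst (r k) = white_of (fst (c (p k))) (snd (c (p k)))" if "k < N" for k
  proof -
    have "white_of (fst (row_edge k)) (snd (c (p k))) = snd (row_edge k)"
      using edge_nbrs[OF row_edge_E[OF that]] assms that by (intro white_of_eq) (auto simp: compatible_def)
    then show ?thesis using assms that by (simp add: compatible_def row_edge_def)
  qed
  have W: "(\<Prod>k<N. \<Prod>l<N. negif (fst (r k) = fst (r l) \<and> snd (r k) < snd (r l) \<and>
        pos (fst (r k)) (fst (c (p l))) < pos (fst (r k)) (fst (c (p k))))) =
      (\<Prod>w\<in>W. real_of_int (vertex_sign B E rot cil n S T w))"
  proof -
    have "(\<Prod>k<N. \<Prod>l<N. negif (fst (r k) = fst (r l) \<and> snd (r k) < snd (r l) \<and>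
        pos (fst (r k)) (fst (c (p l))) < pos (fst (r k)) (fst (c (p k))))) =
      (\<Prod>k<N. \<Prod>l<N. negif (fst (r k) = fst (r l) \<and> (\<lambda>x y. snd x < snd y \<and>
        pos (fst x) (black_of (fst y) (snd y)) < pos (fst x) (black_of (fst x) (snd x))) (r k) (r l)))"
      by (intro prod.cong refl) (simp add: bk)
    also have "\<dots> = (\<Prod>w\<in>W. real_of_int (vertex_sign B E rot cil n S T w))"
      by (subst prod_fibers[OF finite_W r[unfolded white_idx_Sigma]]) (simp add: vertex_sign_W)
    finally show ?thesis .
  qed
  have B: "(\<Prod>k<N. \<Prod>l<N. negif (fst (c (p k)) = fst (c (p l)) \<and> snd (c (p k)) < snd (c (p l)) \<and>
        pos (fst (c (p k))) (fst (r l)) < pos (fst (c (p k))) (fst (r k)))) =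
      (\<Prod>b\<in>B. real_of_int (vertex_sign B E rot cil n S T b))"
  proof -
    have cp: "bij_betw (\<lambda>k. c (p k)) {..<N} (SIGMA b:B. {1..n b})"
      using bij_betw_trans[OF permutes_imp_bij[OF p] c] by (simp add: black_idx_Sigma o_def)
    have "(\<Prod>k<N. \<Prod>l<N. negif (fst (c (p k)) = fst (c (p l)) \<and> snd (c (p k)) < snd (c (p l)) \<and>
        pos (fst (c (p k))) (fst (r l)) < pos (fst (c (p k))) (fst (r k)))) =
      (\<Prod>k<N. \<Prod>l<N. negif (fst (c (p k)) = fst (c (p l)) \<and> (\<lambda>x y. snd x < snd y \<and>
        pos (fst x) (white_of (fst y) (snd y)) < pos (fst x) (white_of (fst x) (snd x))) (c (p k)) (c (p l))))"
      by (intro prod.cong refl) (simp add: wk[symmetric])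
    also have "\<dots> = (\<Prod>b\<in>B. real_of_int (vertex_sign B E rot cil n S T b))"
      by (subst prod_fibers[OF finite_B cp]) (simp add: vertex_sign_B)
    finally show ?thesis .
  qed
  have BW: "real_of_int (\<Prod>v\<in>B \<union> W. vertex_sign B E rot cil n S T v) =
      (\<Prod>w\<in>W. real_of_int (vertex_sign B E rot cil n S T w)) * (\<Prod>b\<in>B. real_of_int (vertex_sign B E rot cil n S T b))"
    using finite_B finite_W disj by (simp add: prod.union_disjoint)
  have JJ: "(\<Prod>k<N. \<Prod>l<N. J (strand p k) (strand p l)) = (\<Prod>k<N. \<Prod>l<N. J (row_edge k) (row_edge l))"
    by (intro prod.cong refl) (simp add: st)
  have LL: "(\<Prod>k<N. \<Prod>l<N. negif (strand p k = strand p l \<and> snd (r k) < snd (r l) \<and> snd (c (p l)) < snd (c (p k)))) =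
     (\<Prod>k<N. \<Prod>l<N. negif (row_edge k = row_edge l \<and> snd (r k) < snd (r l) \<and> snd (c (p l)) < snd (c (p k))))"
    by (intro prod.cong refl) (simp add: st)
  have stE: "strand p k \<in> E" if "k < N" for k using st[OF that] row_edge_E[OF that] by simp
  show ?thesis using sign_factorization[OF p stE] unfolding W B BW JJ LL by simp
qed

lemma fiber_sum:
  "(\<Sum>p | compatible p. real_of_int (sign p) *
      (\<Prod>k<N. eps (strand p k) * phi (strand p k) (snd (r k)) (snd (c (p k)))))
   = sign_r * sign_c * Phi {e \<in> E. odd (m e)} *
     (real_of_int (\<Prod>v\<in>B \<union> W. vertex_sign B E rot cil n S T v) *
      (\<Prod>e\<in>{e \<in> E. m e > 0}. subdet (phi e) (T e) (S e)))"
proof -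
  define V where "V = real_of_int (\<Prod>v\<in>B \<union> W. vertex_sign B E rot cil n S T v)"
  define Ph where "Ph = Phi {e \<in> E. odd (m e)}"
  define u where "u p = real_of_int (sign p) *
      (\<Prod>k<N. eps (strand p k) * phi (strand p k) (snd (r k)) (snd (c (p k))))" for p
  have trm: "u (assemble q) = sign_r * sign_c * Ph * V *
      (\<Prod>e\<in>E. real_of_int (sign (q e)) * (\<Prod>i<m e. phi e (enum_of (T e) i) (enum_of (S e) (q e i))))"
    if q: "q \<in> perm_families" for q
  proof -
    let ?p = "assemble q"
    have comp: "compatible ?p" using assemble_compatible[OF q] .
    have st: "strand ?p k = row_edge k" if "k < N" for k using strand_compatible[OF comp that] .
    have L: "(\<Prod>k<N. \<Prod>l<N. negif (row_edge k = row_edge l \<and> snd (r k) < snd (r l) \<and> snd (c (?p l)) < snd (c (?p k)))) =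
        (\<Prod>e\<in>E. real_of_int (sign (q e)))"
      unfolding prod_pairs_by_edge
    proof (rule prod.cong[OF refl])
      fix e assume e: "e \<in> E"
      have qp: "q e permutes {..<m e}" using q e by blast
      have "real_of_int (sign (q e)) = (\<Prod>i<m e. \<Prod>i'<m e. negif (i < i' \<and> q e i' < q e i))"
        using sign_eq_inversions[OF qp, of id] by simp
      also have "\<dots> = (\<Prod>i<m e. \<Prod>i'<m e. negif (snd (r (row_at e i)) < snd (r (row_at e i')) \<and>
          snd (c (?p (row_at e i'))) < snd (c (?p (row_at e i)))))"
      proof (intro prod.cong refl)
        fix i i' assume "i \<in> {..<m e}" "i' \<in> {..<m e}"
        then have i: "i < m e" "i' < m e" by auto
        have qi: "q e i < m e" "q e i' < m e"
          using permutes_in_image[OF qp, of i] permutes_in_image[OF qp, of i'] i by auto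
        show "negif (i < i' \<and> q e i' < q e i) = negif (snd (r (row_at e i)) < snd (r (row_at e i')) \<and>
          snd (c (?p (row_at e i'))) < snd (c (?p (row_at e i))))"
          using i qi T_props(2)[OF e] S_props(2)[OF e]
          by (simp add: row_at(2)[OF e] assemble_row_at[OF q e] enum_of_less_iff)
      qed
      finally show "(\<Prod>i<m e. \<Prod>i'<m e. negif (snd (r (row_at e i)) < snd (r (row_at e i')) \<and>
          snd (c (?p (row_at e i'))) < snd (c (?p (row_at e i))))) = real_of_int (sign (q e))" by simp
    qed
    have ph: "(\<Prod>k<N. phi (strand ?p k) (snd (r k)) (snd (c (?p k)))) =
        (\<Prod>e\<in>E. \<Prod>i<m e. phi e (enum_of (T e) i) (enum_of (S e) (q e i)))"
      unfolding prod_by_edge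
      by (intro prod.cong refl) (simp add: st[OF row_at(1)] row_at assemble_row_at[OF q])
    have ep: "(\<Prod>k<N. eps (strand ?p k)) = (\<Prod>k<N. eps (row_edge k))"
      by (intro prod.cong refl) (simp add: st)
    have "u ?p = sign_r * sign_c * V * ((\<Prod>k<N. \<Prod>l<N. J (row_edge k) (row_edge l)) * (\<Prod>e\<in>E. real_of_int (sign (q e)))) *
       ((\<Prod>k<N. eps (row_edge k)) * (\<Prod>e\<in>E. \<Prod>i<m e. phi e (enum_of (T e) i) (enum_of (S e) (q e i))))"
      unfolding u_def prod.distrib sign_compatible[OF comp] L ph ep V_def ..
    also have "\<dots> = sign_r * sign_c * ((\<Prod>k<N. eps (row_edge k)) * (\<Prod>k<N. \<Prod>l<N. J (row_edge k) (row_edge l))) * V *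
       ((\<Prod>e\<in>E. real_of_int (sign (q e))) * (\<Prod>e\<in>E. \<Prod>i<m e. phi e (enum_of (T e) i) (enum_of (S e) (q e i))))"
      by (simp only: ac_simps)
    finally show ?thesis unfolding Phi_strands Ph_def prod.distrib .
  qed
  have "(\<Sum>p | compatible p. u p) = (\<Sum>q\<in>perm_families. u (assemble q))"
    using sum.reindex_bij_betw[OF assemble_bij, of u] by simp
  also have "\<dots> = (\<Sum>q\<in>perm_families. sign_r * sign_c * Ph * V *
      (\<Prod>e\<in>E. real_of_int (sign (q e)) * (\<Prod>i<m e. phi e (enum_of (T e) i) (enum_of (S e) (q e i)))))"
    by (rule sum.cong[OF refl trm])
  also have "\<dots> = sign_r * sign_c * Ph * V * (\<Prod>e\<in>E. \<Sum>q | q permutes {..<m e}.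
      real_of_int (sign q) * (\<Prod>i<m e. phi e (enum_of (T e) i) (enum_of (S e) (q i))))"
    unfolding sum_distrib_left[symmetric]
    by (subst prod_sum_PiE) (use finite_E finite_permutations in auto)
  also have "(\<Prod>e\<in>E. \<Sum>q | q permutes {..<m e}.
      real_of_int (sign q) * (\<Prod>i<m e. phi e (enum_of (T e) i) (enum_of (S e) (q i)))) =
      (\<Prod>e\<in>E. subdet (phi e) (T e) (S e))"
    using S_props T_props by (intro prod.cong refl subdet_eq[symmetric]) auto
  also have "\<dots> = (\<Prod>e\<in>{e \<in> E. m e > 0}. subdet (phi e) (T e) (S e))"
  proof (rule prod.mono_neutral_right[OF finite_E])
    have "subdet (phi e) (T e) (S e) = 1" if "e \<in> E" "m e = 0" for e
      using that S_props[OF that(1)] T_props[OF that(1)] by (simp add: subdet_def)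
    then show "\<forall>e\<in>E - {e \<in> E. m e > 0}. subdet (phi e) (T e) (S e) = 1" by auto
  qed auto
  finally show ?thesis by (simp add: u_def V_def Ph_def ac_simps)
qed

end

section \<open>Summation over multiwebs and colorings\<close>

lemma prod_pm_one: "(\<And>x. x \<in> A \<Longrightarrow> g x \<in> {1, -1}) \<Longrightarrow> prod g A \<in> {1, -1::real}"
proof (induction A rule: infinite_finite_induct)
  case (insert x A)
  then have "prod g A \<in> {1, -1}" "g x \<in> {1, -1}" by blast+
  with insert(1,2) show ?case by auto
qed simp_all

context plane_graph
begin

lemma coloring_multiweb:
  assumes col: "(S, T) \<in> colorings B W E n m" and m0: "\<And>e. e \<notin> E \<Longrightarrow> m e = 0"
  shows "m \<in> multiwebs B W E n"
proof -
  note col' = col[unfolded colorings_def mem_Collect_eq prod.case, THEN conjunct2]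
  have card: "card (S e) = m e" "card (T e) = m e" "finite (S e)" "finite (T e)" if "e \<in> E" for e
  proof -
    note * = bspec[OF col'[THEN conjunct1] that]
    show "card (S e) = m e" "card (T e) = m e" using * by simp_all
    show "finite (S e)" using * by (intro finite_subset[OF _ finite_atLeastAtMost[of 1 "n (fst e)"]]) simp
    show "finite (T e)" using * by (intro finite_subset[OF _ finite_atLeastAtMost[of 1 "n (snd e)"]]) simp
  qed
  have B: "(\<Sum>w\<in>nbrs E b. m (b, w)) = n b" if b: "b \<in> B" for b
  proof -
    note * = bspec[OF col'[THEN conjunct2, THEN conjunct1] b]
    have e: "(b, w) \<in> E" if "w \<in> nbrs E b" for w using that nbrs_B[OF b] by simp
    have "(\<Sum>w\<in>nbrs E b. m (b, w)) = (\<Sum>w\<in>nbrs E b. card (S (b, w)))"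
      using card(1)[OF e] by simp
    also have "\<dots> = card (\<Union>w\<in>nbrs E b. S (b, w))"
      using *[THEN conjunct2] card(3)[OF e] finite_nbrs
      by (intro card_UN_disjoint[symmetric]) (auto simp: disjoint_family_on_def)
    also have "\<dots> = n b" using * by simp
    finally show ?thesis .
  qed
  have W: "(\<Sum>b\<in>nbrs E w. m (b, w)) = n w" if w: "w \<in> W" for w
  proof -
    note * = bspec[OF col'[THEN conjunct2, THEN conjunct2] w]
    have e: "(b, w) \<in> E" if "b \<in> nbrs E w" for b using that nbrs_W[OF w] by simp
    have "(\<Sum>b\<in>nbrs E w. m (b, w)) = (\<Sum>b\<in>nbrs E w. card (T (b, w)))"
      using card(2)[OF e] by simp
    also have "\<dots> = card (\<Union>b\<in>nbrs E w. T (b, w))"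
      using *[THEN conjunct2] card(4)[OF e] finite_nbrs
      by (intro card_UN_disjoint[symmetric]) (auto simp: disjoint_family_on_def)
    also have "\<dots> = n w" using * by simp
    finally show ?thesis .
  qed
  show ?thesis unfolding multiwebs_def using m0 B W by blast
qed

lemma finite_multiwebs: "finite (multiwebs B W E n)"
proof (rule finite_subset)
  let ?M = "\<Sum>b\<in>B. n b"
  show "multiwebs B W E n \<subseteq> {m. \<forall>e. (e \<in> E \<longrightarrow> m e \<in> {..?M}) \<and> (e \<notin> E \<longrightarrow> m e = 0)}"
  proof (rule subsetI, rule CollectI, rule allI, rule conjI; rule impI)
    fix m e assume m: "m \<in> multiwebs B W E n" and e: "e \<in> E"
    obtain b w where bw: "e = (b, w)" by (cases e)
    have b: "b \<in> B" "w \<in> nbrs E b" using e E_mem bw by (auto simp: nbrs_def)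
    have "m (b, w) \<le> (\<Sum>w\<in>nbrs E b. m (b, w))" using b(2) finite_nbrs by (intro member_le_sum) auto
    also have "\<dots> = n b" using m b(1) by (simp add: multiwebs_def)
    also have "\<dots> \<le> ?M" using b(1) finite_B by (intro member_le_sum) auto
    finally show "m e \<in> {..?M}" by (simp add: bw)
  next
    fix m e assume "m \<in> multiwebs B W E n" "e \<notin> E"
    then show "m e = 0" by (cases e) (simp add: multiwebs_def)
  qed
  show "finite {m. \<forall>e. (e \<in> E \<longrightarrow> m e \<in> {..?M}) \<and> (e \<notin> E \<longrightarrow> m e = (0::nat))}"
    by (rule finite_set_of_finite_funs[OF finite_E]) simp
qed

lemma finite_colorings: "finite (colorings B W E n m)"
proof (rule finite_subset)
  define U where "U = (\<Union>v\<in>B \<union> W. {1..n v})"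
  let ?X = "{S. \<forall>e. (e \<in> E \<longrightarrow> S e \<in> Pow U) \<and> (e \<notin> E \<longrightarrow> S e = {})}"
  show "colorings B W E n m \<subseteq> ?X \<times> ?X"
  proof (rule subsetI)
    fix x assume x: "x \<in> colorings B W E n m"
    obtain S T where ST: "x = (S, T)" by (cases x)
    note col = x[unfolded ST colorings_def mem_Collect_eq prod.case]
    have "S e \<subseteq> U" "T e \<subseteq> U" if "e \<in> E" for e
    proof -
      have "S e \<subseteq> {1..n (fst e)}" "T e \<subseteq> {1..n (snd e)}"
        using bspec[OF col[THEN conjunct2, THEN conjunct1] that] by simp_all
      moreover have "fst e \<in> B" "snd e \<in> W" using that E_mem[of "fst e" "snd e"] by simp_all
      ultimately show "S e \<subseteq> U" "T e \<subseteq> U" unfolding U_def by blast+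
    qed
    then show "x \<in> ?X \<times> ?X" using col[THEN conjunct1] unfolding ST by blast
  qed
  have "finite U" using finite_B finite_W by (simp add: U_def)
  then have "finite ?X" by (intro finite_set_of_finite_funs[OF finite_E]) simp
  then show "finite (?X \<times> ?X)" by simp
qed

end

context indexed_graph
begin

definition good :: "(nat \<Rightarrow> nat) \<Rightarrow> bool" where
  "good p \<longleftrightarrow> p permutes {..<N} \<and> (\<forall>k<N. strand p k \<in> E)"

definition rows :: "(nat \<Rightarrow> nat) \<Rightarrow> 'a \<times> 'a \<Rightarrow> nat set" where
  "rows p e = {k \<in> {..<N}. strand p k = e}"

definition mult :: "(nat \<Rightarrow> nat) \<Rightarrow> 'a \<times> 'a \<Rightarrow> nat" where
  "mult p e = card (rows p e)"

definition colS :: "(nat \<Rightarrow> nat) \<Rightarrow> 'a \<times> 'a \<Rightarrow> nat set" where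
  "colS p e = (\<lambda>k. snd (c (p k))) ` rows p e"

definition colT :: "(nat \<Rightarrow> nat) \<Rightarrow> 'a \<times> 'a \<Rightarrow> nat set" where
  "colT p e = (\<lambda>k. snd (r k)) ` rows p e"

lemma rows_iff: "k \<in> rows p (b, w) \<longleftrightarrow> k < N \<and> fst (c (p k)) = b \<and> fst (r k) = w"
  by (simp add: rows_def strand_def)

lemma inj_on_rows:
  assumes p: "p permutes {..<N}"
  shows "inj_on (\<lambda>k. snd (c (p k))) (rows p e)" "inj_on (\<lambda>k. snd (r k)) (rows p e)"
proof -
  obtain b w where e: "e = (b, w)" by (cases e)
  show "inj_on (\<lambda>k. snd (c (p k))) (rows p e)"
  proof (rule inj_onI)
    fix k l assume "k \<in> rows p e" "l \<in> rows p e" and eq: "snd (c (p k)) = snd (c (p l))"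
    then have kl: "k < N" "l < N" "fst (c (p k)) = fst (c (p l))" by (simp_all add: e rows_iff)
    then have "p k < N" "p l < N" using permutes_in_image[OF p, of k] permutes_in_image[OF p, of l] by simp_all
    then have "p k = p l" using c_inj[of "p k" "p l"] kl(3) eq by (simp add: prod_eq_iff)
    then show "k = l" using injD[OF permutes_inj[OF p]] by blast
  qed
  show "inj_on (\<lambda>k. snd (r k)) (rows p e)"
  proof (rule inj_onI)
    fix k l assume "k \<in> rows p e" "l \<in> rows p e" and eq: "snd (r k) = snd (r l)"
    then have kl: "k < N" "l < N" "fst (r k) = fst (r l)" by (simp_all add: e rows_iff)
    then show "k = l" using r_inj[of k l] eq by (simp add: prod_eq_iff)
  qed
qed

lemma good_coloring:
  assumes "good p"
  shows "(colS p, colT p) \<in> colorings B W E n (mult p)" "mult p \<in> multiwebs B W E n"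
proof -
  have p: "p permutes {..<N}" and pE: "\<And>k. k < N \<Longrightarrow> strand p k \<in> E" using assms by (simp_all add: good_def)
  have pN: "p k < N" if "k < N" for k using permutes_in_image[OF p, of k] that by simp
  have out: "rows p e = {}" if "e \<notin> E" for e using that pE by (auto simp: rows_def)
  have sub: "colS p e \<subseteq> {1..n (fst e)}" "colT p e \<subseteq> {1..n (snd e)}" for e
  proof -
    obtain b w where e: "e = (b, w)" by (cases e)
    show "colS p e \<subseteq> {1..n (fst e)}"
    proof
      fix j assume "j \<in> colS p e"
      then obtain k where "k < N" "fst (c (p k)) = b" "j = snd (c (p k))" by (auto simp: colS_def e rows_iff)
      then show "j \<in> {1..n (fst e)}" using c_mem[OF pN, of k] by (simp add: e)
    qed
    show "colT p e \<subseteq> {1..n (snd e)}"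
    proof
      fix j assume "j \<in> colT p e"
      then obtain k where "k < N" "fst (r k) = w" "j = snd (r k)" by (auto simp: colT_def e rows_iff)
      then show "j \<in> {1..n (snd e)}" using r_mem[of k] by (simp add: e)
    qed
  qed
  have card: "card (colS p e) = mult p e" "card (colT p e) = mult p e" for e
    unfolding colS_def colT_def mult_def by (intro card_image inj_on_rows[OF p])+
  have B: "(\<Union>w\<in>nbrs E b. colS p (b, w)) = {1..n b}" "disjoint_family_on (\<lambda>w. colS p (b, w)) (nbrs E b)" if b: "b \<in> B" for b
  proof -
    show "(\<Union>w\<in>nbrs E b. colS p (b, w)) = {1..n b}"
    proof (rule subset_antisym)
      show "(\<Union>w\<in>nbrs E b. colS p (b, w)) \<subseteq> {1..n b}" using sub(1)[of "(b, w)" for w] by fastforce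
      show "{1..n b} \<subseteq> (\<Union>w\<in>nbrs E b. colS p (b, w))"
      proof
        fix j assume "j \<in> {1..n b}"
        then have "(b, j) \<in> c ` {..<N}" using c b by (simp add: bij_betw_def black_idx_def)
        then obtain i where i: "i < N" "c i = (b, j)" by auto
        obtain k where k: "k < N" "p k = i" using permutes_image[OF p] i(1) by (metis imageE lessThan_iff)
        have "(b, fst (r k)) \<in> E" using pE[OF k(1)] k(2) i(2) by (simp add: strand_def)
        then have "fst (r k) \<in> nbrs E b" using nbrs_B[OF b] by simp
        moreover have "k \<in> rows p (b, fst (r k))" using k i by (simp add: rows_iff)
        then have "snd (c (p k)) \<in> colS p (b, fst (r k))" unfolding colS_def by (rule imageI)
        ultimately show "j \<in> (\<Union>w\<in>nbrs E b. colS p (b, w))" using k i by auto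
      qed
    qed
    show "disjoint_family_on (\<lambda>w. colS p (b, w)) (nbrs E b)"
    proof (unfold disjoint_family_on_def, intro ballI impI)
      fix w w' :: 'a assume ne: "w \<noteq> w'"
      have False if mem: "j \<in> colS p (b, w)" "j \<in> colS p (b, w')" for j
      proof -
        obtain k where k: "k < N" "fst (c (p k)) = b" "fst (r k) = w" "snd (c (p k)) = j"
          using mem(1) by (auto simp: colS_def rows_iff)
        obtain l where l: "l < N" "fst (c (p l)) = b" "fst (r l) = w'" "snd (c (p l)) = j"
          using mem(2) by (auto simp: colS_def rows_iff)
        have "p k = p l" using c_inj[OF pN[OF k(1)] pN[OF l(1)]] k l by (simp add: prod_eq_iff)
        then have "k = l" using injD[OF permutes_inj[OF p]] by blast
        then show False using k(3) l(3) ne by simp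
      qed
      then show "colS p (b, w) \<inter> colS p (b, w') = {}" by blast
    qed
  qed
  have W: "(\<Union>b\<in>nbrs E w. colT p (b, w)) = {1..n w}" "disjoint_family_on (\<lambda>b. colT p (b, w)) (nbrs E w)" if w: "w \<in> W" for w
  proof -
    show "(\<Union>b\<in>nbrs E w. colT p (b, w)) = {1..n w}"
    proof (rule subset_antisym)
      show "(\<Union>b\<in>nbrs E w. colT p (b, w)) \<subseteq> {1..n w}" using sub(2)[of "(b, w)" for b] by fastforce
      show "{1..n w} \<subseteq> (\<Union>b\<in>nbrs E w. colT p (b, w))"
      proof
        fix a assume "a \<in> {1..n w}"
        then have "(w, a) \<in> r ` {..<N}" using r w by (simp add: bij_betw_def white_idx_def)
        then obtain k where k: "k < N" "r k = (w, a)" by auto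
        have "(fst (c (p k)), w) \<in> E" using pE[OF k(1)] k(2) by (simp add: strand_def)
        then have "fst (c (p k)) \<in> nbrs E w" using nbrs_W[OF w] by simp
        moreover have "k \<in> rows p (fst (c (p k)), w)" using k by (simp add: rows_iff)
        then have "snd (r k) \<in> colT p (fst (c (p k)), w)" unfolding colT_def by (rule imageI)
        ultimately show "a \<in> (\<Union>b\<in>nbrs E w. colT p (b, w))" using k by auto
      qed
    qed
    show "disjoint_family_on (\<lambda>b. colT p (b, w)) (nbrs E w)"
    proof (unfold disjoint_family_on_def, intro ballI impI)
      fix b b' :: 'a assume ne: "b \<noteq> b'"
      have False if mem: "a \<in> colT p (b, w)" "a \<in> colT p (b', w)" for a
      proof -
        obtain k where k: "k < N" "fst (c (p k)) = b" "fst (r k) = w" "snd (r k) = a"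
          using mem(1) by (auto simp: colT_def rows_iff)
        obtain l where l: "l < N" "fst (c (p l)) = b'" "fst (r l) = w" "snd (r l) = a"
          using mem(2) by (auto simp: colT_def rows_iff)
        have "k = l" using r_inj[OF k(1) l(1)] k l by (simp add: prod_eq_iff)
        then show False using k(2) l(2) ne by simp
      qed
      then show "colT p (b, w) \<inter> colT p (b', w) = {}" by blast
    qed
  qed
  have o: "\<forall>e. e \<notin> E \<longrightarrow> colS p e = {} \<and> colT p e = {}" using out by (simp add: colS_def colT_def)
  show col: "(colS p, colT p) \<in> colorings B W E n (mult p)"
    unfolding colorings_def mem_Collect_eq prod.case by (intro conjI ballI) (assumption | rule o sub card B W)+
  show "mult p \<in> multiwebs B W E n"
    by (rule coloring_multiweb[OF col]) (simp add: mult_def out)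
qed

lemma det_expand:
  "det (Ktilde E eps phi r c N) = (\<Sum>p | good p. real_of_int (sign p) *
      (\<Prod>k<N. eps (strand p k) * phi (strand p k) (snd (r k)) (snd (c (p k)))))"
proof -
  let ?K = "Ktilde E eps phi r c N"
  let ?u = "\<lambda>p. \<Prod>k<N. eps (strand p k) * phi (strand p k) (snd (r k)) (snd (c (p k)))"
  have entry: "?K $$ (k, p k) = (if strand p k \<in> E then eps (strand p k) * phi (strand p k) (snd (r k)) (snd (c (p k))) else 0)"
    if "p permutes {..<N}" "k < N" for p k
    using that permutes_in_image[OF that(1), of k] by (simp add: Ktilde_def strand_def Let_def split_def)
  have "det ?K = (\<Sum>p | p permutes {..<N}. real_of_int (sign p) * (\<Prod>k<N. ?K $$ (k, p k)))"
    using det_def'[of ?K N] by (simp add: Ktilde_def atLeast0LessThan)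
  also have "\<dots> = (\<Sum>p | good p. real_of_int (sign p) * (\<Prod>k<N. ?K $$ (k, p k)))"
  proof (rule sum.mono_neutral_right)
    show "\<forall>p\<in>{p. p permutes {..<N}} - {p. good p}. real_of_int (sign p) * (\<Prod>k<N. ?K $$ (k, p k)) = 0"
    proof
      fix p assume "p \<in> {p. p permutes {..<N}} - {p. good p}"
      then obtain k where p: "p permutes {..<N}" and k: "k < N" "strand p k \<notin> E" by (auto simp: good_def)
      then have "?K $$ (k, p k) = 0" using entry by simp
      then have "(\<Prod>k<N. ?K $$ (k, p k)) = 0" using k(1) by (intro prod_zero) auto
      then show "real_of_int (sign p) * (\<Prod>k<N. ?K $$ (k, p k)) = 0" by simp
    qed
  qed (auto simp: good_def finite_permutations)
  also have "\<dots> = (\<Sum>p | good p. real_of_int (sign p) * ?u p)"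
  proof (rule sum.cong[OF refl])
    fix p assume "p \<in> {p. good p}"
    then have "(\<Prod>k<N. ?K $$ (k, p k)) = ?u p" by (intro prod.cong refl) (simp add: good_def entry)
    then show "real_of_int (sign p) * (\<Prod>k<N. ?K $$ (k, p k)) = real_of_int (sign p) * ?u p" by simp
  qed
  finally show ?thesis .
qed

end

context colored_web
begin

lemma fiber_eq: "{p \<in> {p. good p}. (mult p, colS p, colT p) = (m, S, T)} = {p. compatible p}"
proof (intro equalityI subsetI)
  fix p assume "p \<in> {p \<in> {p. good p}. (mult p, colS p, colT p) = (m, S, T)}"
  then have g: "good p" "colS p = S" "colT p = T" by auto
  have "fst (c (p k)) = fst (row_edge k) \<and> snd (c (p k)) \<in> S (row_edge k)" if k: "k < N" for k
  proof -
    have row: "k \<in> rows p (strand p k)" using k by (simp add: rows_def)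
    have e: "strand p k \<in> E" using g(1) k by (simp add: good_def)
    have "snd (r k) \<in> T (strand p k)" unfolding g(3)[symmetric] colT_def using row by (rule imageI)
    then have "black_of (fst (r k)) (snd (r k)) = fst (c (p k))"
      using edge_nbrs[OF e] by (intro black_of_eq) (simp_all add: strand_def)
    then have eq: "row_edge k = strand p k" by (simp add: row_edge_def strand_def)
    have "snd (c (p k)) \<in> S (strand p k)" unfolding g(2)[symmetric] colS_def using row by (rule imageI)
    then show ?thesis unfolding eq by (simp add: strand_def)
  qed
  then show "p \<in> {p. compatible p}" using g(1) by (simp add: compatible_def good_def)
next
  fix p assume "p \<in> {p. compatible p}"
  then have comp: "compatible p" by simp
  then have p: "p permutes {..<N}" by (simp add: compatible_def)
  have st: "strand p k = row_edge k" if "k < N" for k using strand_compatible[OF comp that] .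
  have g: "good p" using p st row_edge_E by (simp add: good_def)
  have rows: "rows p e = row_at e ` {..<m e}" if "e \<in> E" for e
    using row_at_bij[OF that] st by (auto simp: rows_def bij_betw_def)
  have rows0: "rows p e = {}" if "e \<notin> E" for e using that st row_edge_E by (auto simp: rows_def)
  have "mult p e = m e" for e
  proof (cases "e \<in> E")
    case True
    then show ?thesis using card_image[OF bij_betw_imp_inj_on[OF row_at_bij[OF True]]]
      unfolding mult_def rows[OF True] by (simp only: card_lessThan)
  qed (simp add: mult_def rows0 ST_outside)
  then have mult: "mult p = m" by blast
  have "colT p e = T e" for e
  proof (cases "e \<in> E")
    case True
    have "colT p e = enum_of (T e) ` {..<m e}"
      unfolding colT_def rows[OF True] image_image by (intro image_cong refl) (simp add: row_at(2)[OF True])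
    then show ?thesis using enum_of_bij[OF T_props(3)[OF True]] T_props(2)[OF True] by (simp add: bij_betw_def)
  qed (simp add: colT_def rows0 ST_outside)
  then have T: "colT p = T" by blast
  have "colS p e = S e" for e
  proof (cases "e \<in> E")
    case True
    have "colS p e \<subseteq> S e" using comp st by (auto simp: colS_def rows_def compatible_def)
    moreover have "card (colS p e) = card (S e)"
      unfolding colS_def card_image[OF inj_on_rows(1)[OF p]] S_props(2)[OF True] mult[symmetric] mult_def ..
    ultimately show ?thesis using card_subset_eq[OF S_props(3)[OF True]] by blast
  qed (simp add: colS_def rows0 ST_outside)
  then have "colS p = S" by blast
  then show "p \<in> {p \<in> {p. good p}. (mult p, colS p, colT p) = (m, S, T)}" using g mult T by simp
qed

end

context indexed_graph
begin

lemma det_eq_sum_traces: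
  "det (Ktilde E eps phi r c N) =
    (\<Sum>m\<in>multiwebs B W E n. sign_r * sign_c * Phi {e \<in> E. odd (m e)} * trace B W E rot cil n phi m)"
proof -
  define u where "u p = real_of_int (sign p) *
      (\<Prod>k<N. eps (strand p k) * phi (strand p k) (snd (r k)) (snd (c (p k))))" for p
  define t where "t m S T = real_of_int (\<Prod>v\<in>B \<union> W. vertex_sign B E rot cil n S T v) *
      (\<Prod>e\<in>{e \<in> E. m e > 0}. subdet (phi e) (T e) (S e))" for m :: "'a \<times> 'a \<Rightarrow> nat" and S T
  let ?M = "multiwebs B W E n" and ?C = "colorings B W E n"
  let ?g = "\<lambda>p. (mult p, colS p, colT p)"
  have fin: "finite {p. good p}"
    by (rule finite_subset[OF _ finite_permutations[of "{..<N}"]]) (auto simp: good_def)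
  have "det (Ktilde E eps phi r c N) = (\<Sum>p | good p. u p)"
    unfolding u_def by (rule det_expand)
  also have "\<dots> = (\<Sum>x\<in>Sigma ?M ?C. \<Sum>p\<in>{p \<in> {p. good p}. ?g p = x}. u p)"
    using good_coloring
    by (intro sum.group[symmetric] fin finite_SigmaI finite_multiwebs finite_colorings) auto
  also have "\<dots> = (\<Sum>(m, x)\<in>Sigma ?M ?C. sign_r * sign_c * Phi {e \<in> E. odd (m e)} * (case x of (S, T) \<Rightarrow> t m S T))"
  proof (rule sum.cong[OF refl])
    fix x assume x: "x \<in> Sigma ?M ?C"
    obtain m S T where mST: "x = (m, S, T)" by (cases x)
    interpret colored_web B W E rot Fo n cil eps key r c N m S T
      by unfold_locales (use x mST in auto)
    have "(\<Sum>p\<in>{p \<in> {p. good p}. ?g p = x}. u p) = (\<Sum>p | compatible p. u p)"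
      unfolding mST fiber_eq ..
    also have "\<dots> = sign_r * sign_c * Phi {e \<in> E. odd (m e)} * t m S T"
      unfolding u_def t_def by (rule fiber_sum)
    finally show "(\<Sum>p\<in>{p \<in> {p. good p}. ?g p = x}. u p) =
      (case x of (m, x) \<Rightarrow> sign_r * sign_c * Phi {e \<in> E. odd (m e)} * (case x of (S, T) \<Rightarrow> t m S T))"
      by (simp add: mST)
  qed
  also have "\<dots> = (\<Sum>m\<in>?M. \<Sum>x\<in>?C m. sign_r * sign_c * Phi {e \<in> E. odd (m e)} * (case x of (S, T) \<Rightarrow> t m S T))"
    by (rule sum.Sigma[symmetric, OF finite_multiwebs]) (simp add: finite_colorings)
  also have "\<dots> = (\<Sum>m\<in>?M. sign_r * sign_c * Phi {e \<in> E. odd (m e)} * trace B W E rot cil n phi m)"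
    unfolding trace_def t_def sum_distrib_left ..
  finally show ?thesis .
qed

lemma signs_pm_one: "sign_r \<in> {1, -1}" "sign_c \<in> {1, -1}" "z \<subseteq> E \<Longrightarrow> Phi z \<in> {1, -1}"
proof -
  have n: "negif P \<in> {1, -1}" for P by (simp add: negif_def)
  show "sign_r \<in> {1, -1}" "sign_c \<in> {1, -1}" unfolding sign_r_def sign_c_def by (intro prod_pm_one n)+
  assume z: "z \<subseteq> E"
  have "prod eps z \<in> {1, -1}" using z kast by (intro prod_pm_one) (auto simp: kasteleyn_def)
  moreover have "(\<Prod>e\<in>z. \<Prod>e'\<in>z. J e e') \<in> {1, -1}" unfolding J_def by (intro prod_pm_one n)
  ultimately show "Phi z \<in> {1, -1}" unfolding Phi_def by auto
qed

lemma det_eq_signed_sum: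
  "\<exists>s\<in>{1, -1::real}. \<forall>phi. det (Ktilde E eps phi r c N)
     = s * (\<Sum>m\<in>multiwebs B W E n. trace B W E rot cil n phi m)"
proof (cases "multiwebs B W E n = {}")
  case True
  then show ?thesis by (intro bexI[of _ 1]) (simp_all add: det_eq_sum_traces)
next
  case False
  then obtain m0 where m0: "m0 \<in> multiwebs B W E n" by blast
  let ?z = "\<lambda>m. {e \<in> E. odd (m e :: nat)}"
  have const: "Phi (?z m) = Phi (?z m0)" if "m \<in> multiwebs B W E n" for m
    by (rule Phi_const) (use bd_odd_multiweb[OF m0] bd_odd_multiweb[OF that] in auto)
  let ?s = "sign_r * sign_c * Phi (?z m0)"
  have "?s \<in> {1, -1}" using signs_pm_one(1,2) signs_pm_one(3)[of "?z m0"] by auto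
  moreover have "det (Ktilde E eps phi r c N) = ?s * (\<Sum>m\<in>multiwebs B W E n. trace B W E rot cil n phi m)" for phi
    unfolding det_eq_sum_traces sum_distrib_left by (intro sum.cong refl) (simp add: const)
  ultimately show ?thesis by blast
qed

end

theorem theorem3:
  fixes B W :: "'v set" and E :: "('v \<times> 'v) set" and rot :: "'v \<Rightarrow> 'v \<Rightarrow> 'v"
    and Fo :: "('v \<times> 'v) set set" and n :: "'v \<Rightarrow> nat" and cil :: "'v \<Rightarrow> 'v"
    and eps :: "'v \<times> 'v \<Rightarrow> real" and r c :: "nat \<Rightarrow> 'v \<times> nat"
  assumes "plane_bipartite B W E rot Fo"
    and "\<forall>v\<in>B \<union> W. n v > 0"
    and "(\<Sum>b\<in>B. n b) = (\<Sum>w\<in>W. n w)"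
    and "cilia B W E cil"
    and "kasteleyn E rot Fo n cil eps"
    and "bij_betw r {..<(\<Sum>w\<in>W. n w)} (white_idx W n)"
    and "bij_betw c {..<(\<Sum>w\<in>W. n w)} (black_idx B n)"
  shows "\<exists>s\<in>{1, -1::real}. \<forall>phi.
           det (Ktilde E eps phi r c (\<Sum>w\<in>W. n w))
             = s * (\<Sum>m\<in>multiwebs B W E n. trace B W E rot cil n phi m)"
proof -
  interpret plane_graph B W E rot Fo by unfold_locales fact
  obtain key :: "'v \<Rightarrow> nat" where "inj_on key (B \<union> W)"
    using finite_imp_inj_to_nat_seg[of "B \<union> W"] finite_B finite_W by auto
  then interpret indexed_graph B W E rot Fo n cil eps key r c "\<Sum>w\<in>W. n w"
    using assms(4-7) by unfold_locales
  show ?thesis by (rule det_eq_signed_sum)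
qed

end
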